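(* The points (up to isomorphism) of the topos $\mathrm{M}_2^{\mathrm{ns}}(\mathbb{Z})\text{-}\mathsf{Set}$ are given by the double quotient $$\mathrm{GL}_2(\widehat{\mathbb{Z}})\backslash \mathrm{M}_2(\mathbb{A}_f)/\mathrm{GL}_2(\mathbb{Q}),$$ that is, the assignment $x\mapsto\pi(x)$ described in the context induces a bijection from this double quotient to the set of isomorphism classes of points. Moreover, these points are in bijective correspondence with the isomorphism classes (as abelian groups) of subgroups $A$ with $\mathbb{Z}^2\subseteq A\subseteq\mathbb{Q}^2$.
   Context: $\mathrm{M}_2^{\mathrm{ns}}(\mathbb{Z})$ is the monoid (under multiplication) of $2\times 2$ integer matrices with nonzero determinant; $\mathrm{M}_2^{\mathrm{ns}}(\mathbb{Z})\text{-}\mathsf{Set}$ is the topos of sets with a left action of it and equivariant maps. $\widehat{\mathbb{Z}}=\prod_p\mathbb{Z}_p$ and $\mathbb{A}_f=\widehat{\mathbb{Z}}\otimes\mathbb{Q}$ is the ring of finite adeles. In the double quotient, $\mathrm{GL}_2(\widehat{\mathbb{Z}})$ acts by left multiplication and $\mathrm{GL}_2(\mathbb{Q})$ by right multiplication. Every double coset has a representative in $\mathrm{M}_2(\widehat{\mathbb{Z}})$. Let $X=\mathrm{GL}_2(\mathbb{Z})\backslash \mathrm{M}_2^{\mathrm{ns}}(\mathbb{Z})$, with a chosen matrix representative for each element, viewed inside $\hat X=\mathrm{GL}_2(\widehat{\mathbb{Z}})\backslash \mathrm{M}_2(\widehat{\mathbb{Z}})$, where $\hat X$ is partially ordered by $a\le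 b$ iff $b=ma$ for some $m\in \mathrm{M}_2(\widehat{\mathbb{Z}})$. For $x\in\hat X$, $\pi(x)$ is the point of $\mathrm{M}_2^{\mathrm{ns}}(\mathbb{Z})\text{-}\mathsf{Set}$ with inverse image functor $\pi(x)^*N=\varinjlim_{m\in X,\ m\le x}N$ (a colimit of sets), where for $m\le m'$ with $m'=am$ the transition map $N\to N$ is the action of $a$. Two points are isomorphic if their inverse image functors are naturally isomorphic. *)

theory Defs
  imports
    "HOL-Analysis.Analysis"
    "HOL-Algebra.Group"
    "HOL-Number_Theory.Cong"
begin

section \<open>Profinite integers and finite adeles\<close>

(* Z_p as the inverse limit of the rings Z/p^k, each with carrier {0..<p^k} *)
definition padic_ints :: "nat \<Rightarrow> (nat \<Rightarrow> int) set" where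
  "padic_ints p = {a. \<forall>k. a k \<in> {0..<int p ^ k} \<and> a (Suc k) mod int p ^ k = a k}"

lemma padic_intsI:
  assumes "p > 0" "\<And>k. [f (Suc k) = f k] (mod (int p ^ k))"
  shows "(\<lambda>k. f k mod int p ^ k) \<in> padic_ints p"
proof -
  have "f (Suc k) mod int p ^ Suc k mod int p ^ k = f k mod int p ^ k" for k
  proof -
    have "f (Suc k) mod int p ^ Suc k mod int p ^ k = f (Suc k) mod int p ^ k"
      by (intro mod_mod_cancel le_imp_power_dvd) simp
    then show ?thesis
      using assms(2)[of k] by (simp add: cong_def)
  qed
  then show ?thesis
    using assms(1) by (auto simp: padic_ints_def)
qed

lemma padic_ints_cong:
  assumes "a \<in> padic_ints p"
  shows "[a (Suc k) = a k] (mod (int p ^ k))"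
  using assms by (auto simp: padic_ints_def cong_def)

lemma padic_ints_add:
  assumes "p > 0" "a \<in> padic_ints p" "b \<in> padic_ints p"
  shows "(\<lambda>k. (a k + b k) mod int p ^ k) \<in> padic_ints p"
  by (rule padic_intsI[OF assms(1)]) (rule cong_add[OF assms(2,3)[THEN padic_ints_cong]])

lemma padic_ints_mult:
  assumes "p > 0" "a \<in> padic_ints p" "b \<in> padic_ints p"
  shows "(\<lambda>k. (a k * b k) mod int p ^ k) \<in> padic_ints p"
  by (rule padic_intsI[OF assms(1)]) (rule cong_mult[OF assms(2,3)[THEN padic_ints_cong]])

lemma padic_ints_mod:
  assumes "a \<in> padic_ints p"
  shows "a k mod int p ^ k = a k"
  using assms by (auto simp: padic_ints_def)

lemma padic_ints_mod_add:
  assumes "a \<in> padic_ints p"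
  shows "a (k + j) mod int p ^ k = a k"
proof (induction j)
  case 0
  show ?case using padic_ints_mod[OF assms] by simp
next
  case (Suc j)
  have "a (k + Suc j) mod int p ^ k = a (Suc (k + j)) mod int p ^ (k + j) mod int p ^ k"
    by (simp add: mod_mod_cancel le_imp_power_dvd)
  then show ?case
    using Suc padic_ints_cong[OF assms, of "k + j"] padic_ints_mod[OF assms, of "k + j"]
    by (simp add: cong_def)
qed

typedef zhat = "\<Pi>\<^sub>E p\<in>{p::nat. prime p}. padic_ints p"
  morphisms zhat_comp Abs_zhat
proof -
  have "(\<lambda>k. 0 mod int p ^ k) \<in> padic_ints p" if "prime p" for p
    using that by (intro padic_intsI) (auto simp: prime_gt_0_nat)
  then have "(\<lambda>p\<in>{p. prime p}. \<lambda>k. 0 mod int p ^ k) \<in> (\<Pi>\<^sub>E p\<in>{p::nat. prime p}. padic_ints p)"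
    by (intro restrict_PiE_iff[THEN iffD2]) auto
  then show ?thesis by blast
qed

setup_lifting type_definition_zhat

lemma zhat_comp_padic: "prime p \<Longrightarrow> zhat_comp x p \<in> padic_ints p"
  using zhat_comp[of x] by (auto simp: PiE_iff)

lemmas zhat_comp_cong = padic_ints_cong[OF zhat_comp_padic]
lemmas zhat_comp_mod = padic_ints_mod[OF zhat_comp_padic]

lemma zhat_eqI:
  assumes "\<And>p k. prime p \<Longrightarrow> zhat_comp x p k = zhat_comp y p k"
  shows "x = y"
proof -
  have "zhat_comp x = zhat_comp y"
    by (rule PiE_ext[OF zhat_comp zhat_comp]) (auto simp: assms)
  then show ?thesis by (simp add: zhat_comp_inject)
qed

instantiation zhat :: comm_ring_1
begin

lift_definition zero_zhat :: zhat is "\<lambda>p\<in>{p. prime p}. \<lambda>k. 0 mod int p ^ k"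
  by (intro restrict_PiE_iff[THEN iffD2] ballI padic_intsI) (auto simp: prime_gt_0_nat)

lift_definition one_zhat :: zhat is "\<lambda>p\<in>{p. prime p}. \<lambda>k. 1 mod int p ^ k"
  by (intro restrict_PiE_iff[THEN iffD2] ballI padic_intsI) (auto simp: prime_gt_0_nat)

lift_definition plus_zhat :: "zhat \<Rightarrow> zhat \<Rightarrow> zhat"
  is "\<lambda>x y. \<lambda>p\<in>{p. prime p}. \<lambda>k. (x p k + y p k) mod int p ^ k"
  by (intro restrict_PiE_iff[THEN iffD2] ballI padic_ints_add) (auto simp: prime_gt_0_nat PiE_iff)

lift_definition times_zhat :: "zhat \<Rightarrow> zhat \<Rightarrow> zhat"
  is "\<lambda>x y. \<lambda>p\<in>{p. prime p}. \<lambda>k. (x p k * y p k) mod int p ^ k"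
  by (intro restrict_PiE_iff[THEN iffD2] ballI padic_ints_mult) (auto simp: prime_gt_0_nat PiE_iff)

lift_definition uminus_zhat :: "zhat \<Rightarrow> zhat"
  is "\<lambda>x. \<lambda>p\<in>{p. prime p}. \<lambda>k. (- x p k) mod int p ^ k"
  by (intro restrict_PiE_iff[THEN iffD2] ballI padic_intsI)
     (auto simp: prime_gt_0_nat PiE_iff cong_minus_minus_iff intro!: padic_ints_cong)

definition minus_zhat :: "zhat \<Rightarrow> zhat \<Rightarrow> zhat" where
  "minus_zhat x y = x + - y"

lemma zhat_comp_simps:
  assumes "prime p"
  shows "zhat_comp 0 p k = 0" "zhat_comp 1 p k = 1 mod int p ^ k"
    "zhat_comp (x + y) p k = (zhat_comp x p k + zhat_comp y p k) mod int p ^ k"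
    "zhat_comp (x * y) p k = (zhat_comp x p k * zhat_comp y p k) mod int p ^ k"
    "zhat_comp (- x) p k = (- zhat_comp x p k) mod int p ^ k"
  using assms
  by (simp_all add: zero_zhat.rep_eq one_zhat.rep_eq plus_zhat.rep_eq times_zhat.rep_eq
      uminus_zhat.rep_eq)

instance
proof
  fix a b c :: zhat
  show "a * b * c = a * (b * c)"
    by (rule zhat_eqI) (simp add: zhat_comp_simps mod_simps mult.assoc)
  show "a * b = b * a"
    by (rule zhat_eqI) (simp add: zhat_comp_simps mult.commute)
  show "1 * a = a"
    by (rule zhat_eqI) (simp add: zhat_comp_simps mod_simps zhat_comp_mod)
  show "a + b + c = a + (b + c)"
    by (rule zhat_eqI) (simp add: zhat_comp_simps mod_simps add.assoc)
  show "a + b = b + a"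
    by (rule zhat_eqI) (simp add: zhat_comp_simps add.commute)
  show "0 + a = a"
    by (rule zhat_eqI) (simp add: zhat_comp_simps zhat_comp_mod)
  show "- a + a = 0"
    by (rule zhat_eqI) (simp add: zhat_comp_simps mod_simps)
  show "a - b = a + - b"
    by (simp add: minus_zhat_def)
  show "(a + b) * c = a * c + b * c"
    by (rule zhat_eqI) (simp add: zhat_comp_simps mod_simps distrib_right)
  have "zhat_comp 0 2 1 \<noteq> zhat_comp 1 2 1"
    by (simp add: zhat_comp_simps)
  then show "(0::zhat) \<noteq> 1" by metis
qed

end

lemma zhat_comp_of_nat: "prime p \<Longrightarrow> zhat_comp (of_nat n) p k = int n mod int p ^ k"
  by (induction n) (auto simp: zhat_comp_simps mod_simps)

lemma zhat_comp_of_int: "prime p \<Longrightarrow> zhat_comp (of_int n) p k = n mod int p ^ k"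
  by (cases n rule: int_cases2) (auto simp: zhat_comp_simps zhat_comp_of_nat mod_simps)

lemma zhat_torsion_free:
  fixes x :: zhat
  assumes "of_int n * x = 0" "n \<noteq> 0"
  shows "x = 0"
proof (rule zhat_eqI)
  fix p k assume p: "prime (p :: nat)"
  define v where "v = multiplicity (int p) n"
  have pi: "prime (int p)" using p by simp
  obtain m where m: "n = int p ^ v * m" "\<not> int p dvd m"
    using multiplicity_decompose'[of n "int p"] assms(2) pi
    unfolding v_def by (metis not_prime_unit)
  have "(n * zhat_comp x p (k + v)) mod int p ^ (k + v) = 0"
    using arg_cong[OF assms(1), of "\<lambda>y. zhat_comp y p (k + v)"] p
    by (simp add: zhat_comp_simps zhat_comp_of_int mod_simps)
  then have "int p ^ v * int p ^ k dvd int p ^ v * (m * zhat_comp x p (k + v))"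
    using m(1) by (auto simp: power_add mult_ac mod_eq_0_iff_dvd)
  then have "int p ^ k dvd m * zhat_comp x p (k + v)"
    using p by (simp add: prime_gt_0_nat)
  moreover have "coprime (int p ^ k) m"
    using m(2) pi by (simp add: prime_imp_coprime)
  ultimately have "int p ^ k dvd zhat_comp x p (k + v)"
    by (simp add: coprime_dvd_mult_right_iff)
  then show "zhat_comp x p k = zhat_comp 0 p k"
    using padic_ints_mod_add[OF zhat_comp_padic[OF p], of x k v] p
    by (simp add: zhat_comp_simps)
qed

lifting_update zhat.lifting
lifting_forget zhat.lifting

(* The tensor product of the profinite integers with Q, as the localization at the nonzero
   integers: a pair (x, n) with n \<noteq> 0 stands for x \<otimes> 1/n. *)
definition adele_rel :: "zhat \<times> int \<Rightarrow> zhat \<times> int \<Rightarrow> bool" where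
  "adele_rel = (\<lambda>x y. snd x \<noteq> 0 \<and> snd y \<noteq> 0 \<and> fst x * of_int (snd y) = fst y * of_int (snd x))"

lemma part_equivp_adele_rel: "part_equivp adele_rel"
proof (rule part_equivpI)
  show "\<exists>x. adele_rel x x"
    by (rule exI[of _ "(0, 1)"]) (simp add: adele_rel_def)
  show "symp adele_rel"
    by (auto simp: adele_rel_def symp_def)
  show "transp adele_rel"
  proof (rule transpI, unfold split_paired_all)
    fix a b c :: zhat and k l m :: int
    assume "adele_rel (a, k) (b, l)" "adele_rel (b, l) (c, m)"
    then have *: "k \<noteq> 0" "l \<noteq> 0" "m \<noteq> 0"
      "a * of_int l = b * of_int k" "b * of_int m = c * of_int l"
      by (auto simp: adele_rel_def)
    have "of_int l * (a * of_int m - c * of_int k)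
        = (a * of_int l) * of_int m - (c * of_int l) * of_int k"
      by (simp add: algebra_simps)
    also have "\<dots> = 0"
      by (simp add: *(4) *(5)[symmetric] algebra_simps)
    finally have "a * of_int m - c * of_int k = 0"
      using zhat_torsion_free *(2) by blast
    with * show "adele_rel (a, k) (c, m)"
      by (simp add: adele_rel_def)
  qed
qed

quotient_type adele = "zhat \<times> int" / partial: adele_rel
  by (rule part_equivp_adele_rel)

instantiation adele :: comm_ring_1
begin

lift_definition zero_adele :: adele is "(0, 1)"
  by (simp add: adele_rel_def)

lift_definition one_adele :: adele is "(1, 1)"
  by (simp add: adele_rel_def)

lift_definition plus_adele :: "adele \<Rightarrow> adele \<Rightarrow> adele"
  is "\<lambda>x y. (fst x * of_int (snd y) + fst y * of_int (snd x), snd x * snd y)"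
proof -
  fix a a' b b' :: "zhat \<times> int"
  assume "adele_rel a a'" "adele_rel b b'"
  then have nz: "snd a \<noteq> 0" "snd a' \<noteq> 0" "snd b \<noteq> 0" "snd b' \<noteq> 0"
    and a: "fst a * of_int (snd a') = fst a' * of_int (snd a)"
    and b: "fst b * of_int (snd b') = fst b' * of_int (snd b)"
    by (auto simp: adele_rel_def)
  have "(fst a * of_int (snd b) + fst b * of_int (snd a)) * (of_int (snd a') * of_int (snd b'))
      = (fst a * of_int (snd a')) * (of_int (snd b) * of_int (snd b'))
        + (fst b * of_int (snd b')) * (of_int (snd a) * of_int (snd a'))"
    by (simp add: algebra_simps)
  also have "\<dots> = (fst a' * of_int (snd b') + fst b' * of_int (snd a')) * (of_int (snd a) * of_int (snd b))"
    unfolding a b by (simp add: algebra_simps)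
  finally show "adele_rel
      (fst a * of_int (snd b) + fst b * of_int (snd a), snd a * snd b)
      (fst a' * of_int (snd b') + fst b' * of_int (snd a'), snd a' * snd b')"
    using nz by (simp add: adele_rel_def)
qed

lift_definition times_adele :: "adele \<Rightarrow> adele \<Rightarrow> adele"
  is "\<lambda>x y. (fst x * fst y, snd x * snd y)"
  unfolding adele_rel_def by (auto simp: ac_simps) (metis mult.assoc mult.left_commute)

lift_definition uminus_adele :: "adele \<Rightarrow> adele" is "\<lambda>x. (- fst x, snd x)"
  unfolding adele_rel_def by simp

definition minus_adele :: "adele \<Rightarrow> adele \<Rightarrow> adele" where
  "minus_adele x y = x + - y"

instance
proof
  fix a b c :: adele
  show "a * b * c = a * (b * c)"
    by transfer (simp add: adele_rel_def ac_simps)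
  show "a * b = b * a"
    by transfer (simp add: adele_rel_def ac_simps)
  show "1 * a = a"
    by transfer (simp add: adele_rel_def)
  show "a + b + c = a + (b + c)"
    by transfer (simp add: adele_rel_def algebra_simps)
  show "a + b = b + a"
    by transfer (simp add: adele_rel_def algebra_simps)
  show "0 + a = a"
    by transfer (simp add: adele_rel_def)
  show "- a + a = 0"
    by transfer (simp add: adele_rel_def)
  show "a - b = a + - b"
    by (simp add: minus_adele_def)
  show "(a + b) * c = a * c + b * c"
    by transfer (simp add: adele_rel_def algebra_simps)
  show "(0::adele) \<noteq> 1"
    by transfer (simp add: adele_rel_def)
qed

end

lift_definition zhat_to_adele :: "zhat \<Rightarrow> adele" is "\<lambda>x. (x, 1)"
  by (simp add: adele_rel_def)

lift_definition rat_to_adele :: "rat \<Rightarrow> adele"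
  is "\<lambda>q. (of_int (fst (quotient_of q)), snd (quotient_of q))"
  using quotient_of_denom_pos' by (auto simp: adele_rel_def less_imp_neq[THEN not_sym])

section \<open>Categories, functors, limits and adjunctions\<close>

(* Arrows do not determine their domain and codomain, so these are passed explicitly:
   ccomp C A B D g f is the composite of f : A \<rightarrow> B and g : B \<rightarrow> D. *)
record ('o, 'm) cat =
  obj :: "'o set"
  arr :: "'o \<Rightarrow> 'o \<Rightarrow> 'm set"
  cid :: "'o \<Rightarrow> 'm"
  ccomp :: "'o \<Rightarrow> 'o \<Rightarrow> 'o \<Rightarrow> 'm \<Rightarrow> 'm \<Rightarrow> 'm"

definition is_category :: "('o, 'm) cat \<Rightarrow> bool" where
  "is_category C \<longleftrightarrow>
     (\<forall>A\<in>obj C. cid C A \<in> arr C A A) \<and>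
     (\<forall>A\<in>obj C. \<forall>B\<in>obj C. \<forall>D\<in>obj C. \<forall>f\<in>arr C A B. \<forall>g\<in>arr C B D.
        ccomp C A B D g f \<in> arr C A D) \<and>
     (\<forall>A\<in>obj C. \<forall>B\<in>obj C. \<forall>f\<in>arr C A B.
        ccomp C A A B f (cid C A) = f \<and> ccomp C A B B (cid C B) f = f) \<and>
     (\<forall>A\<in>obj C. \<forall>B\<in>obj C. \<forall>D\<in>obj C. \<forall>E\<in>obj C.
        \<forall>f\<in>arr C A B. \<forall>g\<in>arr C B D. \<forall>h\<in>arr C D E.
        ccomp C A B E (ccomp C B D E h g) f = ccomp C A D E h (ccomp C A B D g f))"

record ('o, 'm, 'p, 'n) fctr =
  fobj :: "'o \<Rightarrow> 'p"
  farr :: "'o \<Rightarrow> 'o \<Rightarrow> 'm \<Rightarrow> 'n"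

definition is_functor ::
  "('o, 'm) cat \<Rightarrow> ('p, 'n) cat \<Rightarrow> ('o, 'm, 'p, 'n) fctr \<Rightarrow> bool" where
  "is_functor C D F \<longleftrightarrow>
     (\<forall>A\<in>obj C. fobj F A \<in> obj D) \<and>
     (\<forall>A\<in>obj C. \<forall>B\<in>obj C. \<forall>f\<in>arr C A B.
        farr F A B f \<in> arr D (fobj F A) (fobj F B)) \<and>
     (\<forall>A\<in>obj C. farr F A A (cid C A) = cid D (fobj F A)) \<and>
     (\<forall>A\<in>obj C. \<forall>B\<in>obj C. \<forall>E\<in>obj C. \<forall>f\<in>arr C A B. \<forall>g\<in>arr C B E.
        farr F A E (ccomp C A B E g f)
          = ccomp D (fobj F A) (fobj F B) (fobj F E) (farr F B E g) (farr F A B f))"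

definition is_iso_arr :: "('o, 'm) cat \<Rightarrow> 'o \<Rightarrow> 'o \<Rightarrow> 'm \<Rightarrow> bool" where
  "is_iso_arr C A B f \<longleftrightarrow> f \<in> arr C A B \<and>
     (\<exists>g\<in>arr C B A. ccomp C A B A g f = cid C A \<and> ccomp C B A B f g = cid C B)"

definition naturally_isomorphic ::
  "('o, 'm) cat \<Rightarrow> ('p, 'n) cat \<Rightarrow> ('o, 'm, 'p, 'n) fctr \<Rightarrow> ('o, 'm, 'p, 'n) fctr \<Rightarrow> bool" where
  "naturally_isomorphic C D F G \<longleftrightarrow>
     (\<exists>\<eta>. (\<forall>A\<in>obj C. is_iso_arr D (fobj F A) (fobj G A) (\<eta> A)) \<and>
          (\<forall>A\<in>obj C. \<forall>B\<in>obj C. \<forall>f\<in>arr C A B.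
             ccomp D (fobj F A) (fobj F B) (fobj G B) (\<eta> B) (farr F A B f)
               = ccomp D (fobj F A) (fobj G A) (fobj G B) (farr G A B f) (\<eta> A)))"

(* A finite diagram: finitely many objects d i (i \<in> I) and finitely many arrows
   (i, j, f) \<in> E with f : d i \<rightarrow> d j. Diagrams indexed by a finite category are the case in
   which E is closed under composition; no closure is needed to speak of cones. *)
definition finite_diagram ::
  "('o, 'm) cat \<Rightarrow> nat set \<Rightarrow> (nat \<Rightarrow> 'o) \<Rightarrow> (nat \<times> nat \<times> 'm) set \<Rightarrow> bool" where
  "finite_diagram C I d E \<longleftrightarrow> finite I \<and> finite E \<and> (\<forall>i\<in>I. d i \<in> obj C) \<and>
     (\<forall>(i, j, f)\<in>E. i \<in> I \<and> j \<in> I \<and> f \<in> arr C (d i) (d j))"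

definition is_cone ::
  "('o, 'm) cat \<Rightarrow> nat set \<Rightarrow> (nat \<Rightarrow> 'o) \<Rightarrow> (nat \<times> nat \<times> 'm) set \<Rightarrow> 'o \<Rightarrow> (nat \<Rightarrow> 'm) \<Rightarrow> bool" where
  "is_cone C I d E L l \<longleftrightarrow> L \<in> obj C \<and> (\<forall>i\<in>I. l i \<in> arr C L (d i)) \<and>
     (\<forall>(i, j, f)\<in>E. ccomp C L (d i) (d j) f (l i) = l j)"

definition is_limit ::
  "('o, 'm) cat \<Rightarrow> nat set \<Rightarrow> (nat \<Rightarrow> 'o) \<Rightarrow> (nat \<times> nat \<times> 'm) set \<Rightarrow> 'o \<Rightarrow> (nat \<Rightarrow> 'm) \<Rightarrow> bool" where
  "is_limit C I d E L l \<longleftrightarrow> is_cone C I d E L l \<and>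
     (\<forall>L' l'. is_cone C I d E L' l' \<longrightarrow>
        (\<exists>!h. h \<in> arr C L' L \<and> (\<forall>i\<in>I. ccomp C L' L (d i) (l i) h = l' i)))"

definition preserves_finite_limits ::
  "('o, 'm) cat \<Rightarrow> ('p, 'n) cat \<Rightarrow> ('o, 'm, 'p, 'n) fctr \<Rightarrow> bool" where
  "preserves_finite_limits C D F \<longleftrightarrow>
     (\<forall>I d E L l. finite_diagram C I d E \<longrightarrow> is_limit C I d E L l \<longrightarrow>
        is_limit D I (\<lambda>i. fobj F (d i)) ((\<lambda>(i, j, f). (i, j, farr F (d i) (d j) f)) ` E)
          (fobj F L) (\<lambda>i. farr F L (d i) (l i)))"

definition is_adjunction ::
  "('o, 'm) cat \<Rightarrow> ('p, 'n) cat \<Rightarrow> ('o, 'm, 'p, 'n) fctr \<Rightarrow> ('p, 'n, 'o, 'm) fctr \<Rightarrow> bool" where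
  "is_adjunction C D F G \<longleftrightarrow>
     (\<exists>\<Phi>. (\<forall>A\<in>obj C. \<forall>B\<in>obj D.
             bij_betw (\<Phi> A B) (arr D (fobj F A) B) (arr C A (fobj G B))) \<and>
          (\<forall>A\<in>obj C. \<forall>A'\<in>obj C. \<forall>B\<in>obj D. \<forall>f\<in>arr C A' A. \<forall>g\<in>arr D (fobj F A) B.
             \<Phi> A' B (ccomp D (fobj F A') (fobj F A) B g (farr F A' A f))
               = ccomp C A' A (fobj G B) (\<Phi> A B g) f) \<and>
          (\<forall>A\<in>obj C. \<forall>B\<in>obj D. \<forall>B'\<in>obj D. \<forall>g\<in>arr D (fobj F A) B. \<forall>k\<in>arr D B B'.
             \<Phi> A B' (ccomp D (fobj F A) B B' k g)
               = ccomp C A (fobj G B) (fobj G B') (farr G B B' k) (\<Phi> A B g)))"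

(* F is the inverse image part of a geometric morphism D \<rightarrow> C. *)
definition is_inverse_image ::
  "('o, 'm) cat \<Rightarrow> ('p, 'n) cat \<Rightarrow> ('o, 'm, 'p, 'n) fctr \<Rightarrow> bool" where
  "is_inverse_image C D F \<longleftrightarrow> is_functor C D F \<and> preserves_finite_limits C D F \<and>
     (\<exists>G. is_functor D C G \<and> is_adjunction C D F G)"

section \<open>Sets and sets with an action of the nonsingular integer matrices\<close>

(* The family U of "small" subsets of a type plays the role of the universe of sets. Only the
   closure properties needed below are required; they hold for Grothendieck universes as well as
   for the family of all subsets of a type that is closed under countable powers. *)
definition set_universe :: "'u set set \<Rightarrow> bool" where
  "set_universe U \<longleftrightarrow>
     (\<forall>A\<in>U. \<forall>f. \<forall>B. B \<subseteq> f ` A \<longrightarrow> B \<in> U) \<and>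
     (\<exists>A\<in>U. infinite A) \<and>
     (\<forall>A\<in>U. \<exists>e :: (nat \<Rightarrow> 'u) \<Rightarrow> 'u. inj_on e (UNIV \<rightarrow> A) \<and> e ` (UNIV \<rightarrow> A) \<in> U)"

lemma set_universe_nat_set: "set_universe (UNIV :: nat set set set)"
proof -
  define e :: "(nat \<Rightarrow> nat set) \<Rightarrow> nat set" where "e s = prod_encode ` Sigma UNIV s" for s
  have "inj e"
  proof (rule injI)
    fix s t assume "e s = e t"
    then have "Sigma UNIV s = Sigma UNIV t"
      unfolding e_def by (simp add: inj_image_eq_iff inj_prod_encode)
    then show "s = t" by (auto simp: set_eq_iff fun_eq_iff)
  qed
  moreover have "infinite (UNIV :: nat set set)"
    by (simp add: Finite_Set.finite_set)
  ultimately show ?thesis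
    unfolding set_universe_def by (auto intro: inj_on_subset)
qed

definition set_cat :: "'u set set \<Rightarrow> ('u set, 'u \<Rightarrow> 'u) cat" where
  "set_cat U = \<lparr> obj = U, arr = (\<lambda>A B. A \<rightarrow>\<^sub>E B), cid = (\<lambda>A. \<lambda>x\<in>A. x),
     ccomp = (\<lambda>A B D g f. compose A g f) \<rparr>"

definition nsmat :: "(int^2^2) set" where
  "nsmat = {a. det a \<noteq> 0}"

record 'u mset =
  und :: "'u set"
  act :: "int^2^2 \<Rightarrow> 'u \<Rightarrow> 'u"

definition is_mset :: "'u mset \<Rightarrow> bool" where
  "is_mset N \<longleftrightarrow> (\<forall>a\<in>nsmat. \<forall>n\<in>und N. act N a n \<in> und N) \<and>
     (\<forall>n\<in>und N. act N (mat 1) n = n) \<and>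
     (\<forall>a\<in>nsmat. \<forall>b\<in>nsmat. \<forall>n\<in>und N. act N (a ** b) n = act N a (act N b n))"

definition mset_maps :: "'u mset \<Rightarrow> 'u mset \<Rightarrow> ('u \<Rightarrow> 'u) set" where
  "mset_maps N N' = {f \<in> und N \<rightarrow>\<^sub>E und N'. \<forall>a\<in>nsmat. \<forall>n\<in>und N. f (act N a n) = act N' a (f n)}"

definition mset_cat :: "'u set set \<Rightarrow> ('u mset, 'u \<Rightarrow> 'u) cat" where
  "mset_cat U = \<lparr> obj = {N. is_mset N \<and> und N \<in> U}, arr = mset_maps,
     cid = (\<lambda>N. \<lambda>x\<in>und N. x), ccomp = (\<lambda>N N' N'' g f. compose (und N) g f) \<rparr>"

lemma is_category_set_cat: "is_category (set_cat U)"
  unfolding is_category_def set_cat_def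
  by (auto simp: PiE_iff compose_def fun_eq_iff restrict_def extensional_def)

lemma is_category_mset_cat: "is_category (mset_cat U)"
  unfolding is_category_def mset_cat_def mset_maps_def is_mset_def
  by (auto simp: PiE_iff compose_def fun_eq_iff restrict_def extensional_def)

section \<open>Points\<close>

type_synonym 'u point = "('u mset, 'u \<Rightarrow> 'u, 'u set, 'u \<Rightarrow> 'u) fctr"

(* A point is represented by its inverse image functor. *)
definition points :: "'u set set \<Rightarrow> 'u point set" where
  "points U = {F. is_inverse_image (mset_cat U) (set_cat U) F}"

definition point_iso :: "'u set set \<Rightarrow> ('u point \<times> 'u point) set" where
  "point_iso U = {(F, G). F \<in> points U \<and> G \<in> points U \<and>
     naturally_isomorphic (mset_cat U) (set_cat U) F G}"

definition point_classes :: "'u set set \<Rightarrow> 'u point set set" where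
  "point_classes U = points U // point_iso U"

definition GL_orbit :: "'a::comm_ring_1^2^2 \<Rightarrow> ('a^2^2) set" where
  "GL_orbit x = {u ** x | u. invertible u}"

definition Xhat :: "(zhat^2^2) set set" where
  "Xhat = range GL_orbit"

definition Xhat_le :: "(zhat^2^2) set \<Rightarrow> (zhat^2^2) set \<Rightarrow> bool" where
  "Xhat_le A B \<longleftrightarrow> (\<exists>a\<in>A. \<exists>b\<in>B. \<exists>m. b = m ** a)"

definition to_Xhat :: "int^2^2 \<Rightarrow> (zhat^2^2) set" where
  "to_Xhat m = GL_orbit (map_matrix of_int m)"

(* R consists of one matrix from each GL_2(Z)-orbit of nonsingular matrices. *)
definition representatives :: "(int^2^2) set \<Rightarrow> bool" where
  "representatives R \<longleftrightarrow> R \<subseteq> nsmat \<and> (\<forall>c \<in> GL_orbit ` nsmat. \<exists>!m. m \<in> R \<inter> c)"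

definition below :: "(int^2^2) set \<Rightarrow> (zhat^2^2) set \<Rightarrow> (int^2^2) set" where
  "below R x = {m \<in> R. Xhat_le (to_Xhat m) x}"

definition colim_step ::
  "(int^2^2) set \<Rightarrow> (zhat^2^2) set \<Rightarrow> 'u mset \<Rightarrow> (int^2^2) \<times> 'u \<Rightarrow> (int^2^2) \<times> 'u \<Rightarrow> bool" where
  "colim_step R x N s t \<longleftrightarrow> s \<in> below R x \<times> und N \<and> t \<in> below R x \<times> und N \<and>
     (\<exists>a\<in>nsmat. fst t = a ** fst s \<and> snd t = act N a (snd s))"

definition colim_rel ::
  "(int^2^2) set \<Rightarrow> (zhat^2^2) set \<Rightarrow> 'u mset \<Rightarrow> (((int^2^2) \<times> 'u) \<times> ((int^2^2) \<times> 'u)) set" where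
  "colim_rel R x N = {(s, t). s \<in> below R x \<times> und N \<and> t \<in> below R x \<times> und N \<and>
     equivclp (colim_step R x N) s t}"

definition colim ::
  "(int^2^2) set \<Rightarrow> (zhat^2^2) set \<Rightarrow> 'u mset \<Rightarrow> ((int^2^2) \<times> 'u) set set" where
  "colim R x N = (below R x \<times> und N) // colim_rel R x N"

definition colim_map ::
  "(int^2^2) set \<Rightarrow> (zhat^2^2) set \<Rightarrow> 'u mset \<Rightarrow> ('u \<Rightarrow> 'u) \<Rightarrow> ((int^2^2) \<times> 'u) set \<Rightarrow> ((int^2^2) \<times> 'u) set" where
  "colim_map R x N' f c = (\<Union>(m, n)\<in>c. colim_rel R x N' `` {(m, f n)})"

(* The elements of a colimit are sets of pairs; they are renamed injectively by elements of the
   underlying type so that the colimit becomes an object of the category of sets. The choice of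
   the renaming affects the functor only up to natural isomorphism. *)
definition rename :: "'a set \<Rightarrow> 'a \<Rightarrow> 'u" where
  "rename Q = (SOME e. inj_on e Q)"

definition point_of :: "(int^2^2) set \<Rightarrow> (zhat^2^2) set \<Rightarrow> 'u point" where
  "point_of R x = \<lparr>
     fobj = (\<lambda>N. rename (colim R x N) ` colim R x N),
     farr = (\<lambda>N N' f. \<lambda>z\<in>rename (colim R x N) ` colim R x N.
       rename (colim R x N') (colim_map R x N' f
         (inv_into (colim R x N) (rename (colim R x N)) z))) \<rparr>"

definition point_class :: "'u set set \<Rightarrow> (int^2^2) set \<Rightarrow> (zhat^2^2) set \<Rightarrow> 'u point set" where
  "point_class U R x = point_iso U `` {point_of R x}"

section \<open>The double quotient\<close>

definition double_coset :: "adele^2^2 \<Rightarrow> (adele^2^2) set" where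
  "double_coset y = {map_matrix zhat_to_adele u ** y ** map_matrix rat_to_adele g | u g.
     invertible u \<and> invertible g}"

definition double_quotient :: "(adele^2^2) set set" where
  "double_quotient = range double_coset"

section \<open>Groups between the integral and the rational plane\<close>

definition Q2 :: "(rat^2) monoid" where
  "Q2 = \<lparr>carrier = UNIV, mult = (+), one = 0\<rparr>"

definition Z2 :: "(rat^2) set" where
  "Z2 = {v. \<forall>i. v $ i \<in> \<int>}"

definition intermediate_groups :: "(rat^2) set set" where
  "intermediate_groups = {A. subgroup A Q2 \<and> Z2 \<subseteq> A}"

definition group_iso :: "((rat^2) set \<times> (rat^2) set) set" where
  "group_iso = {(A, B). A \<in> intermediate_groups \<and> B \<in> intermediate_groups \<and>
     Q2\<lparr>carrier := A\<rparr> \<cong> Q2\<lparr>carrier := B\<rparr>}"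

definition group_classes :: "(rat^2) set set set" where
  "group_classes = intermediate_groups // group_iso"

(* The union of the lattices m^{-1} Z^2 for m \<le> x. It is the value of the inverse image functor
   of point_of R x at Z^2, where matrices act on column vectors. *)
definition group_of :: "(int^2^2) set \<Rightarrow> (zhat^2^2) set \<Rightarrow> (rat^2) set" where
  "group_of R x = {v. \<exists>m\<in>below R x. map_matrix of_int m *v v \<in> Z2}"

end

theory Submission
  imports Defs
begin

text \<open>
  Write \<open>M\<close> for the monoid of nonsingular integer matrices. A functor from sets with a left action of \<open>M\<close>
  to sets that preserves finite limits and has a right adjoint is determined by its value \<open>P\<close> at \<open>M\<close>
  itself, a set with a right action of \<open>M\<close>: the functor is \<open>N \<mapsto> P \<otimes> N\<close>. Preservation of finite limits
  makes \<open>P\<close> flat: it is not empty, any two elements are multiples of a third, and different matrices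
  move an element differently. Fixing one element of \<open>P\<close> therefore embeds \<open>P\<close> into the invertible rational
  matrices, and the image is the set of bases, called frames here, of the lattices contained in a group
  \<open>A\<close> with \<open>\<int>\<^sup>2 \<subseteq> A \<subseteq> \<rat>\<^sup>2\<close> (\<open>flat_module_is_frames\<close>, \<open>point_presentation\<close>). Conversely, tensoring with the
  frames of \<open>A\<close> is a filtered colimit, hence commutes with finite limits, and it has the right adjoint
  that sends a set \<open>B\<close> to the set of functions from frames to \<open>B\<close> (\<open>preserves_limits\<close>, \<open>adjunction\<close>). An
  isomorphism between two such functors gives an isomorphism between the right modules of frames, which
  is left multiplication by an invertible rational matrix that maps one group onto the other
  (\<open>isomorphic_presentations\<close>). These matrices are also the isomorphisms of the abstract groups, since a
  homomorphism is determined by its values on \<open>\<int>\<^sup>2\<close> (\<open>group_iso_iff\<close>). So points and groups have the same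
  isomorphism classes.

  The groups are matched with profinite matrices by duality: \<open>y\<close> is sent to the group of all rational
  vectors \<open>v\<close> for which \<open>y v\<close> is integral. Partial fractions reduce the study of this assignment to one
  prime \<open>p\<close> at a time. There a group is a family of kernels modulo \<open>p\<^sup>k\<close>, an explicit matrix
  with these kernels is written down, and any other such matrix differs from it by a unit on the left
  (\<open>universal_solution_exists\<close>). Gluing over all primes shows that every group arises, and that \<open>y\<close> is
  determined by its group up to multiplication by \<open>GL\<^sub>2\<close> of the profinite integers on the left
  (\<open>universal_matrix\<close>). Rational matrices on the right translate the group, so double cosets correspond
  to isomorphism classes of groups (\<open>double_coset_eq_iff\<close>).

  Finally, an integer matrix \<open>m\<close> is below \<open>y\<close> iff the lattice \<open>m\<^sup>-\<^sup>1 \<int>\<^sup>2\<close> is contained in the group of \<open>y\<close>, and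
  lattices of this kind are cofinal among all lattices in the group. The colimit over the \<open>m\<close> below \<open>y\<close>
  is therefore the tensor product with the frames of the group (\<open>point_of_presentation\<close>). Both bijections
  of the theorem then come from the fact that the double coset, the point and the group of \<open>y\<close> determine
  each other up to isomorphism.
\<close>

section \<open>Integer matrices and frames of rational groups\<close>

abbreviation ratm :: "int^2^2 \<Rightarrow> rat^2^2" where
  "ratm \<equiv> map_matrix of_int"

abbreviation ratv :: "int^2 \<Rightarrow> rat^2" where
  "ratv w \<equiv> (\<chi> i. of_int (w $ i))"

lemma map_matrix_mult:
  fixes A B :: "'a::comm_ring_1^2^2" and h :: "'a \<Rightarrow> 'b::comm_ring_1"
  assumes "\<And>a b. h (a + b) = h a + h b" "\<And>a b. h (a * b) = h a * h b"
  shows "map_matrix h (A ** B) = map_matrix h A ** map_matrix h B"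
  by (simp add: vec_eq_iff matrix_matrix_mult_def sum_2 assms)

lemma ratm_mult: "ratm (A ** B) = ratm A ** ratm B"
  by (rule map_matrix_mult) auto

lemma ratm_mat: "ratm (mat c) = mat (of_int c)"
  by (simp add: vec_eq_iff mat_def)

lemma ratm_add: "ratm (A + B) = ratm A + ratm B"
  by (simp add: vec_eq_iff)

lemma ratm_eq_iff: "ratm A = ratm B \<longleftrightarrow> A = B"
  by (simp add: vec_eq_iff)

lemma ratm_ratv: "ratm m *v ratv w = ratv (m *v w)"
  by (simp add: vec_eq_iff matrix_vector_mult_def sum_2)

lemma det_ratm: "det (ratm m) = of_int (det m)"
  by (simp add: det_2)

lemma nsmat_mult: "a \<in> nsmat \<Longrightarrow> b \<in> nsmat \<Longrightarrow> a ** b \<in> nsmat"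
  by (simp add: nsmat_def det_mul)

lemma nsmat_one: "mat 1 \<in> nsmat"
  by (simp add: nsmat_def)

lemma invertible_ratm: "invertible (ratm m) \<longleftrightarrow> m \<in> nsmat"
  by (simp add: invertible_det_nz det_ratm nsmat_def)

lemma invertible_prod:
  fixes A B :: "'a::comm_ring_1^2^2"
  assumes "invertible A" "invertible B"
  shows "invertible (A ** B)"
proof -
  obtain A' B' where *: "A ** A' = mat 1" "A' ** A = mat 1" "B ** B' = mat 1" "B' ** B = mat 1"
    using assms unfolding invertible_def by blast
  have "(A ** B) ** (B' ** A') = A ** (B ** B') ** A'" "(B' ** A') ** (A ** B) = B' ** (A' ** A) ** B"
    by (simp_all add: matrix_mul_assoc)
  with * show ?thesis
    unfolding invertible_def by (metis matrix_mul_rid)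
qed

lemma invertibleE:
  fixes A :: "'a::comm_ring_1^2^2"
  assumes "invertible A"
  obtains B where "invertible B" "A ** B = mat 1" "B ** A = mat 1"
  using assms unfolding invertible_def by blast

lemma invertible_cancel_left:
  fixes A :: "'a::comm_ring_1^2^2"
  assumes "invertible A"
  shows "A ** B = A ** C \<longleftrightarrow> B = C"
  using assms by (metis invertibleE matrix_mul_assoc matrix_mul_lid)

lemma invertible_cancel_right:
  fixes A :: "'a::comm_ring_1^2^2"
  assumes "invertible A"
  shows "B ** A = C ** A \<longleftrightarrow> B = C"
  using assms by (metis invertibleE matrix_mul_assoc matrix_mul_rid)

lemma nsmat_cancel_left: "(a :: int^2^2) \<in> nsmat \<Longrightarrow> a ** b = a ** c \<longleftrightarrow> b = (c :: int^2^2)"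
  using invertible_cancel_left[of "ratm a" "ratm b" "ratm c"]
  by (simp add: invertible_ratm ratm_mult[symmetric] ratm_eq_iff)

lemma nsmat_cancel_right: "a \<in> nsmat \<Longrightarrow> b ** a = c ** a \<longleftrightarrow> b = (c :: int^2^2)"
  using invertible_cancel_right[of "ratm a" "ratm b" "ratm c"]
  by (simp add: invertible_ratm ratm_mult[symmetric] ratm_eq_iff)

lemma mat_mult_commute:
  fixes A :: "'a::comm_ring_1^2^2"
  shows "A ** mat c = mat c ** A"
  by (simp add: vec_eq_iff matrix_matrix_mult_def sum_2 forall_2 mat_def mult.commute)

lemma common_denominator_rat:
  assumes "finite I"
  shows "\<exists>n::int. n \<noteq> 0 \<and> (\<forall>i\<in>I. \<exists>a. of_int n * q i = (of_int a :: rat))"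
  using assms
proof (induction I rule: finite_induct)
  case empty
  show ?case by (intro exI[of _ 1]) simp
next
  case (insert i I)
  then obtain n :: int where n: "n \<noteq> 0" "\<And>j. j \<in> I \<Longrightarrow> \<exists>a. of_int n * q j = (of_int a :: rat)"
    by blast
  obtain a b where ab: "quotient_of (q i) = (a, b)" by fastforce
  then have b: "b > 0" "q i = of_int a / of_int b"
    by (simp_all add: quotient_of_denom_pos quotient_of_div)
  have "\<exists>a. of_int (n * b) * q j = of_int a" if "j \<in> insert i I" for j
  proof (cases "j = i")
    case True
    then show ?thesis using b by (intro exI[of _ "n * a"]) simp
  next
    case False
    then have "j \<in> I" using that by simp
    then obtain c where "of_int n * q j = (of_int c :: rat)" using n(2) by metis
    then show ?thesis by (intro exI[of _ "b * c"]) (simp add: mult_ac)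
  qed
  then show ?case using n(1) b(1) by (intro exI[of _ "n * b"]) auto
qed

lemma common_denominator:
  fixes s :: "rat^2^2"
  obtains n k where "n \<noteq> 0" "s ** ratm (mat n) = ratm k"
proof -
  obtain n :: int where n: "n \<noteq> 0"
    "\<forall>i\<in>(UNIV :: (2 \<times> 2) set). \<exists>a. of_int n * (case i of (i, j) \<Rightarrow> s $ i $ j) = (of_int a :: rat)"
    using common_denominator_rat[of "UNIV :: (2 \<times> 2) set" "\<lambda>i. case i of (i, j) \<Rightarrow> s $ i $ j", OF finite]
    by (elim exE conjE)
  then have "\<forall>i j. \<exists>a. of_int n * s $ i $ j = (of_int a :: rat)" by auto
  then obtain f where f: "\<And>i j. of_int n * s $ i $ j = (of_int (f i j) :: rat)" by metis
  have "s ** ratm (mat n) = ratm (\<chi> i j. f i j)"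
    by (simp add: vec_eq_iff matrix_matrix_mult_def sum_2 forall_2 mat_def f[symmetric])
  with n(1) that show ?thesis by blast
qed

lemma common_denominator_vec:
  fixes v :: "rat^2"
  obtains n w where "n > 0" "of_int n *s v = ratv w"
proof -
  obtain n :: int where n: "n \<noteq> 0"
    "\<forall>i\<in>(UNIV :: 2 set). \<exists>a. of_int n * v $ i = (of_int a :: rat)"
    using common_denominator_rat[of "UNIV :: 2 set" "\<lambda>i. v $ i", OF finite] by (elim exE conjE)
  then have "\<forall>i. \<exists>a. of_int \<bar>n\<bar> * v $ i = (of_int a :: rat)"
    by (auto simp: abs_if) (metis of_int_minus)
  then obtain f where f: "\<And>i. of_int \<bar>n\<bar> * v $ i = (of_int (f i) :: rat)" by metis
  have "of_int \<bar>n\<bar> *s v = ratv (\<chi> i. f i)"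
    by (simp add: vec_eq_iff f[symmetric])
  moreover have "\<bar>n\<bar> > 0" using n(1) by simp
  ultimately show ?thesis using that by blast
qed

lemma int_subgroup_principal:
  fixes H :: "int set"
  assumes "0 \<in> H" "\<And>a b. a \<in> H \<Longrightarrow> b \<in> H \<Longrightarrow> a - b \<in> H"
  obtains d where "d \<in> H" "\<And>a. a \<in> H \<Longrightarrow> d dvd a"
proof (cases "H \<subseteq> {0}")
  case True
  then show ?thesis using that[of 0] assms(1) by auto
next
  case False
  have neg: "- a \<in> H" if "a \<in> H" for a using assms(2)[OF assms(1) that] by simp
  have add: "a + b \<in> H" if "a \<in> H" "b \<in> H" for a b using assms(2)[OF that(1) neg[OF that(2)]] by simp
  define P where "P n \<longleftrightarrow> n > 0 \<and> int n \<in> H" for n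
  obtain a where "a \<in> H" "a \<noteq> 0" using False by auto
  then have "P (nat \<bar>a\<bar>)" using neg by (auto simp: P_def abs_if)
  then have P: "P (LEAST n. P n)" by (rule LeastI)
  define d where "d = (LEAST n. P n)"
  have mult: "int k * int d \<in> H" for k
    by (induction k) (use P assms(1) add in \<open>auto simp: P_def d_def algebra_simps\<close>)
  have multz: "k * int d \<in> H" for k
    using mult[of "nat k"] neg[OF mult[of "nat (-k)"]] by (cases "k \<ge> 0") auto
  show ?thesis
  proof (rule that[of "int d"])
    show "int d \<in> H" using P by (simp add: P_def d_def)
    fix a assume "a \<in> H"
    then have "a - a div int d * int d \<in> H" using assms(2) multz by blast
    then have H: "a mod int d \<in> H" by (simp add: minus_div_mult_eq_mod)
    have d0: "d > 0" using P by (simp add: P_def d_def)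
    have "a mod int d = 0"
    proof (rule ccontr)
      assume "a mod int d \<noteq> 0"
      then have "a mod int d > 0" using pos_mod_sign[of "int d" a] d0 by linarith
      then have "P (nat (a mod int d))" using H by (simp add: P_def)
      then have "d \<le> nat (a mod int d)" unfolding d_def by (rule Least_le)
      then show False using d0 pos_mod_bound[of "int d" a] by linarith
    qed
    then show "int d dvd a" by auto
  qed
qed

lemma column_eq_mult_axis:
  fixes A :: "'a::comm_ring_1^2^2"
  shows "column j A = A *v axis j 1"
  using exhaust_2[of j] by (auto simp: vec_eq_iff column_def matrix_vector_mult_def sum_2 axis_def)

text \<open>Over a principal ideal domain two matrices have a greatest common left divisor. It is read
  off from the lattice spanned by the columns of both: a basis in triangular form is given by generators
  of the first coordinates of the lattice and of the second coordinates of its vectors \<open>(0, b)\<close>.\<close>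

lemma matrix_bezout:
  fixes s t :: "int^2^2"
  assumes "s \<in> nsmat"
  obtains h a b m m' where "h \<in> nsmat" "h = s ** a + t ** b" "s = h ** m" "t = h ** m'"
proof -
  define L where "L = {s *v u + t *v w | u w. True}"
  have diff: "x - y \<in> L" if "x \<in> L" "y \<in> L" for x y
  proof -
    obtain u w u' w' where "x = s *v u + t *v w" "y = s *v u' + t *v w'"
      using \<open>x \<in> L\<close> \<open>y \<in> L\<close> unfolding L_def by blast
    then have "x - y = s *v (u - u') + t *v (w - w')"
      by (simp add: matrix_vector_mult_diff_distrib algebra_simps)
    then show ?thesis unfolding L_def by blast
  qed
  have zero: "0 \<in> L"
    unfolding L_def by (metis (mono_tags, lifting) CollectI add.right_neutral matrix_vector_mult_0_right)
  have neg: "- x \<in> L" if "x \<in> L" for x using diff[OF zero that] by simp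
  have add: "x + y \<in> L" if "x \<in> L" "y \<in> L" for x y using diff[OF that(1) neg[OF that(2)]] by simp
  have multn: "of_nat k *s x \<in> L" if "x \<in> L" for k x
  proof (induction k)
    case (Suc k)
    have "of_nat (Suc k) *s x = of_nat k *s x + x" by (simp add: vec_eq_iff algebra_simps)
    then show ?case using add[OF Suc that] by metis
  qed (simp add: zero)
  have mult: "k *s x \<in> L" if "x \<in> L" for k x
  proof (cases k rule: int_cases2)
    case (nonpos n)
    have "k *s x = - (of_nat n *s x)" by (simp add: nonpos vec_eq_iff)
    then show ?thesis using neg multn[OF that] by simp
  qed (use multn[OF that] in simp)
  have col_s: "column j s \<in> L" for j
  proof -
    have "column j s = s *v axis j 1 + t *v 0" by (simp add: column_eq_mult_axis)
    then show ?thesis unfolding L_def by blast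
  qed
  have col_t: "column j t \<in> L" for j
  proof -
    have "column j t = s *v 0 + t *v axis j 1" by (simp add: column_eq_mult_axis)
    then show ?thesis unfolding L_def by blast
  qed
  \<comment> \<open>The columns of \<open>s\<close> times its adjugate lie in \<open>L\<close>, so neither generator vanishes.\<close>
  have Ns: "det s \<noteq> 0" using assms by (simp add: nsmat_def)
  have e1: "vector [det s, 0] \<in> L"
  proof -
    have "vector [det s, 0] = s *v vector [s$2$2, - s$2$1] + t *v 0"
      by (simp add: vec_eq_iff forall_2 matrix_vector_mult_def sum_2 det_2 algebra_simps)
    then show ?thesis unfolding L_def by blast
  qed
  have e2: "vector [0, det s] \<in> L"
  proof -
    have "vector [0, det s] = s *v vector [- s$1$2, s$1$1] + t *v 0"
      by (simp add: vec_eq_iff forall_2 matrix_vector_mult_def sum_2 det_2 algebra_simps)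
    then show ?thesis unfolding L_def by blast
  qed
  obtain d1 where d1: "d1 \<in> (\<lambda>x. x $ 1) ` L" "\<And>a. a \<in> (\<lambda>x. x $ 1) ` L \<Longrightarrow> d1 dvd a"
  proof (rule int_subgroup_principal[of "(\<lambda>x. x $ 1) ` L"])
    show "0 \<in> (\<lambda>x. x $ 1) ` L" using zero by force
    show "a - b \<in> (\<lambda>x. x $ 1) ` L" if "a \<in> (\<lambda>x. x $ 1) ` L" "b \<in> (\<lambda>x. x $ 1) ` L" for a b
      using that diff by (metis (no_types, lifting) image_iff vector_minus_component)
  qed blast
  obtain d2 where d2: "d2 \<in> (\<lambda>x. x $ 2) ` {x \<in> L. x $ 1 = 0}"
    "\<And>a. a \<in> (\<lambda>x. x $ 2) ` {x \<in> L. x $ 1 = 0} \<Longrightarrow> d2 dvd a"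
  proof (rule int_subgroup_principal[of "(\<lambda>x. x $ 2) ` {x \<in> L. x $ 1 = 0}"])
    show "0 \<in> (\<lambda>x. x $ 2) ` {x \<in> L. x $ 1 = 0}" using zero by force
    show "a - b \<in> (\<lambda>x. x $ 2) ` {x \<in> L. x $ 1 = 0}"
      if "a \<in> (\<lambda>x. x $ 2) ` {x \<in> L. x $ 1 = 0}" "b \<in> (\<lambda>x. x $ 2) ` {x \<in> L. x $ 1 = 0}" for a b
    proof -
      obtain x y where "x \<in> L" "y \<in> L" "x $ 1 = 0" "y $ 1 = 0" "a = x $ 2" "b = y $ 2"
        using \<open>a \<in> _\<close> \<open>b \<in> _\<close> by auto
      then show ?thesis using diff[of x y] by (intro image_eqI[of _ _ "x - y"]) auto
    qed
  qed blast
  obtain f1 where f1: "f1 \<in> L" "f1 $ 1 = d1" using d1(1) by auto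
  obtain f2 where f2: "f2 \<in> L" "f2 $ 1 = 0" "f2 $ 2 = d2" using d2(1) by auto
  have "d1 dvd det s" using d1(2) e1 by (metis imageI vector_2(1))
  then have d1nz: "d1 \<noteq> 0" using Ns by auto
  have "d2 dvd det s"
    by (rule d2(2), rule image_eqI[of _ _ "vector [0, det s]"]) (use e2 in auto)
  then have d2nz: "d2 \<noteq> 0" using Ns by auto
  define h :: "int^2^2" where "h = (\<chi> i j. if j = 1 then f1 $ i else f2 $ i)"
  have "det h = d1 * d2" by (simp add: h_def det_2 f1 f2)
  then have hns: "h \<in> nsmat" using d1nz d2nz by (simp add: nsmat_def)
  have ex: "\<exists>w. x = h *v w" if "x \<in> L" for x
  proof -
    obtain k where k: "x $ 1 = d1 * k" using d1(2) \<open>x \<in> L\<close> by (meson dvd_def imageI)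
    have "x - k *s f1 \<in> L" using that f1 mult diff by blast
    moreover have "(x - k *s f1) $ 1 = 0" using k f1 by simp
    ultimately have "d2 dvd (x - k *s f1) $ 2" using d2(2) by blast
    then obtain l where "x $ 2 - k * f1 $ 2 = d2 * l" by (auto simp: dvd_def)
    then have "x = h *v vector [k, l]"
      using k f1 f2 by (simp add: vec_eq_iff forall_2 h_def matrix_vector_mult_def sum_2 algebra_simps)
    then show ?thesis by blast
  qed
  have fac: "\<exists>m. z = h ** m" if "\<And>j. column j z \<in> L" for z :: "int^2^2"
  proof -
    have "\<forall>j. \<exists>w. column j z = h *v w" using ex that by blast
    then obtain w where "\<And>j. column j z = h *v w j" by metis
    then have "z = h ** (\<chi> i j. w j $ i)"
      by (simp add: vec_eq_iff matrix_vector_mult_def matrix_matrix_mult_def column_def)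
    then show ?thesis by blast
  qed
  obtain m where m: "s = h ** m" using fac col_s by blast
  obtain m' where m': "t = h ** m'" using fac col_t by blast
  obtain u1 w1 u2 w2 where "f1 = s *v u1 + t *v w1" "f2 = s *v u2 + t *v w2"
    using f1(1) f2(1) unfolding L_def by blast
  then have "h = s ** (\<chi> i j. if j = 1 then u1 $ i else u2 $ i)
      + t ** (\<chi> i j. if j = 1 then w1 $ i else w2 $ i)"
    by (simp add: vec_eq_iff forall_2 h_def matrix_vector_mult_def matrix_matrix_mult_def sum_2)
  with that hns m m' show ?thesis by blast
qed

lemma intermediate_groups_iff:
  "A \<in> intermediate_groups \<longleftrightarrow> Z2 \<subseteq> A \<and> (\<forall>u\<in>A. \<forall>v\<in>A. u - v \<in> A)"
proof -
  interpret group Q2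
    by (rule groupI) (auto simp: Q2_def algebra_simps intro: exI[of _ "- x" for x])
  have inv: "inv\<^bsub>Q2\<^esub> v = - v" for v
    by (rule inv_equality) (auto simp: Q2_def)
  show ?thesis
  proof
    assume A: "A \<in> intermediate_groups"
    then have "subgroup A Q2" by (simp add: intermediate_groups_def)
    from subgroup.m_closed[OF this] subgroup.m_inv_closed[OF this]
    have "u - v \<in> A" if "u \<in> A" "v \<in> A" for u v
      using that by (metis Q2_def add_uminus_conv_diff inv monoid.select_convs(1))
    with A show "Z2 \<subseteq> A \<and> (\<forall>u\<in>A. \<forall>v\<in>A. u - v \<in> A)" by (auto simp: intermediate_groups_def)
  next
    assume A: "Z2 \<subseteq> A \<and> (\<forall>u\<in>A. \<forall>v\<in>A. u - v \<in> A)"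
    then have zero: "0 \<in> A" by (auto simp: Z2_def)
    then have neg: "- u \<in> A" if "u \<in> A" for u using A that by (metis diff_0)
    then have "u + v \<in> A" if "u \<in> A" "v \<in> A" for u v using A that by (metis diff_minus_eq_add)
    with zero neg have "subgroup A Q2"
      by (intro subgroupI) (auto simp: inv, auto simp: Q2_def)
    with A show "A \<in> intermediate_groups" by (simp add: intermediate_groups_def)
  qed
qed

lemma ratv_Z2: "ratv w \<in> Z2"
  by (simp add: Z2_def)

lemma Z2_ratvE:
  assumes "v \<in> Z2" obtains w where "v = ratv w"
proof -
  have "\<forall>i. \<exists>a. v $ i = of_int a" using assms by (auto simp: Z2_def Ints_def)
  then obtain f where "\<And>i. v $ i = of_int (f i)" by metis
  then have "v = ratv (\<chi> i. f i)" by (simp add: vec_eq_iff)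
  with that show ?thesis by blast
qed

context
  fixes A assumes A: "A \<in> intermediate_groups"
begin

lemma intermediate_zero: "0 \<in> A"
  using A by (auto simp: intermediate_groups_iff Z2_def)

lemma intermediate_diff: "u \<in> A \<Longrightarrow> v \<in> A \<Longrightarrow> u - v \<in> A"
  using A by (auto simp: intermediate_groups_iff)

lemma intermediate_neg: "u \<in> A \<Longrightarrow> - u \<in> A"
  using intermediate_diff[OF intermediate_zero, of u] by simp

lemma intermediate_add: "u \<in> A \<Longrightarrow> v \<in> A \<Longrightarrow> u + v \<in> A"
  using intermediate_diff[OF _ intermediate_neg, of u v] by simp

lemma intermediate_scale: "u \<in> A \<Longrightarrow> of_int k *s u \<in> A"
proof -
  assume u: "u \<in> A"
  have n: "of_nat n *s u \<in> A" for n
  proof (induction n)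
    case (Suc n)
    have "of_nat (Suc n) *s u = of_nat n *s u + u" by (simp add: vec_eq_iff algebra_simps)
    then show ?case using intermediate_add[OF Suc u] by metis
  qed (simp add: intermediate_zero)
  show ?thesis
  proof (cases k rule: int_cases2)
    case (nonneg n)
    then show ?thesis using n[of n] by simp
  next
    case (nonpos m)
    have "of_int k *s u = - (of_nat m *s u)" by (simp add: nonpos vec_eq_iff)
    then show ?thesis using intermediate_neg[OF n[of m]] by simp
  qed
qed

lemma intermediate_lincomb:
  assumes "\<And>j. column j g \<in> A" shows "g *v ratv w \<in> A"
proof -
  have "g *v ratv w = of_int (w $ 1) *s column 1 g + of_int (w $ 2) *s column 2 g"
    by (simp add: vec_eq_iff matrix_vector_mult_def sum_2 column_def mult.commute)
  then show ?thesis using assms by (simp add: intermediate_add intermediate_scale)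
qed

end

text \<open>A frame of \<open>A\<close> is a basis of a lattice contained in \<open>A\<close>. As every finitely generated subgroup
  of \<open>A\<close> lies in such a lattice, \<open>A\<close> is the directed union of its lattices, and the set of frames
  is the corresponding flat right module over the monoid of nonsingular integer matrices.\<close>

definition frames :: "(rat^2) set \<Rightarrow> (rat^2^2) set" where
  "frames A = {g. invertible g \<and> (\<forall>j. column j g \<in> A)}"

lemma column_mult: "column j (a ** b) = a *v column j b"
  by (simp add: column_def vec_eq_iff matrix_matrix_mult_def matrix_vector_mult_def)

lemma column_ratm: "column j (ratm m) = ratv (column j m)"
  by (simp add: column_def vec_eq_iff)

text \<open>After clearing denominators this is \<open>matrix_bezout\<close>; in it \<open>h\<close> is a combination of \<open>s\<close> and
  \<open>t\<close> with integral coefficients, which keeps its columns in \<open>A\<close>.\<close>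

lemma lattice_sum:
  assumes A: "A \<in> intermediate_groups" and s: "s \<in> frames A" and t: "\<And>j. column j t \<in> A"
  obtains h m m' where "h \<in> frames A" "s = h ** ratm m" "t = h ** ratm m'"
proof -
  obtain n1 k1 where n1: "n1 \<noteq> 0" "s ** ratm (mat n1) = ratm k1" by (rule common_denominator)
  obtain n2 k2 where n2: "n2 \<noteq> 0" "t ** ratm (mat n2) = ratm k2" by (rule common_denominator)
  define n where "n = n1 * n2"
  have mm: "mat a ** mat b = (mat (a * b) :: int^2^2)" for a b
    by (simp add: vec_eq_iff forall_2 matrix_matrix_mult_def sum_2 mat_def)
  define sn where "sn = k1 ** mat n2"
  define tn where "tn = k2 ** mat n1"
  have sn: "s ** ratm (mat n) = ratm sn" and tn: "t ** ratm (mat n) = ratm tn"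
    unfolding sn_def tn_def n_def ratm_mult n1(2)[symmetric] n2(2)[symmetric]
    by (simp_all add: matrix_mul_assoc[symmetric] ratm_mult[symmetric] mm mult.commute)
  have nn: "mat n \<in> nsmat" using n1 n2 by (simp add: n_def nsmat_def det_2 mat_def)
  have "invertible (ratm sn)"
    unfolding sn[symmetric] using s nn by (intro invertible_prod) (auto simp: frames_def invertible_ratm)
  then have "sn \<in> nsmat" by (simp add: invertible_ratm)
  then obtain h a b m m' where h: "h \<in> nsmat" "h = sn ** a + tn ** b" "sn = h ** m" "tn = h ** m'"
    by (rule matrix_bezout)
  obtain d where d: "invertible d" "ratm (mat n) ** d = mat 1" "d ** ratm (mat n) = mat 1"
    using nn invertible_ratm invertibleE by blast
  have dc: "x ** d = d ** x" for x
    by (metis d(2,3) mat_mult_commute matrix_mul_assoc matrix_mul_lid matrix_mul_rid ratm_mat)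
  have madd: "(x + y) ** z = x ** z + y ** z" for x y z :: "rat^2^2"
    by (simp add: vec_eq_iff matrix_matrix_mult_def sum_2 algebra_simps)
  have hd: "ratm h ** d = s ** ratm a + t ** ratm b"
  proof -
    have "ratm h ** d = s ** (ratm (mat n) ** (ratm a ** d)) + t ** (ratm (mat n) ** (ratm b ** d))"
      unfolding h(2) ratm_add ratm_mult sn[symmetric] tn[symmetric]
      by (simp add: madd matrix_mul_assoc)
    moreover have "ratm (mat n) ** (x ** d) = x" for x
      unfolding dc[of x] matrix_mul_assoc d(2) by (rule matrix_mul_lid)
    ultimately show ?thesis by simp
  qed
  have "invertible (ratm h ** d)" using d(1) h(1) by (intro invertible_prod) (simp_all add:
      invertible_ratm)
  moreover have "column j (ratm h ** d) \<in> A" for j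
  proof -
    have "column j (ratm h ** d) = s *v ratv (column j a) + t *v ratv (column j b)"
      unfolding hd column_ratm[symmetric] column_mult[symmetric] by (simp add: column_def vec_eq_iff)
    then show ?thesis using A s t by (simp add: intermediate_add intermediate_lincomb frames_def)
  qed
  ultimately have "ratm h ** d \<in> frames A" by (simp add: frames_def)
  moreover have "s = (ratm h ** d) ** ratm m" "t = (ratm h ** d) ** ratm m'"
    using arg_cong[OF sn, of "\<lambda>x. x ** d"] arg_cong[OF tn, of "\<lambda>x. x ** d"]
    unfolding h(3,4) ratm_mult matrix_mul_assoc[symmetric] d(2) matrix_mul_rid
    by (simp_all only: dc[of "ratm m"] dc[of "ratm m'"])
  ultimately show ?thesis using that by blast
qed

lemma frames_invertible: "g \<in> frames A \<Longrightarrow> invertible g"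
  by (simp add: frames_def)

lemma frames_factor_nsmat:
  assumes "invertible (h :: rat^2^2)" "invertible (h ** ratm m)" shows "m \<in> nsmat"
  using assms by (auto simp: invertible_det_nz det_mul det_ratm nsmat_def)

lemma frames_one: "A \<in> intermediate_groups \<Longrightarrow> mat 1 \<in> frames A"
proof -
  assume "A \<in> intermediate_groups"
  moreover have "column j (mat 1) \<in> Z2" for j :: 2
    by (simp add: Z2_def column_def mat_def)
  moreover have "invertible (mat 1 :: rat^2^2)" by (simp add: invertible_det_nz)
  ultimately show ?thesis by (auto simp: frames_def intermediate_groups_iff)
qed

lemma frames_mult:
  assumes "A \<in> intermediate_groups" "g \<in> frames A" "m \<in> nsmat" shows "g ** ratm m \<in> frames A"
  using assms unfolding frames_def
  by (auto simp: column_mult column_ratm invertible_ratm intro!: invertible_prod intermediate_lincomb)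

lemma frames_directed:
  assumes "A \<in> intermediate_groups" "s \<in> frames A" "t \<in> frames A"
  obtains h m m' where "h \<in> frames A" "m \<in> nsmat" "m' \<in> nsmat" "s = h ** ratm m" "t = h ** ratm m'"
proof -
  have "\<And>j. column j t \<in> A" using assms by (simp add: frames_def)
  from lattice_sum[OF assms(1,2) this] obtain h m m' where
    *: "h \<in> frames A" "s = h ** ratm m" "t = h ** ratm m'" by blast
  then have "m \<in> nsmat" "m' \<in> nsmat"
    using assms(2,3) frames_factor_nsmat frames_invertible by metis+
  with * that show ?thesis by blast
qed

text \<open>The lattice can be taken to contain \<open>\<int>\<^sup>2\<close> as well, so that the frame is the inverse of an
  integer matrix; this is how frames are compared with the integer matrices below a profinite one.\<close>

lemma frames_cover:
  assumes "A \<in> intermediate_groups" "v \<in> A"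
  obtains h m w where "h \<in> frames A" "m \<in> nsmat" "h ** ratm m = mat 1" "v = h *v ratv w"
proof -
  have "column j (\<chi> i j. v $ i) = v" for j :: 2 by (simp add: column_def vec_eq_iff)
  then have "column j (\<chi> i j. v $ i) \<in> A" for j :: 2 using assms by simp
  from lattice_sum[OF assms(1) frames_one[OF assms(1)] this] obtain h m m' where
    *: "h \<in> frames A" "mat 1 = h ** ratm m" "(\<chi> i j. v $ i) = h ** ratm m'" by blast
  then have "v = h *v ratv (column 1 m')"
    unfolding column_ratm[symmetric] column_mult[symmetric] by (metis \<open>\<And>j. column j (\<chi> i j. v $ i) = v\<close>)
  moreover have "m \<in> nsmat" using * frames_factor_nsmat[of h m] frames_invertible
    by (metis frames_invertible frames_one[OF assms(1)])
  ultimately show ?thesis using that[of h m "column 1 m'"] * by simp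
qed

text \<open>The converse: a directed set of matrices that is stable under the right action consists of all
  frames of the union \<open>A\<close> of its lattices. Directedness makes \<open>A\<close> a group and puts the two columns of
  a frame of \<open>A\<close> into a single lattice of the set.\<close>

lemma frames_of_flat:
  assumes one: "mat 1 \<in> S"
    and inv: "\<And>s. s \<in> S \<Longrightarrow> invertible s"
    and right: "\<And>s m. s \<in> S \<Longrightarrow> m \<in> nsmat \<Longrightarrow> s ** ratm m \<in> S"
    and dir: "\<And>s t. s \<in> S \<Longrightarrow> t \<in> S \<Longrightarrow>
      \<exists>h\<in>S. \<exists>m\<in>nsmat. \<exists>m'\<in>nsmat. s = h ** ratm m \<and> t = h ** ratm m'"
  shows "\<exists>A\<in>intermediate_groups. frames A = S"
proof -
  define A where "A = {s *v ratv w | s w. s \<in> S}"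
  have pair: "\<exists>h\<in>S. \<exists>w w'. u = h *v ratv w \<and> v = h *v ratv w'" if "u \<in> A" "v \<in> A" for u v
  proof -
    obtain s w t w' where *: "u = s *v ratv w" "v = t *v ratv w'" "s \<in> S" "t \<in> S"
      using \<open>u \<in> A\<close> \<open>v \<in> A\<close> unfolding A_def by blast
    then obtain h m m' where "h \<in> S" "s = h ** ratm m" "t = h ** ratm m'" using dir by blast
    with * show ?thesis
      by (metis matrix_vector_mul_assoc ratm_ratv)
  qed
  have "u - v \<in> A" if "u \<in> A" "v \<in> A" for u v
  proof -
    obtain h w w' where h: "h \<in> S" "u = h *v ratv w" "v = h *v ratv w'"
      using pair \<open>u \<in> A\<close> \<open>v \<in> A\<close> by blast
    have "u - v = h *v ratv (w - w')"
      unfolding h by (simp add: vec_eq_iff matrix_vector_mult_def sum_2 algebra_simps)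
    with h(1) show ?thesis unfolding A_def by blast
  qed
  moreover have "Z2 \<subseteq> A"
  proof
    fix v assume "v \<in> Z2"
    then obtain w where "v = mat 1 *v ratv w" by (metis Z2_ratvE matrix_vector_mul_lid)
    then show "v \<in> A" using one unfolding A_def by blast
  qed
  ultimately have A: "A \<in> intermediate_groups" by (simp add: intermediate_groups_iff)
  have "s \<in> frames A" if "s \<in> S" for s
  proof -
    have "column j s = s *v ratv (axis j 1)" for j
    proof -
      have "ratv (axis j 1) = axis j 1" by (simp add: vec_eq_iff axis_def)
      then show ?thesis by (simp only: column_eq_mult_axis)
    qed
    then show ?thesis using that inv unfolding frames_def A_def by blast
  qed
  moreover have "g \<in> S" if g: "g \<in> frames A" for g
  proof -
    obtain h w w' where h: "h \<in> S" "column 1 g = h *v ratv w" "column 2 g = h *v ratv w'"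
      using pair[of "column 1 g" "column 2 g"] g by (auto simp: frames_def)
    define k :: "int^2^2" where "k = (\<chi> i j. if j = 1 then w $ i else w' $ i)"
    have "g $ i $ 1 = (h ** ratm k) $ i $ 1" "g $ i $ 2 = (h ** ratm k) $ i $ 2" for i
      using arg_cong[OF h(2), of "\<lambda>v. v $ i"] arg_cong[OF h(3), of "\<lambda>v. v $ i"]
      by (simp_all add: k_def column_def matrix_vector_mult_def matrix_matrix_mult_def sum_2)
    then have gk: "g = h ** ratm k" by (simp add: vec_eq_iff forall_2)
    then have "k \<in> nsmat"
      using frames_factor_nsmat[OF inv[OF h(1)], of k] frames_invertible[OF g] by simp
    then show ?thesis using right[OF h(1)] gk by simp
  qed
  ultimately show ?thesis using A by blast
qed

lemma frames_image:
  assumes "invertible g"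
  shows "frames ((*v) g ` A) = (**) g ` frames A"
proof -
  obtain d where d: "invertible d" "g ** d = mat 1" "d ** g = mat 1" using assms invertibleE by blast
  have *: "d *v (g *v v) = v" "g *v (d *v v) = v" for v
    by (simp_all add: matrix_vector_mul_assoc d)
  show ?thesis
  proof (intro equalityI subsetI)
    fix t assume t: "t \<in> frames ((*v) g ` A)"
    have "d ** t \<in> frames A"
      using t d(1) * unfolding frames_def by (auto simp: column_mult intro!: invertible_prod) (metis
          imageE)
    then show "t \<in> (**) g ` frames A"
      by (intro image_eqI[of _ _ "d ** t"]) (auto simp: matrix_mul_assoc d)
  next
    fix t assume "t \<in> (**) g ` frames A"
    then show "t \<in> frames ((*v) g ` A)"
      using assms unfolding frames_def by (auto simp: column_mult intro!: invertible_prod)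
  qed
qed

lemma frames_inject:
  assumes "A \<in> intermediate_groups" "B \<in> intermediate_groups" "(**) g ` frames A = frames B"
  shows "B = (*v) g ` A"
proof (intro equalityI subsetI)
  fix v assume "v \<in> B"
  then obtain h w where h: "h \<in> frames B" "v = h *v ratv w" using frames_cover assms(2) by metis
  then obtain k where k: "k \<in> frames A" "h = g ** k" using assms(3) by blast
  then have "k *v ratv w \<in> A" using assms(1) intermediate_lincomb by (simp add: frames_def)
  moreover have "v = g *v (k *v ratv w)" by (simp add: h k matrix_vector_mul_assoc)
  ultimately show "v \<in> (*v) g ` A" by blast
next
  fix v assume "v \<in> (*v) g ` A"
  then obtain h w where h: "h \<in> frames A" "v = g *v (h *v ratv w)"
    using frames_cover[OF assms(1)] by (metis imageE)
  then have "g ** h \<in> frames B" using assms(3) by blast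
  then show "v \<in> B" using assms(2) h intermediate_lincomb
    by (simp add: frames_def matrix_vector_mul_assoc)
qed

text \<open>A homomorphism between groups containing \<open>\<int>\<^sup>2\<close> extends uniquely to a linear map of the
  rational plane, because every element has a multiple in \<open>\<int>\<^sup>2\<close>.\<close>

lemma group_iso_iff:
  "(A, B) \<in> group_iso \<longleftrightarrow> A \<in> intermediate_groups \<and> B \<in> intermediate_groups \<and>
     (\<exists>g. invertible g \<and> B = (*v) g ` A)"
proof
  assume "(A, B) \<in> group_iso"
  then have AB: "A \<in> intermediate_groups" "B \<in> intermediate_groups"
    and "\<exists>f. f \<in> iso (Q2\<lparr>carrier := A\<rparr>) (Q2\<lparr>carrier := B\<rparr>)"
    unfolding group_iso_def is_iso_def by auto
  then obtain f where add: "\<And>u v. u \<in> A \<Longrightarrow> v \<in> A \<Longrightarrow> f (u + v) = f u + f v" and bij: "bij_betw f A B"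
    unfolding iso_def hom_def Q2_def by auto
  note ops = intermediate_zero[OF AB(1)] intermediate_add[OF AB(1)] intermediate_neg[OF AB(1)]
    intermediate_scale[OF AB(1)]
  have f0: "f 0 = 0" using add[OF ops(1) ops(1)] by simp
  have neg: "f (- u) = - f u" if "u \<in> A" for u
    using add[OF that ops(3)[OF that]] f0 by (simp add: eq_neg_iff_add_eq_0 add.commute)
  have scn: "f (of_nat n *s u) = of_nat n *s f u" if u: "u \<in> A" for u n
  proof (induction n)
    case (Suc n)
    have "of_nat (Suc n) *s x = of_nat n *s x + x" for x :: "rat^2" by (simp add: vec_eq_iff
        algebra_simps)
    moreover have "f (of_nat n *s u + u) = f (of_nat n *s u) + f u"
      using add[OF _ u] ops(4)[OF u, of "int n"] by simp
    ultimately show ?case using Suc by metis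
  qed (simp add: f0)
  have sc: "f (of_int k *s u) = of_int k *s f u" if u: "u \<in> A" for u k
  proof (cases k rule: int_cases2)
    case (nonpos m)
    have "of_int k *s x = - (of_nat m *s x)" for x :: "rat^2" by (simp add: nonpos vec_eq_iff)
    then show ?thesis using scn[OF u, of m] neg[OF ops(4)[OF u, of "int m"]] by simp
  qed (use scn[OF u] in simp)
  define e :: "2 \<Rightarrow> rat^2" where "e j = axis j 1" for j
  have eA: "e j \<in> A" for j
    using AB(1) unfolding intermediate_groups_iff by (auto simp: Z2_def e_def axis_def)
  define g where "g = (\<chi> i j. f (e j) $ i)"
  have lin: "f u = g *v u" if u: "u \<in> A" for u
  proof -
    obtain n w where n: "n > 0" "of_int n *s u = ratv w" by (rule common_denominator_vec)
    have "ratv w = of_int (w $ 1) *s e 1 + of_int (w $ 2) *s e 2"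
      by (simp add: vec_eq_iff forall_2 e_def axis_def)
    then have "f (ratv w) = of_int (w $ 1) *s f (e 1) + of_int (w $ 2) *s f (e 2)"
      by (simp add: add sc ops(4) eA)
    also have "\<dots> = g *v ratv w"
      by (simp add: vec_eq_iff g_def matrix_vector_mult_def sum_2)
    finally have "of_int n *s f u = of_int n *s (g *v u)"
      using n sc[OF u, of n] by (metis vector_scalar_commute)
    then show ?thesis using n(1) by (simp add: vec_eq_iff)
  qed
  have "invertible g"
  proof -
    have "x = 0" if x: "g *v x = 0" for x
    proof -
      obtain n w where n: "n > 0" "of_int n *s x = ratv w" by (rule common_denominator_vec)
      have wA: "ratv w \<in> A" using AB(1) ratv_Z2 by (auto simp: intermediate_groups_iff)
      have "f (ratv w) = of_int n *s (g *v x)" using lin[OF wA] n(2) by (metis vector_scalar_commute)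
      then have "f (ratv w) = f 0" by (simp add: x f0)
      then have "ratv w = 0" using bij wA ops(1) unfolding bij_betw_def inj_on_def by blast
      then show "x = 0" using n by (metis of_int_eq_0_iff order_less_irrefl vector_mul_eq_0)
    qed
    then show ?thesis by (metis invertible_left_inverse matrix_left_invertible_ker)
  qed
  moreover have "B = (*v) g ` A" using bij lin by (auto simp: bij_betw_def)
  ultimately show "A \<in> intermediate_groups \<and> B \<in> intermediate_groups \<and>
     (\<exists>g. invertible g \<and> B = (*v) g ` A)" using AB by blast
next
  assume *: "A \<in> intermediate_groups \<and> B \<in> intermediate_groups \<and> (\<exists>g. invertible g \<and> B = (*v) g ` A)"
  then obtain g where g: "invertible g" "B = (*v) g ` A" by blast
  obtain d where d: "d ** g = mat 1" using g(1) invertibleE by blast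
  have "inj_on ((*v) g) A"
    by (rule inj_on_inverseI[of _ "(*v) d"]) (simp add: matrix_vector_mul_assoc d)
  then have "(*v) g \<in> iso (Q2\<lparr>carrier := A\<rparr>) (Q2\<lparr>carrier := B\<rparr>)"
    unfolding iso_def hom_def Q2_def g(2)
    by (auto simp: bij_betw_def matrix_vector_right_distrib)
  with * show "(A, B) \<in> group_iso" unfolding group_iso_def is_iso_def by auto
qed

lemma equiv_group_iso: "equiv intermediate_groups group_iso"
proof (rule equivI)
  show "group_iso \<subseteq> intermediate_groups \<times> intermediate_groups" by (auto simp: group_iso_def)
  show "refl_on intermediate_groups group_iso"
  proof (rule refl_onI)
    fix A assume "A \<in> intermediate_groups"
    moreover have "A = (*v) (mat 1) ` A" by simp
    moreover have "invertible (mat 1 :: rat^2^2)" by (simp add: invertible_det_nz)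
    ultimately show "(A, A) \<in> group_iso" unfolding group_iso_iff by blast
  qed
  show "sym group_iso"
  proof (rule symI)
    fix A B assume "(A, B) \<in> group_iso"
    then obtain g where g: "A \<in> intermediate_groups" "B \<in> intermediate_groups" "invertible g"
        "B = (*v) g ` A"
      unfolding group_iso_iff by blast
    then obtain d where d: "invertible d" "d ** g = mat 1" using invertibleE by blast
    have "A = (*v) d ` B" by (simp add: g(4) image_image matrix_vector_mul_assoc d)
    with g d show "(B, A) \<in> group_iso" unfolding group_iso_iff by blast
  qed
  show "trans group_iso"
  proof (rule transI)
    fix A B C assume "(A, B) \<in> group_iso" "(B, C) \<in> group_iso"
    then obtain g h where g: "A \<in> intermediate_groups" "B \<in> intermediate_groups" "invertible g"
        "B = (*v) g ` A"
      "C \<in> intermediate_groups" "invertible h" "C = (*v) h ` B"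
      unfolding group_iso_iff by blast
    have "C = (*v) (h ** g) ` A" by (simp add: g image_image matrix_vector_mul_assoc)
    moreover have "invertible (h ** g)" using g(6,3) by (rule invertible_prod)
    ultimately show "(A, C) \<in> group_iso" using g(1,5) unfolding group_iso_iff by blast
  qed
qed

section \<open>Profinite integers one prime at a time\<close>

lemma zhat_glue:
  assumes "\<And>p k. prime p \<Longrightarrow> [f p (Suc k) = f p k] (mod int p ^ k)"
  obtains z where "\<And>p k. prime p \<Longrightarrow> zhat_comp z p k = f p k mod int p ^ k"
proof -
  have mem: "(\<lambda>p\<in>{p. prime p}. \<lambda>k. f p k mod int p ^ k) \<in> (\<Pi>\<^sub>E p\<in>{p. prime p}. padic_ints p)"
    using assms by (auto intro!: padic_intsI simp: prime_gt_0_nat)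
  show ?thesis
    by (rule that[of "Abs_zhat (\<lambda>p\<in>{p. prime p}. \<lambda>k. f p k mod int p ^ k)"])
       (simp add: Abs_zhat_inverse[OF mem])
qed

lemma zhat_choose:
  obtains z where "\<And>p. prime p \<Longrightarrow> zhat_comp z p = zhat_comp (g p) p"
proof -
  obtain z where "\<And>p k. prime p \<Longrightarrow> zhat_comp z p k = zhat_comp (g p) p k mod int p ^ k"
    using zhat_glue[of "\<lambda>p. zhat_comp (g p) p"] zhat_comp_cong by metis
  then show ?thesis using that by (metis ext zhat_comp_mod)
qed

lemma zhat_comp_diff:
  assumes "prime p"
  shows "zhat_comp (a - b) p k = (zhat_comp a p k - zhat_comp b p k) mod int p ^ k"
  using zhat_comp_simps(3)[OF assms, of a "- b" k] zhat_comp_simps(5)[OF assms, of b k]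
  by (simp add: mod_simps)

text \<open>Divisibility by \<open>p\<^sup>k\<close> and equality at the prime \<open>p\<close>. Statements about \<open>\<int>\<^sub>p\<close> are made for
  profinite integers modulo equality at \<open>p\<close>, so that one type serves for all primes and solutions at the
  different primes can be glued.\<close>

definition pdvd :: "nat \<Rightarrow> nat \<Rightarrow> zhat \<Rightarrow> bool" where
  "pdvd p k z \<longleftrightarrow> zhat_comp z p k = 0"

definition peq :: "nat \<Rightarrow> zhat \<Rightarrow> zhat \<Rightarrow> bool" where
  "peq p a b \<longleftrightarrow> zhat_comp a p = zhat_comp b p"

context
  fixes p :: nat assumes p: "prime p"
begin

lemma pdvd_zero: "pdvd p k 0"
  using p by (simp add: pdvd_def zhat_comp_simps)

lemma pdvd_add: "pdvd p k a \<Longrightarrow> pdvd p k b \<Longrightarrow> pdvd p k (a + b)"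
  using p by (simp add: pdvd_def zhat_comp_simps)

lemma pdvd_minus: "pdvd p k a \<Longrightarrow> pdvd p k (- a)"
  using p by (simp add: pdvd_def zhat_comp_simps)

lemma pdvd_diff: "pdvd p k a \<Longrightarrow> pdvd p k b \<Longrightarrow> pdvd p k (a - b)"
  using pdvd_add[of k a "- b"] pdvd_minus[of k b] by simp

lemma pdvd_mult: "pdvd p k b \<Longrightarrow> pdvd p k (a * b)"
  using p by (simp add: pdvd_def zhat_comp_simps)

lemma pdvd_of_int: "pdvd p k (of_int a) \<longleftrightarrow> int p ^ k dvd a"
  using p by (simp add: pdvd_def zhat_comp_of_int dvd_eq_mod_eq_0)

lemma pdvd_approx: "pdvd p k (z - of_int (zhat_comp z p k))"
proof -
  have "zhat_comp (z - of_int (zhat_comp z p k)) p k = (zhat_comp z p k - zhat_comp z p k mod int p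
      ^ k) mod int p ^ k"
    using p by (simp add: zhat_comp_diff zhat_comp_of_int mod_simps)
  then show ?thesis unfolding pdvd_def using p by (simp add: zhat_comp_mod)
qed

lemma pdvd_iff_dvd_comp: "pdvd p k z \<longleftrightarrow> int p ^ k dvd zhat_comp z p (k + j)"
  using padic_ints_mod_add[OF zhat_comp_padic[OF p], of z k j]
  by (simp add: pdvd_def dvd_eq_mod_eq_0)

lemma pdvd_shift: "pdvd p (i + k) (of_int (int p ^ i) * z) \<longleftrightarrow> pdvd p k z"
proof -
  have "pdvd p (i + k) (of_int (int p ^ i) * z) \<longleftrightarrow> int p ^ i * int p ^ k dvd int p ^ i * zhat_comp z
      p (i + k)"
    using p unfolding pdvd_def
    by (simp add: zhat_comp_simps zhat_comp_of_int mod_simps power_add dvd_eq_mod_eq_0 del: of_int_power)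
  also have "\<dots> \<longleftrightarrow> int p ^ k dvd zhat_comp z p (k + i)"
    using p by (simp add: prime_gt_0_nat add.commute)
  finally show ?thesis by (simp only: pdvd_iff_dvd_comp[of k z i])
qed

lemma peq_iff_pdvd: "peq p a b \<longleftrightarrow> (\<forall>k. pdvd p k (a - b))"
proof
  assume "peq p a b"
  then have "zhat_comp (a - b) p k = 0" for k
    unfolding peq_def using p by (simp add: zhat_comp_diff)
  then show "\<forall>k. pdvd p k (a - b)" by (simp add: pdvd_def)
next
  assume *: "\<forall>k. pdvd p k (a - b)"
  have "zhat_comp a p k = zhat_comp b p k" for k
  proof -
    have "zhat_comp a p k = zhat_comp ((a - b) + b) p k" by simp
    also have "\<dots> = (zhat_comp (a - b) p k + zhat_comp b p k) mod int p ^ k"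
      using p by (simp only: zhat_comp_simps)
    finally show ?thesis using * p by (simp add: pdvd_def zhat_comp_mod)
  qed
  then show "peq p a b" by (auto simp: peq_def)
qed

lemma pdvd_divide:
  assumes "pdvd p i z"
  obtains y where "peq p z (of_int (int p ^ i) * y)"
proof -
  define f where "f q k = (if q = p then zhat_comp z p (k + i) div int p ^ i else 0)" for q k
  have d: "int p ^ i dvd zhat_comp z p (k + i)" for k
    using assms pdvd_iff_dvd_comp[of i z k] by (simp add: add.commute)
  have "[f q (Suc k) = f q k] (mod int q ^ k)" for q k
  proof (cases "q = p")
    case True
    have "[zhat_comp z p (Suc (k + i)) = zhat_comp z p (k + i)] (mod int p ^ (k + i))"
      by (rule zhat_comp_cong[OF p])
    then have "int p ^ k * int p ^ i dvd zhat_comp z p (Suc k + i) - zhat_comp z p (k + i)"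
      by (simp add: cong_iff_dvd_diff power_add)
    moreover have "zhat_comp z p (Suc k + i) - zhat_comp z p (k + i) = (f p (Suc k) - f p k) * int p ^ i"
      using d[of "Suc k"] d[of k] by (simp add: f_def left_diff_distrib)
    ultimately show ?thesis using True p by (simp add: cong_iff_dvd_diff prime_gt_0_nat)
  qed (simp add: f_def)
  from zhat_glue[OF this] obtain y where y: "\<And>q k. prime q \<Longrightarrow> zhat_comp y q k = f q k mod int q ^ k"
    by metis
  have "zhat_comp z p k = zhat_comp (of_int (int p ^ i) * y) p k" for k
  proof -
    have "zhat_comp (of_int (int p ^ i) * y) p k = (int p ^ i * f p k) mod int p ^ k"
      using p by (simp add: zhat_comp_simps zhat_comp_of_int y mod_simps del: of_int_power)
    also have "\<dots> = zhat_comp z p (k + i) mod int p ^ k" using d[of k] by (simp add: f_def)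
    also have "\<dots> = zhat_comp z p k" using padic_ints_mod_add[OF zhat_comp_padic[OF p]] by simp
    finally show ?thesis by simp
  qed
  then have "peq p z (of_int (int p ^ i) * y)" by (auto simp: peq_def)
  then show ?thesis by (rule that)
qed

lemma peq_refl: "peq p a a" by (simp add: peq_def)

lemma peq_sym: "peq p a b \<Longrightarrow> peq p b a" by (simp add: peq_def)

lemma peq_trans: "peq p a b \<Longrightarrow> peq p b c \<Longrightarrow> peq p a c" by (simp add: peq_def)

lemma peq_add: "peq p a b \<Longrightarrow> peq p c d \<Longrightarrow> peq p (a + c) (b + d)"
  using p by (auto simp: peq_def fun_eq_iff zhat_comp_simps)

lemma peq_mult: "peq p a b \<Longrightarrow> peq p c d \<Longrightarrow> peq p (a * c) (b * d)"
  using p by (auto simp: peq_def fun_eq_iff zhat_comp_simps)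

lemma peq_minus: "peq p a b \<Longrightarrow> peq p (- a) (- b)"
  using p by (auto simp: peq_def fun_eq_iff zhat_comp_simps)

lemma peq_diff: "peq p a b \<Longrightarrow> peq p c d \<Longrightarrow> peq p (a - c) (b - d)"
  using peq_add[of a b "- c" "- d"] peq_minus[of c d] by simp

lemma peq_pdvd: "peq p a b \<Longrightarrow> pdvd p k a \<longleftrightarrow> pdvd p k b"
  by (simp add: peq_def pdvd_def)

end

text \<open>Inverses modulo \<open>p\<^sup>k\<close> exist because the component modulo \<open>p\<close> is not zero, and they are coherent
  because inverses are unique.\<close>

lemma zhat_unitI:
  assumes "\<And>p. prime p \<Longrightarrow> \<not> pdvd p 1 z"
  obtains y where "z * y = 1"
proof -
  define f where "f p k = (SOME u. [zhat_comp z p k * u = 1] (mod int p ^ k))" for p k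
  have f: "[zhat_comp z p k * f p k = 1] (mod int p ^ k)" if p: "prime p" for p k
  proof -
    have "coprime (zhat_comp z p k) (int p ^ k)"
    proof (cases k)
      case (Suc l)
      have "\<not> int p dvd zhat_comp z p k"
        using assms[OF p] pdvd_iff_dvd_comp[OF p, of 1 z l] by (simp add: Suc)
      then show ?thesis using p by (simp add: prime_imp_coprime coprime_commute)
    qed simp
    then have "\<exists>u. [zhat_comp z p k * u = 1] (mod int p ^ k)" by (rule cong_solve_coprime_int)
    then show ?thesis unfolding f_def by (rule someI_ex)
  qed
  have coh: "[f p (Suc k) = f p k] (mod int p ^ k)" if p: "prime p" for p k
  proof -
    have "[zhat_comp z p (Suc k) * f p (Suc k) = 1] (mod int p ^ k)"
      using f[OF p, of "Suc k"] by (rule cong_dvd_modulus) simp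
    then have "[zhat_comp z p k * f p (Suc k) = 1] (mod int p ^ k)"
      using cong_mult[OF zhat_comp_cong[OF p, of z k] cong_refl[of "f p (Suc k)"]]
      by (meson cong_sym cong_trans)
    then have a: "[f p k * (zhat_comp z p k * f p (Suc k)) = f p k * 1] (mod int p ^ k)"
      by (rule cong_scalar_left)
    have b: "[f p (Suc k) * (zhat_comp z p k * f p k) = f p (Suc k) * 1] (mod int p ^ k)"
      using f[OF p] by (rule cong_scalar_left)
    have "f p (Suc k) * (zhat_comp z p k * f p k) = f p k * (zhat_comp z p k * f p (Suc k))"
      by (simp add: mult_ac)
    then show ?thesis using a b by (metis cong_sym cong_trans mult.right_neutral)
  qed
  obtain y where y: "\<And>p k. prime p \<Longrightarrow> zhat_comp y p k = f p k mod int p ^ k"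
    using zhat_glue[OF coh] by metis
  have "z * y = 1"
    by (rule zhat_eqI) (use f in \<open>simp add: zhat_comp_simps y mod_simps cong_def\<close>)
  then show ?thesis by (rule that)
qed

lemma invertible_zhat_matrix:
  fixes c :: "zhat^2^2"
  assumes "\<And>p. prime p \<Longrightarrow> \<not> pdvd p 1 (det c)"
  shows "invertible c"
proof -
  obtain y where y: "det c * y = 1" using zhat_unitI[OF assms] by metis
  define d :: "zhat^2^2" where
    "d = (\<chi> i j. y * (if i = 1 then (if j = 1 then c$2$2 else - c$1$2) else (if j = 1 then - c$2$1
        else c$1$1)))"
  have *: "(c$1$1 * c$2$2 - c$1$2 * c$2$1) * y = 1" using y by (simp add: det_2)
  have "c ** d = mat 1" "d ** c = mat 1"
    using * by (simp_all add: vec_eq_iff forall_2 matrix_matrix_mult_def sum_2 d_def mat_def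
        algebra_simps)
  then show ?thesis unfolding invertible_def by blast
qed

text \<open>At each prime \<open>n\<close> is a power of \<open>p\<close> times a unit. The units glue to an invertible profinite
  integer and the quotients by the powers of \<open>p\<close> glue as well.\<close>

lemma zhat_of_int_dvd_iff:
  assumes "n > 0"
  shows "of_int n dvd z \<longleftrightarrow> (\<forall>p. prime p \<longrightarrow> pdvd p (multiplicity (int p) n) z)"
proof
  assume "of_int n dvd z"
  then obtain y where z: "z = y * of_int n" by (metis dvd_def mult.commute)
  show "\<forall>p. prime p \<longrightarrow> pdvd p (multiplicity (int p) n) z"
    unfolding z by (intro allI impI pdvd_mult) (simp_all add: pdvd_of_int multiplicity_dvd)
next
  assume d: "\<forall>p. prime p \<longrightarrow> pdvd p (multiplicity (int p) n) z"
  have "\<exists>m. n = int p ^ multiplicity (int p) n * m \<and> \<not> int p dvd m" if "prime p" for p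
    using multiplicity_decompose'[of n "int p"] assms that
    by (metis not_prime_unit order_less_irrefl prime_nat_int_transfer)
  then obtain m where m: "\<And>p. prime p \<Longrightarrow> n = int p ^ multiplicity (int p) n * m p"
    "\<And>p. prime p \<Longrightarrow> \<not> int p dvd m p" by metis
  have "\<exists>y. peq p z (of_int (int p ^ multiplicity (int p) n) * y)" if "prime p" for p
    using pdvd_divide[OF that] d that by metis
  then obtain y where y: "\<And>p. prime p \<Longrightarrow> peq p z (of_int (int p ^ multiplicity (int p) n) * y p)"
    by metis
  obtain u where u: "\<And>p. prime p \<Longrightarrow> zhat_comp u p = zhat_comp (of_int (m p)) p"
    using zhat_choose[of "\<lambda>p. of_int (m p)"] by blast
  obtain w where w: "\<And>p. prime p \<Longrightarrow> zhat_comp w p = zhat_comp (y p) p"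
    using zhat_choose by blast
  have "\<not> pdvd p 1 u" if p: "prime p" for p
  proof -
    have "pdvd p 1 u \<longleftrightarrow> pdvd p 1 (of_int (m p))" using u[OF p] by (simp add: pdvd_def)
    then show ?thesis using m(2)[OF p] p by (simp add: pdvd_of_int)
  qed
  then obtain v where v: "u * v = 1" using zhat_unitI by metis
  have "u * z = of_int n * w"
  proof (rule zhat_eqI)
    fix p k assume p: "prime (p :: nat)"
    have "peq p (u * z) (of_int (m p) * (of_int (int p ^ multiplicity (int p) n) * w))"
      using u[OF p] w[OF p] y[OF p] by (intro peq_mult[OF p]) (auto simp: peq_def
          zhat_comp_simps[OF p] fun_eq_iff)
    also have "of_int (m p) * (of_int (int p ^ multiplicity (int p) n) * w) = of_int n * w"
      by (subst (2) m(1)[OF p]) (simp add: mult_ac)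
    finally show "zhat_comp (u * z) p k = zhat_comp (of_int n * w) p k" by (simp add: peq_def)
  qed
  then have "z = of_int n * (v * w)"
    using v by (metis mult.assoc mult.commute mult.right_neutral)
  then show "of_int n dvd z" by simp
qed

section \<open>Matrices with prescribed kernels at a prime\<close>

text \<open>For a matrix \<open>x\<close> over \<open>\<int>\<^sub>p\<close> let \<open>K k\<close> be the set of integral vectors killed by \<open>x\<close> modulo \<open>p\<^sup>k\<close>.
  Equivalently, a family \<open>K\<close> as below describes a group \<open>B\<close> with \<open>\<int>\<^sub>p\<^sup>2 \<subseteq> B \<subseteq> \<rat>\<^sub>p\<^sup>2\<close> through the numerators
  of its elements of denominator \<open>p\<^sup>k\<close>. The aim is that every such family comes from a matrix, which is
  unique up to a unit on the left.\<close>

definition kernel_family :: "nat \<Rightarrow> (nat \<Rightarrow> int \<Rightarrow> int \<Rightarrow> bool) \<Rightarrow> bool" where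
  "kernel_family p K \<longleftrightarrow> (\<forall>a b. K 0 a b) \<and>
     (\<forall>k a b a' b'. K k a b \<longrightarrow> K k a' b' \<longrightarrow> K k (a - a') (b - b')) \<and>
     (\<forall>k a b. K (Suc k) (int p * a) (int p * b) \<longleftrightarrow> K k a b)"

definition solves :: "nat \<Rightarrow> (nat \<Rightarrow> int \<Rightarrow> int \<Rightarrow> bool) \<Rightarrow> zhat^2^2 \<Rightarrow> bool" where
  "solves p K x \<longleftrightarrow>
     (\<forall>k a b. K k a b \<longleftrightarrow> (\<forall>i. pdvd p k (x $ i $ 1 * of_int a + x $ i $ 2 * of_int b)))"

text \<open>The factor \<open>c\<close> needs to be invertible only at \<open>p\<close>: such factors for all primes glue to an
  invertible profinite matrix.\<close>

definition universal_solution :: "nat \<Rightarrow> (nat \<Rightarrow> int \<Rightarrow> int \<Rightarrow> bool) \<Rightarrow> zhat^2^2 \<Rightarrow> bool" where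
  "universal_solution p K N \<longleftrightarrow> solves p K N \<and>
     (\<forall>x. solves p K x \<longrightarrow>
        (\<exists>c. (\<forall>i j. peq p (x $ i $ j) ((c ** N) $ i $ j)) \<and> \<not> pdvd p 1 (det c)))"

context
  fixes p K assumes p: "prime (p :: nat)" and kf: "kernel_family p K"
begin

lemma kernel_base: "K 0 a b"
  using kf by (simp add: kernel_family_def)

lemma kernel_diff: "K k a b \<Longrightarrow> K k a' b' \<Longrightarrow> K k (a - a') (b - b')"
  using kf by (simp add: kernel_family_def)

lemma kernel_Suc: "K (Suc k) (int p * a) (int p * b) \<longleftrightarrow> K k a b"
  using kf by (simp add: kernel_family_def)

lemma kernel_pow: "K (k + l) (int p ^ l * a) (int p ^ l * b) \<longleftrightarrow> K k a b"
  by (induction l) (simp_all add: kernel_Suc mult.assoc)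

lemma kernel_zero: "K k 0 0"
  using kernel_pow[of 0 k 0 0] kernel_base by simp

lemma kernel_add: "K k a b \<Longrightarrow> K k a' b' \<Longrightarrow> K k (a + a') (b + b')"
  using kernel_diff[of k a b "- a'" "- b'"] kernel_diff[OF kernel_zero, of k a' b'] by simp

lemma kernel_mult: "K k a b \<Longrightarrow> K k (n * a) (n * b)"
proof (induction n rule: int_induct[of _ 0])
  case base
  show ?case by (simp add: kernel_zero)
next
  case (step1 i)
  then show ?case using kernel_add[of k "i * a" "i * b" a b] by (simp add: algebra_simps)
next
  case (step2 i)
  then show ?case using kernel_diff[of k "i * a" "i * b" a b] by (simp add: algebra_simps)
qed

lemma kernel_trivial: "int p ^ k dvd a \<Longrightarrow> int p ^ k dvd b \<Longrightarrow> K k a b"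
  using kernel_pow[of 0 k] kernel_base by (auto simp: dvd_def)

lemma kernel_mono: "K k a b \<Longrightarrow> l \<le> k \<Longrightarrow> K l a b"
  using kernel_mult[of k a b "int p ^ (k - l)"] kernel_pow[of l "k - l" a b] by simp

lemma kernel_cong:
  assumes "int p ^ k dvd a - a'" "int p ^ k dvd b - b'"
  shows "K k a b \<longleftrightarrow> K k a' b'"
proof -
  have "K k (a - a') (b - b')" using assms by (rule kernel_trivial)
  then show ?thesis
    using kernel_add[of k "a - a'" "b - b'" a' b'] kernel_diff[of k a b "a - a'" "b - b'"] by auto
qed

text \<open>Powers of \<open>p\<close> are split off from \<open>(a, b)\<close> until \<open>a\<close> is invertible modulo the remaining power of
  \<open>p\<close>; then \<open>(a, b)\<close> is proportional to some \<open>(1, t)\<close>. If \<open>p\<close> divides \<open>a\<close> then it divides \<open>b\<close> too, since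
  \<open>(0, 1)\<close> does not lie in \<open>K 1\<close>.\<close>

lemma kernel_slope:
  assumes n01: "\<not> K 1 0 1" and "K k a b"
  shows "\<exists>l t. l \<le> k \<and> int p ^ l dvd a \<and> K (k - l) 1 t \<and> int p ^ k dvd b - a * t"
  using assms(2)
proof (induction k arbitrary: a b)
  case 0
  show ?case using kernel_base by auto
next
  case (Suc k)
  have pp: "prime (int p)" using p by simp
  show ?case
  proof (cases "int p dvd a")
    case False
    then have "coprime (int p) a" using pp by (simp add: prime_imp_coprime)
    then have "coprime a (int p ^ Suc k)" by (simp add: coprime_commute)
    then obtain u where "[a * u = 1] (mod int p ^ Suc k)" using cong_solve_coprime_int by blast
    then have u: "int p ^ Suc k dvd a * u - 1" by (simp add: cong_iff_dvd_diff)
    have "K (Suc k) (u * a) (u * b)" using Suc.prems by (rule kernel_mult)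
    then have "K (Suc k) 1 (u * b)"
      using kernel_cong[of "Suc k" "u * a" 1 "u * b" "u * b"] u by (simp add: mult.commute)
    moreover have "b - a * (u * b) = - (b * (a * u - 1))" by (simp add: algebra_simps)
    then have "int p ^ Suc k dvd b - a * (u * b)" using u by simp
    ultimately show ?thesis by (intro exI[of _ 0] exI[of _ "u * b"]) auto
  next
    case True
    then obtain a' where a: "a = int p * a'" by blast
    have "K 1 a b" using Suc.prems kernel_mono[of "Suc k" a b 1] by simp
    moreover have "K 1 a 0" using kernel_trivial[of 1 a 0] True by simp
    ultimately have K1: "K 1 0 b" using kernel_diff[of 1 a b a 0] by simp
    have "int p dvd b"
    proof (rule ccontr)
      assume "\<not> int p dvd b"
      then have "coprime (int p) b" using pp by (simp add: prime_imp_coprime)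
      then have "coprime b (int p ^ 1)" by (simp add: coprime_commute)
      then obtain u where "[b * u = 1] (mod int p ^ 1)" using cong_solve_coprime_int by blast
      then have "K 1 (u * 0) (u * b) \<longleftrightarrow> K 1 0 1"
        by (intro kernel_cong) (simp_all add: cong_iff_dvd_diff mult.commute)
      with n01 kernel_mult[OF K1, of u] show False by simp
    qed
    then obtain b' where b: "b = int p * b'" by blast
    have "K k a' b'" using Suc.prems by (simp add: a b kernel_Suc)
    from Suc.IH[OF this] obtain l t where
      *: "l \<le> k" "int p ^ l dvd a'" "K (k - l) 1 t" "int p ^ k dvd b' - a' * t" by blast
    have "b - a * t = int p * (b' - a' * t)" by (simp add: a b algebra_simps)
    with * show ?thesis
      by (intro exI[of _ "Suc l"] exI[of _ t]) (simp add: a mult_dvd_mono)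
  qed
qed

lemma kernel_slope_unique:
  assumes n01: "\<not> K 1 0 1" and "K k 1 t" "K k 1 t'"
  shows "int p ^ k dvd t - t'"
proof -
  have "K k 0 (t - t')" using kernel_diff[OF assms(2,3)] by simp
  from kernel_slope[OF n01 this] show ?thesis by auto
qed

end

text \<open>A matrix that is singular modulo a prime kills a column of its adjugate; if the adjugate vanishes
  modulo the prime, so does the matrix.\<close>

lemma mod_matrix_kernel:
  fixes c11 c12 c21 c22 :: int
  assumes "prime (q :: int)" "q dvd c11 * c22 - c12 * c21"
  shows "\<exists>u v. \<not> (q dvd u \<and> q dvd v) \<and> q dvd c11 * u + c12 * v \<and> q dvd c21 * u + c22 * v"
proof (cases "q dvd c22 \<and> q dvd c21")
  case False
  then show ?thesis
    using assms(2) by (intro exI[of _ c22] exI[of _ "- c21"]) (auto simp: algebra_simps)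
next
  case c2: True
  show ?thesis
  proof (cases "q dvd c12 \<and> q dvd c11")
    case False
    then show ?thesis
      using c2 by (intro exI[of _ c12] exI[of _ "- c11"]) (auto simp: algebra_simps)
  next
    case True
    then show ?thesis
      using c2 assms(1) by (intro exI[of _ 1] exI[of _ 0]) (auto simp: not_prime_unit)
  qed
qed

text \<open>If \<open>(0, 1)\<close> does not lie in \<open>K 1\<close>, then the group described by \<open>K\<close> is \<open>\<int>\<^sub>p\<^sup>2\<close> extended by the
  vectors \<open>(1, t) / p\<^sup>k\<close> with \<open>k \<le> j\<close>, for a \<open>p\<close>-adic integer \<open>t\<close> and a bound \<open>j\<close> that may be infinite.
  It consists of the vectors on which the rows \<open>(-t, 1)\<close> and \<open>(p\<^sup>j, 0)\<close> are integral, with \<open>p\<^sup>j = 0\<close> for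
  infinite \<open>j\<close>.\<close>

lemma universal_solution_primitive:
  assumes p: "prime (p :: nat)" and kf: "kernel_family p K" and n01: "\<not> K 1 0 1"
  shows "\<exists>N. universal_solution p K N"
proof -
  note kernel_mono = kernel_mono[OF p kf] and kernel_slope = kernel_slope[OF p kf n01]
    and kernel_slope_unique = kernel_slope_unique[OF p kf n01]
  note pd = pdvd_zero[OF p] pdvd_add[OF p] pdvd_diff[OF p] pdvd_mult[OF p] pdvd_of_int[OF p]
  have pp: "prime (int p)" using p by simp
  define J where "J = {k. \<exists>t. K k 1 t}"
  have J0: "0 \<in> J" using kernel_base[OF p kf] by (auto simp: J_def)
  have Jdown: "l \<in> J" if "k \<in> J" "l \<le> k" for k l
    using that kernel_mono unfolding J_def by blast
  \<comment> \<open>In an equation \<open>x = c N\<close> with \<open>N\<close> having the rows \<open>(-t, 1)\<close> and \<open>(d, 0)\<close>, the first column of \<open>c\<close> is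
  the second column of \<open>x\<close>, and \<open>d\<close> times the second column \<open>c2\<close> of \<open>c\<close> is the vector \<open>x (1, t)\<close>.\<close>
  have build: ?thesis
    if tJ: "\<And>k. k \<in> J \<Longrightarrow> K k 1 (zhat_comp t p k)"
      and d: "\<And>k a. pdvd p k (d * of_int a) \<longleftrightarrow> (\<exists>l\<le>k. int p ^ l dvd a \<and> k - l \<in> J)"
      and uni: "\<And>x. solves p K x \<Longrightarrow> \<exists>c2. (\<forall>i. peq p (x $ i $ 1 + x $ i $ 2 * t) (d * c2 i)) \<and>
          \<not> pdvd p 1 (x $ 1 $ 2 * c2 2 - c2 1 * x $ 2 $ 2)"
    for t d
  proof -
    define N :: "zhat^2^2" where
      "N = (\<chi> i j. if i = 1 then (if j = 1 then - t else 1) else (if j = 1 then d else 0))"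
    have "K k a b \<longleftrightarrow> pdvd p k (of_int b - t * of_int a) \<and> pdvd p k (d * of_int a)" for k a b
    proof
      assume "K k a b"
      from kernel_slope[OF this] obtain l t' where
        *: "l \<le> k" "int p ^ l dvd a" "K (k - l) 1 t'" "int p ^ k dvd b - a * t'" by blast
      then have lJ: "k - l \<in> J" by (auto simp: J_def)
      obtain a' where a': "a = int p ^ l * a'" using *(2) by blast
      have "int p ^ (k - l) dvd t' - zhat_comp t p (k - l)"
        using kernel_slope_unique *(3) tJ[OF lJ] by blast
      then have "pdvd p (k - l) (of_int (t' - zhat_comp t p (k - l)))" by (simp only: pd)
      then have "pdvd p (k - l) (of_int (t' - zhat_comp t p (k - l)) - (t - of_int (zhat_comp t p (k
          - l))))"
        by (rule pdvd_diff[OF p _ pdvd_approx[OF p]])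
      then have "pdvd p (k - l) (of_int t' - t)" by (simp add: algebra_simps)
      then have "pdvd p (k - l) (of_int a' * (of_int t' - t))" by (rule pdvd_mult[OF p])
      then have "pdvd p (l + (k - l)) (of_int (int p ^ l) * (of_int a' * (of_int t' - t)))"
        by (simp only: pdvd_shift[OF p])
      moreover have "of_int (int p ^ l) * (of_int a' * (of_int t' - t)) = of_int a * (of_int t' - t)"
        by (simp add: a')
      ultimately have "pdvd p k (of_int a * (of_int t' - t))" using *(1) by simp
      moreover have "pdvd p k (of_int (b - a * t'))" using *(4) by (simp only: pd)
      ultimately have "pdvd p k (of_int (b - a * t') + of_int a * (of_int t' - t))"
        by (intro pdvd_add[OF p])
      then have "pdvd p k (of_int b - t * of_int a)" by (simp add: algebra_simps)
      with * lJ show "pdvd p k (of_int b - t * of_int a) \<and> pdvd p k (d * of_int a)"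
        unfolding d by blast
    next
      assume *: "pdvd p k (of_int b - t * of_int a) \<and> pdvd p k (d * of_int a)"
      then obtain l where l: "l \<le> k" "int p ^ l dvd a" "k - l \<in> J" unfolding d by blast
      obtain a' where a': "a = int p ^ l * a'" using l(2) by blast
      define T where "T = zhat_comp t p (k - l)"
      have "K (k - l) (a' * 1) (a' * T)"
        using tJ[OF l(3)] unfolding T_def by (rule kernel_mult[OF p kf])
      then have "K (k - l + l) (int p ^ l * (a' * 1)) (int p ^ l * (a' * T))"
        by (simp only: kernel_pow[OF p kf])
      then have KT: "K k a (a * T)" using l(1) by (simp add: a' mult.assoc)
      have "pdvd p (k - l) (of_int a' * (t - of_int T))"
        unfolding T_def by (intro pdvd_mult[OF p] pdvd_approx[OF p])
      then have "pdvd p (l + (k - l)) (of_int (int p ^ l) * (of_int a' * (t - of_int T)))"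
        by (simp only: pdvd_shift[OF p])
      moreover have "of_int (int p ^ l) * (of_int a' * (t - of_int T)) = of_int a * (t - of_int T)"
        by (simp add: a')
      ultimately have "pdvd p k (of_int a * (t - of_int T))" using l(1) by simp
      then have "pdvd p k ((of_int b - t * of_int a) + of_int a * (t - of_int T))"
        using * by (intro pdvd_add[OF p]) auto
      then have "pdvd p k (of_int (b - a * T))" by (simp add: algebra_simps)
      then have "int p ^ k dvd b - a * T" by (simp only: pd)
      then show "K k a b" using kernel_cong[OF p kf, of k a a b "a * T"] KT by simp
    qed
    then have "solves p K N"
      by (simp add: solves_def forall_2 N_def algebra_simps)
    moreover have "\<exists>c. (\<forall>i j. peq p (x $ i $ j) ((c ** N) $ i $ j)) \<and> \<not> pdvd p 1 (det c)"
      if x: "solves p K x" for x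
    proof -
      obtain c2 where c2: "\<And>i. peq p (x $ i $ 1 + x $ i $ 2 * t) (d * c2 i)"
        "\<not> pdvd p 1 (x $ 1 $ 2 * c2 2 - c2 1 * x $ 2 $ 2)" using uni[OF x] by blast
      define c :: "zhat^2^2" where "c = (\<chi> i j. if j = 1 then x $ i $ 2 else c2 i)"
      have "peq p (x $ i $ 1) ((c ** N) $ i $ 1)" for i
      proof -
        have "peq p ((x $ i $ 1 + x $ i $ 2 * t) - x $ i $ 2 * t) (d * c2 i - x $ i $ 2 * t)"
          using c2(1) by (intro peq_diff[OF p] peq_refl[OF p])
        then show ?thesis by (simp add: c_def N_def matrix_matrix_mult_def sum_2 algebra_simps)
      qed
      moreover have "(c ** N) $ i $ 2 = x $ i $ 2" for i
        by (simp add: c_def N_def matrix_matrix_mult_def sum_2)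
      moreover have "det c = x $ 1 $ 2 * c2 2 - c2 1 * x $ 2 $ 2" by (simp add: c_def det_2)
      ultimately show ?thesis using c2(2) peq_refl[OF p]
        by (intro exI[of _ c]) (simp add: forall_2)
    qed
    ultimately show ?thesis unfolding universal_solution_def by blast
  qed
  show ?thesis
  proof (cases "J = UNIV")
    case True
    then have "\<forall>k. \<exists>t. K k 1 t" by (auto simp: J_def)
    then obtain \<tau> where \<tau>: "\<And>k. K k 1 (\<tau> k)" by metis
    have "[\<tau> (Suc k) = \<tau> k] (mod int p ^ k)" for k
      using kernel_slope_unique[OF kernel_mono[OF \<tau>[of "Suc k"]] \<tau>[of k]]
          by (simp add: cong_iff_dvd_diff)
    then have coh: "[(if q = p then \<tau> (Suc k) else 0) = (if q = p then \<tau> k else 0)] (mod int q ^ k)"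
        for q k
      by simp
    from zhat_glue[of "\<lambda>q k. if q = p then \<tau> k else 0", OF coh]
    obtain t where t: "\<And>q k. prime q \<Longrightarrow> zhat_comp t q k = (if q = p then \<tau> k else 0) mod int q ^ k"
      by blast
    have tK: "K k 1 (zhat_comp t p k)" for k
    proof -
      have "int p ^ k dvd zhat_comp t p k - \<tau> k"
        using p by (simp add: t dvd_diff_commute[of _ _ "\<tau> k"] minus_mod_eq_mult_div)
      then show ?thesis using kernel_cong[OF p kf, of k 1 1 "zhat_comp t p k" "\<tau> k"] \<tau> by simp
    qed
    show ?thesis
    proof (rule build[of t 0])
      show "K k 1 (zhat_comp t p k)" for k by (rule tK)
      show "pdvd p k (0 * of_int a) \<longleftrightarrow> (\<exists>l\<le>k. int p ^ l dvd a \<and> k - l \<in> J)" for k a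
        using True pd by (auto intro: exI[of _ 0])
    next
      fix x assume x: "solves p K x"
      have "pdvd p k (x $ i $ 1 + x $ i $ 2 * t)" for i k
      proof -
        have "pdvd p k (x $ i $ 1 + x $ i $ 2 * of_int (zhat_comp t p k))"
          using x tK[of k] unfolding solves_def by fastforce
        then have "pdvd p k ((x $ i $ 1 + x $ i $ 2 * of_int (zhat_comp t p k))
            + x $ i $ 2 * (t - of_int (zhat_comp t p k)))"
          by (rule pdvd_add[OF p _ pdvd_mult[OF p pdvd_approx[OF p]]])
        then show ?thesis by (simp add: algebra_simps)
      qed
      then have z: "peq p (x $ i $ 1 + x $ i $ 2 * t) 0" for i by (simp add: peq_iff_pdvd[OF p])
      have "\<not> (\<forall>i. pdvd p 1 (x $ i $ 2))" using x n01 unfolding solves_def by fastforce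
      then consider "\<not> pdvd p 1 (x $ 1 $ 2)" | "\<not> pdvd p 1 (x $ 2 $ 2)" by (auto simp: forall_2)
      then obtain c2 :: "2 \<Rightarrow> zhat" where "\<not> pdvd p 1 (x $ 1 $ 2 * c2 2 - c2 1 * x $ 2 $ 2)"
      proof cases
        case 1
        then show ?thesis by (intro that[of "\<lambda>i. if i = 2 then 1 else 0"]) simp
      next
        case 2
        then have "\<not> pdvd p 1 (- x $ 2 $ 2)" using pdvd_minus[OF p, of 1 "- x $ 2 $ 2"] by auto
        then show ?thesis by (intro that[of "\<lambda>i. if i = 1 then 1 else 0"]) simp
      qed
      then show "\<exists>c2. (\<forall>i. peq p (x $ i $ 1 + x $ i $ 2 * t) (0 * c2 i)) \<and>
          \<not> pdvd p 1 (x $ 1 $ 2 * c2 2 - c2 1 * x $ 2 $ 2)" using z by auto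
    qed
  next
    case False
    then obtain m where "m \<notin> J" by blast
    then have "k < m" if "k \<in> J" for k using Jdown that by (meson not_le)
    then have fin: "finite J" by (meson finite_nat_iff_bounded lessThan_iff subsetI)
    define j where "j = Max J"
    have jJ: "j \<in> J" and jmax: "\<And>k. k \<in> J \<Longrightarrow> k \<le> j"
      using fin J0 by (auto simp: j_def intro: Max_in)
    have Jiff: "k \<in> J \<longleftrightarrow> k \<le> j" for k using Jdown jJ jmax by blast
    obtain \<tau> where \<tau>: "K j 1 \<tau>" using jJ by (auto simp: J_def)
    show ?thesis
    proof (rule build[of "of_int \<tau>" "of_int (int p ^ j)"])
      fix k assume "k \<in> J"
      then have "K k 1 \<tau>" using \<tau> kernel_mono Jiff by blast
      moreover have "int p ^ k dvd zhat_comp (of_int \<tau>) p k - \<tau>"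
        using p by (simp add: zhat_comp_of_int dvd_diff_commute[of _ _ \<tau>] minus_mod_eq_mult_div)
      ultimately show "K k 1 (zhat_comp (of_int \<tau>) p k)"
        using kernel_cong[OF p kf, of k 1 1 "zhat_comp (of_int \<tau>) p k" \<tau>] by simp
    next
      fix k a
      have "int p ^ k dvd int p ^ j * a \<longleftrightarrow> (\<exists>l\<le>k. int p ^ l dvd a \<and> k - l \<le> j)"
      proof
        assume *: "int p ^ k dvd int p ^ j * a"
        show "\<exists>l\<le>k. int p ^ l dvd a \<and> k - l \<le> j"
        proof (cases "k \<le> j")
          case True
          then show ?thesis by (intro exI[of _ 0]) simp
        next
          case False
          then have "int p ^ j * int p ^ (k - j) dvd int p ^ j * a"
            using * by (simp add: power_add[symmetric])
          then have "int p ^ (k - j) dvd a" using p by (simp add: prime_gt_0_nat)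
          then show ?thesis using False by (intro exI[of _ "k - j"]) simp
        qed
      next
        assume "\<exists>l\<le>k. int p ^ l dvd a \<and> k - l \<le> j"
        then obtain l where l: "l \<le> k" "int p ^ l dvd a" "k - l \<le> j" by blast
        have "int p ^ k dvd int p ^ (j + l)" using l by (intro le_imp_power_dvd) simp
        also have "\<dots> dvd int p ^ j * a" using l(2) by (simp add: power_add)
        finally show "int p ^ k dvd int p ^ j * a" .
      qed
      then show "pdvd p k (of_int (int p ^ j) * of_int a) \<longleftrightarrow> (\<exists>l\<le>k. int p ^ l dvd a \<and> k - l \<in> J)"
        using pd(5)[of k "int p ^ j * a"] by (simp add: Jiff)
    next
      fix x assume x: "solves p K x"
      have "\<exists>y. peq p (x $ i $ 1 + x $ i $ 2 * of_int \<tau>) (of_int (int p ^ j) * y)" for i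
      proof (rule pdvd_divide[OF p])
        show "pdvd p j (x $ i $ 1 + x $ i $ 2 * of_int \<tau>)"
          using x \<tau> unfolding solves_def by fastforce
      qed blast
      then obtain c2 where c2: "\<And>i. peq p (x $ i $ 1 + x $ i $ 2 * of_int \<tau>) (of_int (int p ^ j) * c2 i)"
        by metis
      \<comment> \<open>A vector \<open>(u, v)\<close> killed by \<open>c\<close> modulo \<open>p\<close> gives a vector \<open>(v, b)\<close> killed by \<open>x\<close> modulo
      \<open>p\<^sup>j\<^sup>+\<^sup>1\<close>. By the maximality of \<open>j\<close> the prime divides \<open>v\<close>, and comparison of \<open>b\<close> with
      \<open>v t\<close> shows that it divides \<open>u\<close>.\<close>
      have "\<not> pdvd p 1 (x $ 1 $ 2 * c2 2 - c2 1 * x $ 2 $ 2)"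
      proof
        assume det: "pdvd p 1 (x $ 1 $ 2 * c2 2 - c2 1 * x $ 2 $ 2)"
        define r where "r z = zhat_comp z p 1" for z
        have "r (x $ 1 $ 2 * c2 2 - c2 1 * x $ 2 $ 2) = 0" using det by (simp add: pdvd_def r_def)
        then have "(r (x $ 1 $ 2) * r (c2 2) - r (c2 1) * r (x $ 2 $ 2)) mod int p ^ 1 = 0"
          unfolding r_def using p by (simp add: zhat_comp_diff zhat_comp_simps mod_simps)
        then have "int p dvd r (x $ 1 $ 2) * r (c2 2) - r (c2 1) * r (x $ 2 $ 2)"
          by (simp add: dvd_eq_mod_eq_0)
        from mod_matrix_kernel[OF pp this] obtain u v where
          uv: "\<not> (int p dvd u \<and> int p dvd v)" "int p dvd r (x $ 1 $ 2) * u + r (c2 1) * v"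
          "int p dvd r (x $ 2 $ 2) * u + r (c2 2) * v" by blast
        have one: "pdvd p 1 (x $ i $ 2 * of_int u + c2 i * of_int v)" for i
        proof -
          have "int p dvd r (x $ i $ 2) * u + r (c2 i) * v" using uv(2,3) exhaust_2[of i] by auto
          then show ?thesis
            unfolding pdvd_def r_def using p
            by (simp add: zhat_comp_simps zhat_comp_of_int mod_simps dvd_eq_mod_eq_0)
        qed
        define b where "b = int p ^ j * u + v * \<tau>"
        have "pdvd p (j + 1) (x $ i $ 1 * of_int v + x $ i $ 2 * of_int b)" for i
        proof -
          have e: "x $ i $ 1 * of_int v + x $ i $ 2 * of_int b
            = (x $ i $ 1 + x $ i $ 2 * of_int \<tau>) * of_int v + of_int (int p ^ j) * (x $ i $ 2 *
                of_int u)"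
            by (simp add: b_def algebra_simps)
          have "peq p (x $ i $ 1 * of_int v + x $ i $ 2 * of_int b)
            ((of_int (int p ^ j) * c2 i) * of_int v + of_int (int p ^ j) * (x $ i $ 2 * of_int u))"
            unfolding e using c2 by (intro peq_add[OF p] peq_mult[OF p] peq_refl[OF p])
          also have "(of_int (int p ^ j) * c2 i) * of_int v + of_int (int p ^ j) * (x $ i $ 2 * of_int u)
            = of_int (int p ^ j) * (x $ i $ 2 * of_int u + c2 i * of_int v)" by (simp add: algebra_simps)
          finally show ?thesis using one[of i] peq_pdvd[OF p] pdvd_shift[OF p] by blast
        qed
        then have "K (j + 1) v b" using x unfolding solves_def by blast
        from kernel_slope[OF this] obtain l t where
          l: "l \<le> j + 1" "int p ^ l dvd v" "K (j + 1 - l) 1 t" "int p ^ (j + 1) dvd b - v * t" by blast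
        have l0: "l \<noteq> 0" using l(3) Jiff[of "j + 1"] by (cases l) (auto simp: J_def)
        then have pv: "int p dvd v" using l(2) by (metis dvd_power dvd_trans neq0_conv)
        have "int p ^ (j + 1 - l) dvd t - \<tau>"
          using kernel_slope_unique[OF l(3)] kernel_mono[OF \<tau>, of "j + 1 - l"] l0 by simp
        then have "int p ^ l * int p ^ (j + 1 - l) dvd v * (t - \<tau>)" using l(2)
            by (rule mult_dvd_mono[rotated])
        then have "int p ^ (j + 1) dvd v * (t - \<tau>)" using l(1) by (simp add: power_add[symmetric])
        with l(4) have "int p ^ (j + 1) dvd (b - v * t) + v * (t - \<tau>)" by (rule dvd_add)
        then have "int p ^ j * int p dvd int p ^ j * u" by (simp add: b_def algebra_simps)
        then have "int p dvd u" using p by (simp add: prime_gt_0_nat)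
        with pv uv(1) show False by blast
      qed
      with c2 show "\<exists>c2. (\<forall>i. peq p (x $ i $ 1 + x $ i $ 2 * of_int \<tau>) (of_int (int p ^ j) * c2 i)) \<and>
          \<not> pdvd p 1 (x $ 1 $ 2 * c2 2 - c2 1 * x $ 2 $ 2)" by blast
    qed
  qed
qed

lemma universal_solution_swap:
  assumes p: "prime p" and "universal_solution p (\<lambda>k a b. K k b a) N"
  shows "universal_solution p K (\<chi> i j. if j = 1 then N $ i $ 2 else N $ i $ 1)"
proof -
  define sw :: "zhat^2^2 \<Rightarrow> zhat^2^2" where "sw x = (\<chi> i j. if j = 1 then x $ i $ 2 else x $ i $ 1)" for x
  have s: "solves p K (sw x) \<longleftrightarrow> solves p (\<lambda>k a b. K k b a) x" for x
    unfolding solves_def sw_def by (auto simp: add.commute)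
  have "sw (sw x) = x" for x by (simp add: sw_def vec_eq_iff forall_2)
  moreover have "c ** sw x = sw (c ** x)" for c x
    by (simp add: sw_def vec_eq_iff forall_2 matrix_matrix_mult_def)
  moreover have "(\<forall>i j. peq p (sw x $ i $ j) (sw y $ i $ j)) \<longleftrightarrow> (\<forall>i j.
      peq p (x $ i $ j) (y $ i $ j))" for x y
    by (auto simp: forall_2 sw_def)
  ultimately have "universal_solution p K (sw N)"
    using assms(2) s unfolding universal_solution_def by metis
  then show ?thesis by (simp add: sw_def)
qed

lemma universal_solution_shift:
  assumes p: "prime p" and kf: "kernel_family p K" and all: "\<And>a b. K 1 a b"
    and N: "universal_solution p (\<lambda>k. K (Suc k)) N"
  shows "universal_solution p K (mat (of_int (int p)) ** N)"
proof -
  have sh: "pdvd p (Suc k) (of_int (int p) * z) \<longleftrightarrow> pdvd p k z" for k z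
    using pdvd_shift[OF p, of 1 k z] by simp
  have ent: "(mat (of_int (int p)) ** x) $ i $ j = of_int (int p) * x $ i $ j" for x :: "zhat^2^2"
      and i j
    using exhaust_2[of i] by (auto simp: matrix_matrix_mult_def sum_2 mat_def)
  have iff: "solves p K x \<longleftrightarrow> solves p (\<lambda>k. K (Suc k)) y"
    if xy: "\<And>i j. peq p (x $ i $ j) (of_int (int p) * y $ i $ j)" for x y
  proof -
    have e: "pdvd p (Suc k) (x $ i $ 1 * of_int a + x $ i $ 2 * of_int b) \<longleftrightarrow>
      pdvd p k (y $ i $ 1 * of_int a + y $ i $ 2 * of_int b)" for k i a b
    proof -
      have "peq p (x $ i $ 1 * of_int a + x $ i $ 2 * of_int b)
        ((of_int (int p) * y $ i $ 1) * of_int a + (of_int (int p) * y $ i $ 2) * of_int b)"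
        using xy by (intro peq_add[OF p] peq_mult[OF p] peq_refl[OF p])
      also have "(of_int (int p) * y $ i $ 1) * of_int a + (of_int (int p) * y $ i $ 2) * of_int b
        = of_int (int p) * (y $ i $ 1 * of_int a + y $ i $ 2 * of_int b)"
        by (simp add: algebra_simps)
      finally show ?thesis by (simp only: peq_pdvd[OF p] sh)
    qed
    have z: "K 0 a b" "pdvd p 0 w" for a b w
      using kernel_base[OF p kf] pdvd_iff_dvd_comp[OF p, of 0 w 0] by auto
    show ?thesis unfolding solves_def
    proof (rule iffI; intro allI)
      fix k a b
      assume "\<forall>k a b. K k a b \<longleftrightarrow> (\<forall>i. pdvd p k (x $ i $ 1 * of_int a + x $ i $ 2 * of_int b))"
      then show "K (Suc k) a b \<longleftrightarrow> (\<forall>i. pdvd p k (y $ i $ 1 * of_int a + y $ i $ 2 * of_int b))"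
        by (simp only: e)
    next
      fix k a b
      assume *: "\<forall>k a b. K (Suc k) a b \<longleftrightarrow> (\<forall>i. pdvd p k (y $ i $ 1 * of_int a + y $ i $ 2 * of_int b))"
      show "K k a b \<longleftrightarrow> (\<forall>i. pdvd p k (x $ i $ 1 * of_int a + x $ i $ 2 * of_int b))"
      proof (cases k)
        case 0
        then show ?thesis using z by simp
      next
        case (Suc l)
        then show ?thesis using * by (simp only: e)
      qed
    qed
  qed
  show ?thesis unfolding universal_solution_def
  proof (intro conjI allI impI)
    have "solves p (\<lambda>k. K (Suc k)) N" using N by (simp add: universal_solution_def)
    then show "solves p K (mat (of_int (int p)) ** N)"
      by (subst iff[where y = N]) (simp_all only: ent peq_refl[OF p])
  next
    fix x assume x: "solves p K x"
    have ex: "\<exists>y. peq p (x $ i $ j) (of_int (int p) * y)" for i j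
    proof -
      have "pdvd p 1 (x $ i $ 1 * of_int 1 + x $ i $ 2 * of_int 0)"
        "pdvd p 1 (x $ i $ 1 * of_int 0 + x $ i $ 2 * of_int 1)"
        using x all unfolding solves_def by blast+
      then have "pdvd p 1 (x $ i $ j)" using exhaust_2[of j] by auto
      then show ?thesis using pdvd_divide[OF p, of 1 "x $ i $ j"] by (metis power_one_right)
    qed
    define y :: "zhat^2^2" where "y = (\<chi> i j. SOME y. peq p (x $ i $ j) (of_int (int p) * y))"
    have y: "peq p (x $ i $ j) (of_int (int p) * y $ i $ j)" for i j
      using someI_ex[OF ex[of i j]] by (simp add: y_def)
    then have "solves p (\<lambda>k. K (Suc k)) y" using iff[of x y] x by blast
    then obtain c where c: "\<And>i j. peq p (y $ i $ j) ((c ** N) $ i $ j)" "\<not> pdvd p 1 (det c)"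
      using N unfolding universal_solution_def by blast
    have "peq p (x $ i $ j) ((c ** (mat (of_int (int p)) ** N)) $ i $ j)" for i j
    proof -
      have "c ** (mat (of_int (int p)) ** N) = mat (of_int (int p)) ** (c ** N)"
        by (simp only: matrix_mul_assoc mat_mult_commute[of c])
      moreover have "peq p (of_int (int p) * y $ i $ j) (of_int (int p) * (c ** N) $ i $ j)"
        using c(1) by (intro peq_mult[OF p] peq_refl[OF p])
      ultimately show ?thesis using peq_trans[OF p y[of i j]] by (simp only: ent)
    qed
    then show "\<exists>c. (\<forall>i j. peq p (x $ i $ j) ((c ** (mat (of_int (int p)) ** N)) $ i $ j)) \<and>
        \<not> pdvd p 1 (det c)"
      using c(2) by blast
  qed
qed

text \<open>As long as \<open>p\<^sup>-\<^sup>1 \<int>\<^sup>2\<close> lies in the group, a scalar factor \<open>p\<close> is split off from the matrix. Afterwards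
  one of the unit vectors is missing from \<open>K 1\<close>. If the process does not end, the matrix is zero.\<close>

lemma universal_solution_exists:
  assumes p: "prime p" and kf: "kernel_family p K"
  shows "\<exists>N. universal_solution p K N"
proof (cases "\<forall>k a b. K k a b")
  case True
  have "solves p K 0" using True pdvd_zero[OF p] by (simp add: solves_def)
  moreover have "\<exists>c. (\<forall>i j. peq p (x $ i $ j) ((c ** 0) $ i $ j)) \<and> \<not> pdvd p 1 (det c)"
    if x: "solves p K x" for x
  proof (intro exI[of _ "mat 1"] conjI allI)
    fix i j
    have "pdvd p k (x $ i $ 1 * of_int 1 + x $ i $ 2 * of_int 0)"
      "pdvd p k (x $ i $ 1 * of_int 0 + x $ i $ 2 * of_int 1)" for k
      using x True unfolding solves_def by blast+
    then have "pdvd p k (x $ i $ j)" for k using exhaust_2[of j] by auto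
    then show "peq p (x $ i $ j) ((mat 1 ** 0) $ i $ j)" by (simp add: peq_iff_pdvd[OF p])
    have "\<not> pdvd p 1 (of_int 1)" using p by (simp only: pdvd_of_int[OF p]) (simp add: prime_nat_iff)
    then show "\<not> pdvd p 1 (det (mat 1 :: zhat^2^2))" by simp
  qed
  ultimately show ?thesis unfolding universal_solution_def by blast
next
  case False
  then obtain n a b where "\<not> K n a b" by blast
  then show ?thesis using kf
  proof (induction n arbitrary: K a b)
    case 0
    then show ?case using kernel_base[OF p] by blast
  next
    case (Suc n)
    show ?case
    proof (cases "\<forall>a b. K 1 a b")
      case True
      have "kernel_family p (\<lambda>k. K (Suc k))"
        using Suc.prems(2) True unfolding kernel_family_def by (simp add: One_nat_def)
      with Suc.IH[of "\<lambda>k. K (Suc k)" a b] Suc.prems(1)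
      obtain N where "universal_solution p (\<lambda>k. K (Suc k)) N" by blast
      then show ?thesis using universal_solution_shift[OF p Suc.prems(2)] True by blast
    next
      case False
      then obtain a b where ab: "\<not> K 1 a b" by blast
      have "\<not> K 1 0 1 \<or> \<not> K 1 1 0"
      proof (rule ccontr)
        assume "\<not> (\<not> K 1 0 1 \<or> \<not> K 1 1 0)"
        then have "K 1 (a * 1 + b * 0) (a * 0 + b * 1)"
          by (intro kernel_add[OF p Suc.prems(2)] kernel_mult[OF p Suc.prems(2)]) auto
        with ab show False by simp
      qed
      moreover have "kernel_family p (\<lambda>k a b. K k b a)"
        using Suc.prems(2) unfolding kernel_family_def by blast
      ultimately show ?thesis
        using universal_solution_primitive[OF p Suc.prems(2)]
          universal_solution_primitive[OF p, of "\<lambda>k a b. K k b a"] universal_solution_swap[OF p] by blast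
    qed
  qed
qed

section \<open>Groups of adelic matrices\<close>

abbreviation adm :: "zhat^2^2 \<Rightarrow> adele^2^2" where
  "adm \<equiv> map_matrix zhat_to_adele"

abbreviation qadm :: "rat^2^2 \<Rightarrow> adele^2^2" where
  "qadm \<equiv> map_matrix rat_to_adele"

abbreviation qadv :: "rat^2 \<Rightarrow> adele^2" where
  "qadv v \<equiv> (\<chi> i. rat_to_adele (v $ i))"

lemma zhat_to_adele_add: "zhat_to_adele (a + b) = zhat_to_adele a + zhat_to_adele b"
  by transfer (simp add: adele_rel_def)

lemma zhat_to_adele_mult: "zhat_to_adele (a * b) = zhat_to_adele a * zhat_to_adele b"
  by transfer (simp add: adele_rel_def)

lemma zhat_to_adele_0: "zhat_to_adele 0 = 0"
  by transfer (simp add: adele_rel_def)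

lemma zhat_to_adele_1: "zhat_to_adele 1 = 1"
  by transfer (simp add: adele_rel_def)

lemma zhat_to_adele_minus: "zhat_to_adele (- a) = - zhat_to_adele a"
  by transfer (simp add: adele_rel_def)

lemma zhat_to_adele_diff: "zhat_to_adele (a - b) = zhat_to_adele a - zhat_to_adele b"
  using zhat_to_adele_add[of a "- b"] by (simp add: zhat_to_adele_minus)

lemma zhat_to_adele_eq_iff: "zhat_to_adele a = zhat_to_adele b \<longleftrightarrow> a = b"
  by transfer (simp add: adele_rel_def)

lemma zhat_to_adele_of_int: "zhat_to_adele (of_int n) = of_int n"
proof -
  have "zhat_to_adele (of_nat m) = of_nat m" for m
    by (induction m) (simp_all add: zhat_to_adele_0 zhat_to_adele_1 zhat_to_adele_add)
  then show ?thesis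
    by (cases n rule: int_cases2) (simp_all add: zhat_to_adele_minus)
qed

lemma adele_torsion_free:
  assumes "n \<noteq> 0" "of_int n * x = of_int n * (y :: adele)"
  shows "x = y"
proof -
  have "zhat_to_adele (of_int n) * z = 0 \<Longrightarrow> z = 0" for z
    using assms(1)
  proof (transfer fixing: n)
    fix z assume "adele_rel z z" "n \<noteq> 0"
      "adele_rel (fst (of_int n, 1) * fst z, snd (of_int n, 1) * snd z) (0, 1)"
    then show "adele_rel z (0, 1)"
      using zhat_torsion_free[of n "fst z"] by (simp add: adele_rel_def)
  qed
  from this[of "x - y"] show ?thesis
    using assms(2) by (simp add: zhat_to_adele_of_int algebra_simps)
qed

lemma adele_clear_denominator:
  obtains n z where "n \<noteq> 0" "of_int n * x = zhat_to_adele z"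
proof -
  have "\<exists>n z. n \<noteq> 0 \<and> zhat_to_adele (of_int n) * x = zhat_to_adele z"
  proof transfer
    fix x :: "zhat \<times> int" assume "adele_rel x x"
    then show "\<exists>n z. n \<noteq> 0 \<and> adele_rel (fst (of_int n, 1) * fst x, snd (of_int n, 1) * snd x) (z, 1)"
      by (intro exI[of _ "snd x"] exI[of _ "fst x"]) (simp add: adele_rel_def)
  qed
  then show ?thesis using that by (auto simp: zhat_to_adele_of_int)
qed

text \<open>The embedding of the rationals is defined by reduced fractions; this lemma allows any fraction.\<close>

lemma rat_to_adele_unique:
  assumes "n \<noteq> 0" "of_int n * q = of_int m"
  shows "of_int n * rat_to_adele q = of_int m"
proof -
  obtain a b where ab: "quotient_of q = (a, b)" by fastforce
  then have b: "b > 0" "q = of_int a / of_int b"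
    by (simp_all add: quotient_of_denom_pos quotient_of_div)
  have "zhat_to_adele (of_int b) * rat_to_adele q = zhat_to_adele (of_int a)"
    using b(1) by (transfer fixing: a b q) (simp add: ab adele_rel_def)
  then have *: "of_int b * rat_to_adele q = of_int a" by (simp add: zhat_to_adele_of_int)
  have "of_int n * of_int a = (of_int m * of_int b :: rat)" using assms(2) b by (simp add: field_simps)
  then have nm: "n * a = m * b" by (simp only: of_int_mult[symmetric] of_int_eq_iff)
  have "of_int b * (of_int n * rat_to_adele q) = of_int n * (of_int b * rat_to_adele q)"
    by (simp only: mult_ac)
  also have "\<dots> = of_int (n * a)" by (simp add: *)
  also have "\<dots> = of_int b * of_int m" by (simp add: nm)
  finally show ?thesis using adele_torsion_free[of b] b(1) by simp
qed

lemma rat_as_fraction: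
  obtains n m where "n \<noteq> 0" "of_int n * q = (of_int m :: rat)"
  using common_denominator_rat[of "{()}" "\<lambda>_. q"] by auto

lemma rat_to_adele_of_int: "rat_to_adele (of_int n) = of_int n"
  using rat_to_adele_unique[of 1 "of_int n" n] by simp

lemma rat_to_adele_add: "rat_to_adele (a + b) = rat_to_adele a + rat_to_adele b"
proof -
  obtain n m where n: "n \<noteq> 0" "of_int n * a = of_int m" by (rule rat_as_fraction)
  obtain n' m' where n': "n' \<noteq> 0" "of_int n' * b = of_int m'" by (rule rat_as_fraction)
  have "of_int (n * n') * (a + b) = of_int n' * (of_int n * a) + of_int n * (of_int n' * b)"
    by (simp add: algebra_simps)
  also have "\<dots> = of_int (n' * m + n * m')" by (simp add: n n')
  finally have "of_int (n * n') * rat_to_adele (a + b) = of_int (n' * m + n * m')"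
    using n n' by (intro rat_to_adele_unique) auto
  also have "\<dots> = of_int n' * (of_int n * rat_to_adele a) + of_int n * (of_int n' * rat_to_adele b)"
    by (simp add: rat_to_adele_unique n n')
  also have "\<dots> = of_int (n * n') * (rat_to_adele a + rat_to_adele b)" by (simp add: algebra_simps)
  finally show ?thesis using n n' adele_torsion_free[of "n * n'"] by simp
qed

lemma rat_to_adele_mult: "rat_to_adele (a * b) = rat_to_adele a * rat_to_adele b"
proof -
  obtain n m where n: "n \<noteq> 0" "of_int n * a = of_int m" by (rule rat_as_fraction)
  obtain n' m' where n': "n' \<noteq> 0" "of_int n' * b = of_int m'" by (rule rat_as_fraction)
  have "of_int (n * n') * (a * b) = (of_int n * a) * (of_int n' * b)"
    by (simp add: algebra_simps)
  also have "\<dots> = of_int (m * m')" by (simp add: n n')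
  finally have "of_int (n * n') * rat_to_adele (a * b) = of_int (m * m')"
    using n n' by (intro rat_to_adele_unique) auto
  also have "\<dots> = (of_int n * rat_to_adele a) * (of_int n' * rat_to_adele b)"
    by (simp add: rat_to_adele_unique n n')
  also have "\<dots> = of_int (n * n') * (rat_to_adele a * rat_to_adele b)" by (simp add: algebra_simps)
  finally show ?thesis using n n' adele_torsion_free[of "n * n'"] by simp
qed

lemma rat_to_adele_diff: "rat_to_adele (a - b) = rat_to_adele a - rat_to_adele b"
  using rat_to_adele_add[of "a - b" b] by (simp add: algebra_simps)

lemma adm_mult: "adm (a ** b) = adm a ** adm b"
  by (rule map_matrix_mult) (simp_all add: zhat_to_adele_add zhat_to_adele_mult)

lemma qadm_mult: "qadm (a ** b) = qadm a ** qadm b"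
  by (rule map_matrix_mult) (simp_all add: rat_to_adele_add rat_to_adele_mult)

lemma qadm_ratm: "qadm (ratm k) = adm (map_matrix of_int k)"
  by (simp add: vec_eq_iff rat_to_adele_of_int zhat_to_adele_of_int)

lemma adm_eq_iff: "adm a = adm b \<longleftrightarrow> a = b"
  by (simp add: vec_eq_iff zhat_to_adele_eq_iff)

lemma adm_one: "adm (mat 1) = mat 1"
  by (simp add: vec_eq_iff mat_def zhat_to_adele_0 zhat_to_adele_1)

lemma qadm_one: "qadm (mat 1) = mat 1"
  using rat_to_adele_of_int[of 0] rat_to_adele_of_int[of 1] by (simp add: vec_eq_iff mat_def)

text \<open>The vectors on which all rows of \<open>Y\<close> are integral. It turns out to be the group attached to the
  orbit of \<open>Y\<close> when \<open>Y\<close> is integral, and its dependence on \<open>Y\<close> is transparent: units on the left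
  leave it unchanged and rational matrices on the right translate it.\<close>

definition group_at :: "adele^2^2 \<Rightarrow> (rat^2) set" where
  "group_at Y = {v. \<forall>i. (Y *v qadv v) $ i \<in> range zhat_to_adele}"

lemma group_at_right: "v \<in> group_at (Y ** qadm g) \<longleftrightarrow> g *v v \<in> group_at Y"
proof -
  have "qadm g *v qadv v = qadv (g *v v)"
    by (simp add: vec_eq_iff matrix_vector_mult_def sum_2 rat_to_adele_add rat_to_adele_mult)
  then show ?thesis by (simp add: group_at_def matrix_vector_mul_assoc[symmetric])
qed

lemma group_at_left:
  assumes "invertible u" shows "group_at (adm u ** Y) = group_at Y"
proof -
  have sub: "group_at Y \<subseteq> group_at (adm w ** Y)" for w Y
  proof
    fix v assume "v \<in> group_at Y"
    then have "\<forall>i. \<exists>z. (Y *v qadv v) $ i = zhat_to_adele z" by (auto simp: group_at_def)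
    then obtain z where "\<And>i. (Y *v qadv v) $ i = zhat_to_adele (z i)" by metis
    then have "(adm w *v (Y *v qadv v)) $ i = zhat_to_adele (w $ i $ 1 * z 1 + w $ i $ 2 * z 2)" for i
      by (simp add: matrix_vector_mult_def[of "adm w"] sum_2 zhat_to_adele_add zhat_to_adele_mult)
    then show "v \<in> group_at (adm w ** Y)"
      unfolding group_at_def by (simp add: matrix_vector_mul_assoc)
  qed
  obtain d where "d ** u = mat 1" using assms invertibleE by blast
  then have "adm d ** (adm u ** Y) = Y"
    by (simp add: matrix_mul_assoc adm_mult[symmetric] adm_one)
  with sub[of Y u] sub[of "adm u ** Y" d] show ?thesis by auto
qed

lemma group_at_iff:
  assumes "n > 0" "of_int n *s v = ratv w"
  shows "v \<in> group_at (adm y) \<longleftrightarrow>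
    (\<forall>i. of_int n dvd y $ i $ 1 * of_int (w $ 1) + y $ i $ 2 * of_int (w $ 2))"
proof -
  have "of_int n * v $ j = of_int (w $ j)" for j
    using arg_cong[OF assms(2), of "\<lambda>v. v $ j"] by simp
  then have v: "of_int n * rat_to_adele (v $ j) = of_int (w $ j)" for j
    using assms(1) by (intro rat_to_adele_unique) auto
  have "(adm y *v qadv v) $ i \<in> range zhat_to_adele \<longleftrightarrow>
      of_int n dvd y $ i $ 1 * of_int (w $ 1) + y $ i $ 2 * of_int (w $ 2)" for i
  proof -
    define Y where "Y = (adm y *v qadv v) $ i"
    define z where "z = y $ i $ 1 * of_int (w $ 1) + y $ i $ 2 * of_int (w $ 2)"
    have "of_int n * Y = zhat_to_adele (y $ i $ 1) * (of_int n * rat_to_adele (v $ 1))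
        + zhat_to_adele (y $ i $ 2) * (of_int n * rat_to_adele (v $ 2))"
      by (simp add: Y_def matrix_vector_mult_def sum_2 algebra_simps)
    also have "\<dots> = zhat_to_adele z"
      by (simp only: v) (simp add: z_def zhat_to_adele_add zhat_to_adele_mult zhat_to_adele_of_int)
    finally have nY: "of_int n * Y = zhat_to_adele z" .
    have "Y = zhat_to_adele x \<longleftrightarrow> z = of_int n * x" for x
    proof -
      have "Y = zhat_to_adele x \<longleftrightarrow> of_int n * Y = of_int n * zhat_to_adele x"
        using adele_torsion_free[of n] assms(1) by auto
      also have "\<dots> \<longleftrightarrow> zhat_to_adele z = zhat_to_adele (of_int n * x)"
        by (simp add: nY zhat_to_adele_mult zhat_to_adele_of_int)
      finally show ?thesis by (simp only: zhat_to_adele_eq_iff)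
    qed
    then show ?thesis unfolding Y_def[symmetric] z_def[symmetric] dvd_def by blast
  qed
  then show ?thesis by (simp add: group_at_def)
qed

lemma group_at_intermediate: "group_at (adm y) \<in> intermediate_groups"
  unfolding intermediate_groups_iff
proof (intro conjI ballI subsetI)
  fix v assume "v \<in> Z2"
  then obtain w where "v = ratv w" by (rule Z2_ratvE)
  then show "v \<in> group_at (adm y)" by (subst group_at_iff[of 1 _ w]) auto
next
  fix u v assume "u \<in> group_at (adm y)" "v \<in> group_at (adm y)"
  moreover have "adm y *v qadv (u - v) = adm y *v qadv u - adm y *v qadv v"
    by (simp add: vec_eq_iff matrix_vector_mult_def sum_2 rat_to_adele_diff algebra_simps)
  moreover have "a - b \<in> range zhat_to_adele" if "a \<in> range zhat_to_adele" "b \<in> range zhat_to_adele"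
      for a b
    using that by (auto simp: zhat_to_adele_diff[symmetric])
  ultimately show "u - v \<in> group_at (adm y)" by (simp add: group_at_def)
qed

text \<open>The \<open>p\<close>-primary part of \<open>A\<close> modulo \<open>\<int>\<^sup>2\<close>, given by the numerators of the fractions in \<open>A\<close> with
  denominator \<open>p\<^sup>k\<close>.\<close>

definition local_kernel :: "(rat^2) set \<Rightarrow> nat \<Rightarrow> nat \<Rightarrow> int \<Rightarrow> int \<Rightarrow> bool" where
  "local_kernel A p k a b \<longleftrightarrow> (\<chi> i. of_int (if i = 1 then a else b) / of_int (int p ^ k)) \<in> A"

lemma kernel_family_local_kernel:
  assumes p: "prime p" and A: "A \<in> intermediate_groups"
  shows "kernel_family p (local_kernel A p)"
  unfolding kernel_family_def
proof (intro conjI allI impI)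
  fix a b
  have "ratv (\<chi> i. if i = 1 then a else b) \<in> A"
    using A ratv_Z2 unfolding intermediate_groups_iff by blast
  moreover have "ratv (\<chi> i. if i = 1 then a else b)
      = (\<chi> i. of_int (if i = 1 then a else b) / of_int (int p ^ 0))"
    by (simp add: vec_eq_iff)
  ultimately show "local_kernel A p 0 a b" by (simp only: local_kernel_def)
next
  fix k a b a' b' assume "local_kernel A p k a b" "local_kernel A p k a' b'"
  then have "(\<chi> i. of_int (if i = 1 then a else b) / of_int (int p ^ k))
     - (\<chi> i. of_int (if i = 1 then a' else b') / of_int (int p ^ k)) \<in> A"
    unfolding local_kernel_def by (rule intermediate_diff[OF A])
  also have "(\<chi> i. of_int (if i = 1 then a else b) / of_int (int p ^ k))
     - (\<chi> i. of_int (if i = 1 then a' else b') / of_int (int p ^ k))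
     = (\<chi> i. of_int (if i = 1 then a - a' else b - b') / (of_int (int p ^ k) :: rat))"
    by (simp add: vec_eq_iff diff_divide_distrib)
  finally show "local_kernel A p k (a - a') (b - b')" by (simp add: local_kernel_def)
next
  fix k a b
  have "(\<chi> i :: 2. of_int (if i = 1 then int p * a else int p * b) / of_int (int p ^ Suc k))
    = (\<chi> i. of_int (if i = 1 then a else b) / (of_int (int p ^ k) :: rat))"
    using p by (simp add: vec_eq_iff prime_gt_0_nat)
  then show "local_kernel A p (Suc k) (int p * a) (int p * b) \<longleftrightarrow> local_kernel A p k a b"
    by (simp only: local_kernel_def)
qed

text \<open>Partial fractions: the integers \<open>m\<close> with \<open>m v \<in> A\<close> form an ideal, which contains the
  \<open>p\<close>-free part of a denominator of \<open>v\<close> as soon as \<open>A\<close> contains the \<open>p\<close>-part of \<open>v\<close>.\<close>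

lemma mem_iff_local_kernel:
  assumes A: "A \<in> intermediate_groups" and n: "n > 0" "of_int n *s v = ratv w"
  shows "v \<in> A \<longleftrightarrow> (\<forall>p. prime p \<longrightarrow> local_kernel A p (multiplicity (int p) n) (w $ 1) (w $ 2))"
proof -
  have loc: "local_kernel A p (multiplicity (int p) n) (w $ 1) (w $ 2) \<longleftrightarrow> of_int m *s v \<in> A"
    if p: "prime p" and m: "n = int p ^ multiplicity (int p) n * m" for p m
  proof -
    have "of_int (w $ i) / of_int (int p ^ multiplicity (int p) n) = of_int m * v $ i" for i
    proof -
      have "of_int (w $ i) = of_int n * v $ i" using arg_cong[OF n(2), of "\<lambda>v. v $ i"] by simp
      also have "\<dots> = of_int (int p ^ multiplicity (int p) n) * (of_int m * v $ i)"
        by (subst m) (simp add: mult.assoc)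
      finally show ?thesis using p by (simp add: prime_gt_0_nat)
    qed
    then have "(\<chi> i. of_int (if i = 1 then w $ 1 else w $ 2) / of_int (int p ^ multiplicity (int p) n))
        = of_int m *s v"
      by (simp add: vec_eq_iff forall_2)
    then show ?thesis by (simp only: local_kernel_def)
  qed
  have dec: "\<exists>m. n = int p ^ multiplicity (int p) n * m \<and> \<not> int p dvd m" if "prime p" for p
    using multiplicity_decompose'[of n "int p"] n(1) that
    by (metis not_prime_unit order_less_irrefl prime_nat_int_transfer)
  show ?thesis
  proof
    assume "v \<in> A"
    then show "\<forall>p. prime p \<longrightarrow> local_kernel A p (multiplicity (int p) n) (w $ 1) (w $ 2)"
      using dec loc intermediate_scale[OF A] by metis
  next
    assume *: "\<forall>p. prime p \<longrightarrow> local_kernel A p (multiplicity (int p) n) (w $ 1) (w $ 2)"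
    define H where "H = {m. of_int m *s v \<in> A}"
    have "0 \<in> H" using intermediate_zero[OF A] by (simp add: H_def)
    moreover have "a - b \<in> H" if "a \<in> H" "b \<in> H" for a b
      using intermediate_diff[OF A, of "of_int a *s v" "of_int b *s v"] that
      by (simp add: H_def vector_sub_rdistrib)
    ultimately obtain d where d: "d \<in> H" "\<And>a. a \<in> H \<Longrightarrow> d dvd a"
      using int_subgroup_principal[of H] by blast
    have "ratv w \<in> A" using A ratv_Z2 unfolding intermediate_groups_iff by blast
    then have dn: "d dvd n" using d(2) n(2) by (simp add: H_def)
    have d0: "d \<noteq> 0" using dn n(1) by auto
    have "is_unit d"
    proof (rule ccontr)
      assume "\<not> is_unit d"
      then obtain q where q: "prime q" "q dvd d"
        using prime_divisor_exists[OF d0] by blast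
      define p where "p = nat q"
      have "q \<ge> 0" using q(1) by (rule prime_ge_0_int)
      then have p: "q = int p" "prime p" using q(1) by (simp_all add: p_def)
      obtain m where m: "n = int p ^ multiplicity (int p) n * m" "\<not> int p dvd m" using dec p(2) by blast
      then have "m \<in> H" using loc[OF p(2) m(1)] * p(2) by (simp add: H_def)
      then have "int p dvd m" using d(2) q(2) p(1) dvd_trans by blast
      with m(2) show False by blast
    qed
    then have "d dvd 1" by simp
    then obtain e where "d * e = 1" by (metis dvd_def)
    then have "of_int e *s (of_int d *s v) = v"
      by (simp add: vector_smult_assoc of_int_mult[symmetric] mult.commute del: of_int_mult)
    then show "v \<in> A" using intermediate_scale[OF A, of "of_int d *s v" e] d(1) by (simp add: H_def)
  qed
qed

lemma group_at_eq_iff: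
  assumes A: "A \<in> intermediate_groups"
  shows "group_at (adm y) = A \<longleftrightarrow> (\<forall>p. prime p \<longrightarrow> solves p (local_kernel A p) y)"
proof
  assume eq: "group_at (adm y) = A"
  show "\<forall>p. prime p \<longrightarrow> solves p (local_kernel A p) y"
    unfolding solves_def
  proof (intro allI impI)
    fix p k a b assume p: "prime (p :: nat)"
    define w :: "int^2" where "w = (\<chi> i. if i = 1 then a else b)"
    define v :: "rat^2" where "v = (\<chi> i. of_int (if i = 1 then a else b) / of_int (int p ^ k))"
    have pk: "int p ^ k > 0" using p by (simp add: prime_gt_0_nat)
    have "of_int (int p ^ k) *s v = ratv w" using p by (simp add: v_def w_def vec_eq_iff prime_gt_0_nat)
    note iff = group_at_iff[OF pk this, of y]
    have m: "multiplicity (int q) (int p ^ k) = (if q = p then k else 0)" if "prime q" for q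
      using p that prime_multiplicity_other[of "int q" "int p"]
      by (auto simp: prime_elem_multiplicity_power_distrib prime_multiplicity_other)
    have z: "pdvd q 0 x" if "prime q" for q x using pdvd_iff_dvd_comp[OF that, of 0 x 0] by simp
    have "local_kernel A p k a b \<longleftrightarrow> v \<in> group_at (adm y)"
      by (simp add: eq local_kernel_def v_def)
    also have "\<dots> \<longleftrightarrow> (\<forall>i. pdvd p k (y $ i $ 1 * of_int a + y $ i $ 2 * of_int b))"
      unfolding iff zhat_of_int_dvd_iff[OF pk] using m z p by (auto simp: w_def)
    finally show "local_kernel A p k a b \<longleftrightarrow> (\<forall>i. pdvd p k (y $ i $ 1 * of_int a + y $ i $ 2 * of_int
        b))" .
  qed
next
  assume s: "\<forall>p. prime p \<longrightarrow> solves p (local_kernel A p) y"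
  have "v \<in> group_at (adm y) \<longleftrightarrow> v \<in> A" for v
  proof -
    obtain n w where n: "n > 0" "of_int n *s v = ratv w" by (rule common_denominator_vec)
    show ?thesis
      unfolding group_at_iff[OF n] mem_iff_local_kernel[OF A n] zhat_of_int_dvd_iff[OF n(1)]
      using s unfolding solves_def by blast
  qed
  then show "group_at (adm y) = A" by blast
qed

text \<open>The classification of the groups \<open>A\<close> by profinite matrices modulo units on the left, obtained by
  gluing the solutions at all primes.\<close>

lemma universal_matrix:
  assumes A: "A \<in> intermediate_groups"
  obtains N where "group_at (adm N) = A"
    "\<And>y. group_at (adm y) = A \<Longrightarrow> \<exists>c. invertible c \<and> y = c ** N"
proof -
  have "\<exists>N. universal_solution p (local_kernel A p) N" if "prime p" for p
    using universal_solution_exists[OF that] kernel_family_local_kernel[OF that A] by blast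
  then obtain L where L: "\<And>p. prime p \<Longrightarrow> universal_solution p (local_kernel A p) (L p)" by metis
  have glue: "\<exists>M. \<forall>p i j. prime p \<longrightarrow> peq p (M $ i $ j) (F p $ i $ j)" for F :: "nat \<Rightarrow> zhat^2^2"
  proof -
    have "\<exists>z. \<forall>p. prime p \<longrightarrow> zhat_comp z p = zhat_comp (F p $ i $ j) p" for i j
      using zhat_choose[of "\<lambda>p. F p $ i $ j"] by blast
    then obtain z where "\<And>i j p. prime p \<Longrightarrow> zhat_comp (z i j) p = zhat_comp (F p $ i $ j) p" by metis
    then show ?thesis by (intro exI[of _ "\<chi> i j. z i j"]) (simp add: peq_def)
  qed
  obtain N where N: "\<And>p i j. prime p \<Longrightarrow> peq p (N $ i $ j) (L p $ i $ j)" using glue by blast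
  have "solves p (local_kernel A p) N" if p: "prime p" for p
  proof -
    have "peq p (N $ i $ 1 * of_int a + N $ i $ 2 * of_int b)
        (L p $ i $ 1 * of_int a + L p $ i $ 2 * of_int b)" for i a b
      using N[OF p] by (intro peq_add[OF p] peq_mult[OF p] peq_refl[OF p])
    note peq_pdvd[OF p this]
    then show ?thesis using L[OF p] unfolding universal_solution_def solves_def by simp
  qed
  then have "group_at (adm N) = A" using group_at_eq_iff[OF A] by blast
  moreover have "\<exists>c. invertible c \<and> y = c ** N" if y: "group_at (adm y) = A" for y
  proof -
    have "\<exists>c. (\<forall>i j. peq p (y $ i $ j) ((c ** L p) $ i $ j)) \<and> \<not> pdvd p 1 (det c)" if p: "prime p" for p
      using L[OF p] y group_at_eq_iff[OF A] p unfolding universal_solution_def by blast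
    then obtain C where C: "\<And>p i j. prime p \<Longrightarrow> peq p (y $ i $ j) ((C p ** L p) $ i $ j)"
      "\<And>p. prime p \<Longrightarrow> \<not> pdvd p 1 (det (C p))" by metis
    obtain c where c: "\<And>p i j. prime p \<Longrightarrow> peq p (c $ i $ j) (C p $ i $ j)" using glue by blast
    have "peq p (det c) (det (C p))" if p: "prime p" for p
      unfolding det_2 using c[OF p] by (intro peq_diff[OF p] peq_mult[OF p])
    then have "invertible c"
      using C(2) peq_pdvd by (intro invertible_zhat_matrix) blast
    moreover have "y $ i $ j = (c ** N) $ i $ j" for i j
    proof (rule zhat_eqI)
      fix p k assume p: "prime (p :: nat)"
      have "peq p ((C p ** L p) $ i $ j) ((c ** N) $ i $ j)"
        unfolding matrix_matrix_mult_def sum_2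
        using N[OF p, THEN peq_sym[OF p]] c[OF p, THEN peq_sym[OF p]]
        by (simp add: peq_add[OF p] peq_mult[OF p])
      then have "peq p (y $ i $ j) ((c ** N) $ i $ j)" using C(1)[OF p] peq_trans[OF p] by blast
      then show "zhat_comp (y $ i $ j) p k = zhat_comp ((c ** N) $ i $ j) p k" by (simp add: peq_def)
    qed
    ultimately show ?thesis by (auto simp: vec_eq_iff)
  qed
  ultimately show ?thesis using that by blast
qed

lemma group_at_determines_orbit:
  assumes "group_at (adm y) = group_at (adm z)"
  obtains u where "invertible u" "y = u ** z"
proof -
  obtain N :: "zhat^2^2" where N: "\<And>y'. group_at (adm y') = group_at (adm z) \<Longrightarrow> \<exists>c. invertible c \<and>
      y' = c ** N"
    using universal_matrix[OF group_at_intermediate[of z]] by blast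
  obtain c where c: "invertible c" "y = c ** N" using N assms by blast
  obtain d where d: "invertible d" "z = d ** N" using N by blast
  obtain e where e: "invertible e" "e ** d = mat 1" using d(1) invertibleE by blast
  have "y = (c ** e) ** z" by (simp add: c(2) d(2) matrix_mul_assoc[symmetric]) (simp add:
      matrix_mul_assoc e)
  then show ?thesis using that[of "c ** e"] invertible_prod[OF c(1) e(1)] by simp
qed

lemma mem_double_coset: "y \<in> double_coset y"
  unfolding double_coset_def
proof (intro CollectI exI conjI)
  show "y = adm (mat 1) ** y ** qadm (mat 1)" by (simp add: adm_one qadm_one)
qed (auto simp: invertible_def intro!: exI[of _ "mat 1"])

lemma double_coset_eqI:
  assumes "y = adm u ** z ** qadm g" "invertible u" "invertible g"
  shows "double_coset y = double_coset z"
proof -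
  have sub: "double_coset (adm u ** z ** qadm g) \<subseteq> double_coset z" if "invertible u" "invertible g"
      for u z g
  proof
    fix x assume "x \<in> double_coset (adm u ** z ** qadm g)"
    then obtain u' g' where *: "invertible u'" "invertible g'" "x = adm u' ** (adm u ** z ** qadm g)
        ** qadm g'"
      unfolding double_coset_def by blast
    then have "x = adm (u' ** u) ** z ** qadm (g ** g')"
      by (simp add: adm_mult qadm_mult matrix_mul_assoc)
    moreover have "invertible (u' ** u)" "invertible (g ** g')"
      using * that by (simp_all add: invertible_prod)
    ultimately show "x \<in> double_coset z" unfolding double_coset_def by blast
  qed
  obtain u' where u': "invertible u'" "u' ** u = mat 1" using assms(2) invertibleE by blast
  obtain g' where g': "invertible g'" "g ** g' = mat 1" using assms(3) invertibleE by blast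
  have "adm u' ** y ** qadm g' = adm (u' ** u) ** z ** qadm (g ** g')"
    unfolding assms(1) by (simp add: adm_mult qadm_mult matrix_mul_assoc)
  then have "z = adm u' ** y ** qadm g'" by (simp add: u' g' adm_one qadm_one)
  then show ?thesis using sub[OF assms(2,3), of z] sub[OF u'(1) g'(1), of y] assms(1) by simp
qed

text \<open>An isomorphism of the groups is a rational matrix \<open>g\<close>. Then \<open>y g\<^sup>-\<^sup>1\<close> and \<open>z\<close> have the same group, and
  after multiplication by a common denominator both are integral, so that they differ by a unit.\<close>

lemma double_coset_eq_iff:
  "double_coset (adm y) = double_coset (adm z) \<longleftrightarrow> (group_at (adm y), group_at (adm z)) \<in> group_iso"
proof
  assume "double_coset (adm y) = double_coset (adm z)"
  then have "adm z \<in> double_coset (adm y)" using mem_double_coset by blast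
  then obtain u g where ug: "invertible u" "invertible g" "adm z = adm u ** adm y ** qadm g"
    unfolding double_coset_def by blast
  obtain h where h: "invertible h" "g ** h = mat 1" "h ** g = mat 1" using ug(2) invertibleE by blast
  have mem: "v \<in> group_at (adm z) \<longleftrightarrow> g *v v \<in> group_at (adm y)" for v
    unfolding ug(3) matrix_mul_assoc[symmetric] group_at_left[OF ug(1)] by (rule group_at_right)
  have "group_at (adm z) = (*v) h ` group_at (adm y)"
  proof (intro equalityI subsetI)
    fix v assume "v \<in> group_at (adm z)"
    then show "v \<in> (*v) h ` group_at (adm y)"
      by (intro image_eqI[of _ _ "g *v v"]) (simp_all add: mem[symmetric] matrix_vector_mul_assoc h)
  next
    fix v assume "v \<in> (*v) h ` group_at (adm y)"
    then obtain x where "x \<in> group_at (adm y)" "v = h *v x" by blast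
    then show "v \<in> group_at (adm z)" by (simp add: mem matrix_vector_mul_assoc h)
  qed
  then show "(group_at (adm y), group_at (adm z)) \<in> group_iso"
    unfolding group_iso_iff using h(1) group_at_intermediate by blast
next
  assume "(group_at (adm y), group_at (adm z)) \<in> group_iso"
  then obtain g where g: "invertible g" "group_at (adm z) = (*v) g ` group_at (adm y)"
    unfolding group_iso_iff by blast
  obtain h where h: "invertible h" "g ** h = mat 1" "h ** g = mat 1" using g(1) invertibleE by blast
  obtain n k where nk: "n \<noteq> 0" "h ** ratm (mat n) = ratm k" by (rule common_denominator)
  define z1 where "z1 = y ** map_matrix of_int k"
  define z2 where "z2 = z ** map_matrix of_int (mat n)"
  have z1: "adm z1 = adm y ** qadm (h ** ratm (mat n))" by (simp add: z1_def adm_mult nk qadm_ratm)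
  have z2: "adm z2 = adm z ** qadm (ratm (mat n))" by (simp add: z2_def adm_mult qadm_ratm)
  have "h *v v \<in> group_at (adm y) \<longleftrightarrow> v \<in> group_at (adm z)" for v
  proof
    assume "h *v v \<in> group_at (adm y)"
    then show "v \<in> group_at (adm z)"
      unfolding g(2) by (intro image_eqI[of _ _ "h *v v"]) (simp_all add: matrix_vector_mul_assoc h)
  next
    assume "v \<in> group_at (adm z)"
    then obtain x where "x \<in> group_at (adm y)" "v = g *v x" unfolding g(2) by blast
    then show "h *v v \<in> group_at (adm y)" by (simp add: matrix_vector_mul_assoc h)
  qed
  then have "group_at (adm z1) = group_at (adm z2)"
    unfolding z1 z2 by (auto simp: group_at_right matrix_vector_mul_assoc[symmetric])
  then obtain u where u: "invertible u" "z1 = u ** z2" by (rule group_at_determines_orbit)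
  have "mat n \<in> nsmat" using nk(1) by (simp add: nsmat_def det_2 mat_def)
  then have "invertible (ratm (mat n))" by (simp add: invertible_ratm)
  have "adm z1 = adm u ** adm z ** qadm (ratm (mat n))"
    by (simp only: u(2) adm_mult z2 matrix_mul_assoc)
  then have "double_coset (adm z1) = double_coset (adm z)"
    using u(1) \<open>invertible (ratm (mat n))\<close> by (rule double_coset_eqI)
  moreover have "double_coset (adm z1) = double_coset (adm y)"
  proof (rule double_coset_eqI)
    show "adm z1 = adm (mat 1) ** adm y ** qadm (h ** ratm (mat n))" by (simp add: z1 adm_one)
    show "invertible (mat 1 :: zhat^2^2)" by (auto simp: invertible_def intro!: exI[of _ "mat 1"])
    show "invertible (h ** ratm (mat n))"
      using h(1) \<open>invertible (ratm (mat n))\<close> by (rule invertible_prod)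
  qed
  ultimately show "double_coset (adm y) = double_coset (adm z)" by simp
qed

lemma double_quotient_integral:
  "double_quotient = (\<lambda>y. double_coset (adm y)) ` UNIV"
proof -
  have "\<exists>y. double_coset Y = double_coset (adm y)" for Y
  proof -
    obtain n11 z11 where 11: "n11 \<noteq> 0" "of_int n11 * Y $ 1 $ 1 = zhat_to_adele z11"
        by (rule adele_clear_denominator)
    obtain n12 z12 where 12: "n12 \<noteq> 0" "of_int n12 * Y $ 1 $ 2 = zhat_to_adele z12"
        by (rule adele_clear_denominator)
    obtain n21 z21 where 21: "n21 \<noteq> 0" "of_int n21 * Y $ 2 $ 1 = zhat_to_adele z21"
        by (rule adele_clear_denominator)
    obtain n22 z22 where 22: "n22 \<noteq> 0" "of_int n22 * Y $ 2 $ 2 = zhat_to_adele z22"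
        by (rule adele_clear_denominator)
    define n where "n = n11 * n12 * n21 * n22"
    have zi: "of_int m * zhat_to_adele z = zhat_to_adele (of_int m * z)" for m z
      by (simp add: zhat_to_adele_mult zhat_to_adele_of_int)
    have "of_int n * Y $ 1 $ 1 = of_int (n12 * n21 * n22) * (of_int n11 * Y $ 1 $ 1)"
      "of_int n * Y $ 1 $ 2 = of_int (n11 * n21 * n22) * (of_int n12 * Y $ 1 $ 2)"
      "of_int n * Y $ 2 $ 1 = of_int (n11 * n12 * n22) * (of_int n21 * Y $ 2 $ 1)"
      "of_int n * Y $ 2 $ 2 = of_int (n11 * n12 * n21) * (of_int n22 * Y $ 2 $ 2)"
      by (simp_all add: n_def mult_ac)
    then have "\<forall>i j. \<exists>z. of_int n * Y $ i $ j = zhat_to_adele z"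
      unfolding 11(2) 12(2) 21(2) 22(2) zi forall_2 by blast
    then obtain f where f: "\<And>i j. of_int n * Y $ i $ j = zhat_to_adele (f i j)" by metis
    have "adm (\<chi> i j. f i j) = adm (mat 1) ** Y ** qadm (ratm (mat n))"
      using rat_to_adele_of_int[of 0]
      by (simp add: adm_one vec_eq_iff forall_2 matrix_matrix_mult_def sum_2 mat_def f[symmetric]
          rat_to_adele_of_int mult.commute zhat_to_adele_0 zhat_to_adele_1)
    moreover have "mat n \<in> nsmat" using 11 12 21 22 by (simp add: n_def nsmat_def det_2 mat_def)
    then have "invertible (ratm (mat n))" by (simp add: invertible_ratm)
    moreover have "invertible (mat 1 :: zhat^2^2)" by (auto simp: invertible_def intro!: exI[of _
        "mat 1"])
    ultimately have "double_coset (adm (\<chi> i j. f i j)) = double_coset Y"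
      by (intro double_coset_eqI)
    then show ?thesis by metis
  qed
  then show ?thesis unfolding double_quotient_def by blast
qed

section \<open>Elements of sets with an action\<close>

lemma set_cat_simps [simp]:
  "obj (set_cat U) = U" "arr (set_cat U) A B = A \<rightarrow>\<^sub>E B"
  "cid (set_cat U) A = (\<lambda>x\<in>A. x)" "ccomp (set_cat U) A B D g f = compose A g f"
  by (simp_all add: set_cat_def)

lemma mset_cat_simps [simp]:
  "N \<in> obj (mset_cat U) \<longleftrightarrow> is_mset N \<and> und N \<in> U" "arr (mset_cat U) N N' = mset_maps N N'"
  "cid (mset_cat U) N = (\<lambda>x\<in>und N. x)" "ccomp (mset_cat U) N N' N'' g f = compose (und N) g f"
  by (simp_all add: mset_cat_def)

lemma act_closed: "is_mset N \<Longrightarrow> a \<in> nsmat \<Longrightarrow> n \<in> und N \<Longrightarrow> act N a n \<in> und N"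
  and act_one: "is_mset N \<Longrightarrow> n \<in> und N \<Longrightarrow> act N (mat 1) n = n"
  and act_mult: "is_mset N \<Longrightarrow> a \<in> nsmat \<Longrightarrow> b \<in> nsmat \<Longrightarrow> n \<in> und N \<Longrightarrow>
    act N (a ** b) n = act N a (act N b n)"
  by (simp_all add: is_mset_def)

lemma mset_maps_mem: "f \<in> mset_maps N N' \<Longrightarrow> n \<in> und N \<Longrightarrow> f n \<in> und N'"
  and mset_maps_act: "f \<in> mset_maps N N' \<Longrightarrow> a \<in> nsmat \<Longrightarrow> n \<in> und N \<Longrightarrow> f (act N a n) = act N' a (f n)"
  and mset_maps_ext: "f \<in> mset_maps N N' \<Longrightarrow> f \<in> extensional (und N)"
  by (auto simp: mset_maps_def PiE_iff)

lemma mset_maps_eqI: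
  assumes "f \<in> mset_maps N N'" "g \<in> mset_maps N N''" "\<And>n. n \<in> und N \<Longrightarrow> f n = g n"
  shows "f = g"
  using assms mset_maps_ext by (metis extensionalityI)

lemma mset_maps_compose:
  assumes "f \<in> mset_maps N N'" "g \<in> mset_maps N' N''" "is_mset N"
  shows "compose (und N) g f \<in> mset_maps N N''"
  using assms unfolding mset_maps_def is_mset_def by (auto simp: compose_def PiE_iff)

definition enum_code :: "'u set set \<Rightarrow> nat \<Rightarrow> 'u" where
  "enum_code U = (SOME e. inj e \<and> range e \<in> U)"

definition enc :: "'u set set \<Rightarrow> 'b::countable \<Rightarrow> 'u" where
  "enc U x = enum_code U (to_nat x)"

text \<open>The few auxiliary sets with an action that are needed are countable. They are transported to the
  type of the universe by an injective code, whose range is small because the universe has an infinite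
  member.\<close>

definition coded :: "'u set set \<Rightarrow> 'b::countable set \<Rightarrow> (int^2^2 \<Rightarrow> 'b \<Rightarrow> 'b) \<Rightarrow> 'u mset" where
  "coded U X \<alpha> = \<lparr>und = enc U ` X, act = (\<lambda>a z. enc U (\<alpha> a (inv_into UNIV (enc U) z)))\<rparr>"

definition free_mset :: "'u set set \<Rightarrow> 'u mset" where
  "free_mset U = coded U nsmat (**)"

abbreviation generator :: "'u set set \<Rightarrow> 'u" where
  "generator U \<equiv> enc U (mat 1 :: int^2^2)"

definition orbit_map :: "'u set set \<Rightarrow> 'u mset \<Rightarrow> 'u \<Rightarrow> 'u \<Rightarrow> 'u" where
  "orbit_map U N n = (\<lambda>z\<in>und (free_mset U). act N (inv_into UNIV (enc U) z) n)"

context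
  fixes U :: "'u set set" assumes U: "set_universe U"
begin

lemma universe_image: "A \<in> U \<Longrightarrow> B \<subseteq> f ` A \<Longrightarrow> B \<in> U"
  using U unfolding set_universe_def by blast

lemma universe_subset: "A \<in> U \<Longrightarrow> B \<subseteq> A \<Longrightarrow> B \<in> U"
  using universe_image[of A B id] by simp

lemma enum_code: "inj (enum_code U) \<and> range (enum_code U) \<in> U"
proof -
  obtain A where A: "A \<in> U" "infinite A" using U unfolding set_universe_def by blast
  then obtain e :: "nat \<Rightarrow> 'u" where "inj e" "range e \<subseteq> A" using infinite_countable_subset by blast
  then have "\<exists>e :: nat \<Rightarrow> 'u. inj e \<and> range e \<in> U" using universe_subset A(1) by blast
  then show ?thesis unfolding enum_code_def by (rule someI_ex)
qed

lemma inj_enc: "inj (enc U :: 'b::countable \<Rightarrow> 'u)"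
proof (rule injI)
  fix x y :: 'b assume "enc U x = enc U y"
  then have "to_nat x = to_nat y" using enum_code unfolding enc_def by (simp add: inj_eq)
  then show "x = y" by simp
qed

lemma inv_enc [simp]: "inv_into UNIV (enc U) (enc U x) = x"
  using inj_enc by (rule inv_f_f)

lemma enc_eq_iff [simp]: "enc U x = enc U y \<longleftrightarrow> x = y"
  using inj_enc by (rule inj_eq)

lemma enc_image: "enc U ` X \<in> U"
proof (rule universe_subset)
  show "range (enum_code U) \<in> U" using enum_code by blast
qed (auto simp: enc_def)

lemma und_coded: "und (coded U X \<alpha>) = enc U ` X"
  by (simp add: coded_def)

lemma act_coded [simp]: "act (coded U X \<alpha>) a (enc U x) = enc U (\<alpha> a x)"
  by (simp add: coded_def)

lemma coded_obj:
  assumes "\<And>a x. a \<in> nsmat \<Longrightarrow> x \<in> X \<Longrightarrow> \<alpha> a x \<in> X" "\<And>x. x \<in> X \<Longrightarrow> \<alpha> (mat 1) x = x"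
    "\<And>a b x. a \<in> nsmat \<Longrightarrow> b \<in> nsmat \<Longrightarrow> x \<in> X \<Longrightarrow> \<alpha> (a ** b) x = \<alpha> a (\<alpha> b x)"
  shows "coded U X \<alpha> \<in> obj (mset_cat U)"
  using assms by (auto simp: is_mset_def und_coded enc_image)

lemma free_mset_obj: "free_mset U \<in> obj (mset_cat U)"
  unfolding free_mset_def by (rule coded_obj) (simp_all add: nsmat_mult matrix_mul_assoc)

lemma und_free_mset: "und (free_mset U) = enc U ` nsmat"
  by (simp add: free_mset_def und_coded)

lemma act_free_mset [simp]: "act (free_mset U) a (enc U m) = enc U (a ** m :: int^2^2)"
  by (simp add: free_mset_def)

lemma orbit_map_enc [simp]: "m \<in> nsmat \<Longrightarrow> orbit_map U N n (enc U m) = act N m n"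
  by (simp add: orbit_map_def und_free_mset)

lemma orbit_map_arr:
  assumes "is_mset N" "n \<in> und N"
  shows "orbit_map U N n \<in> mset_maps (free_mset U) N"
proof -
  have "orbit_map U N n \<in> und (free_mset U) \<rightarrow>\<^sub>E und N"
    using assms by (auto simp: orbit_map_def und_free_mset is_mset_def)
  then show ?thesis
    using assms by (auto simp: mset_maps_def und_free_mset nsmat_mult act_mult)
qed

lemma compose_orbit_map:
  assumes "is_mset N" "n \<in> und N" "f \<in> mset_maps N N'"
  shows "compose (und (free_mset U)) f (orbit_map U N n) = orbit_map U N' (f n)"
  using assms by (auto simp: fun_eq_iff compose_def orbit_map_def und_free_mset mset_maps_act)

lemma free_mset_arr:
  assumes "is_mset N" "h \<in> mset_maps (free_mset U) N"
  shows "h = orbit_map U N (h (generator U))" "h (generator U) \<in> und N"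
proof -
  have one: "generator U \<in> und (free_mset U)" using nsmat_one by (auto simp: und_free_mset)
  with assms(2) show mem: "h (generator U) \<in> und N" by (rule mset_maps_mem)
  show "h = orbit_map U N (h (generator U))"
  proof (rule mset_maps_eqI[OF assms(2) orbit_map_arr[OF assms(1) mem]])
    fix z assume "z \<in> und (free_mset U)"
    then obtain m where m: "m \<in> nsmat" "z = enc U m" by (auto simp: und_free_mset)
    have "h (act (free_mset U) m (generator U)) = act N m (h (generator U))"
      using assms(2) m(1) one by (rule mset_maps_act)
    then show "h z = orbit_map U N (h (generator U)) z" using m by simp
  qed
qed

end

text \<open>Both categories have an object whose maps to \<open>X\<close> are the elements of \<open>X\<close>, namely a singleton and
  the monoid itself. Limits in them are therefore limits of elements.\<close>

definition compatible_family ::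
  "nat set \<Rightarrow> (nat \<Rightarrow> 'a set) \<Rightarrow> (nat \<times> nat \<times> ('a \<Rightarrow> 'a)) set \<Rightarrow> (nat \<Rightarrow> 'a) \<Rightarrow> bool" where
  "compatible_family I D E y \<longleftrightarrow> (\<forall>i\<in>I. y i \<in> D i) \<and> (\<forall>(i, j, f)\<in>E. f (y i) = y j)"

definition elementwise_limit ::
  "nat set \<Rightarrow> (nat \<Rightarrow> 'a set) \<Rightarrow> (nat \<times> nat \<times> ('a \<Rightarrow> 'a)) set \<Rightarrow> 'a set \<Rightarrow> (nat \<Rightarrow> 'a \<Rightarrow> 'a) \<Rightarrow> bool" where
  "elementwise_limit I D E L l \<longleftrightarrow>
     (\<forall>y. compatible_family I D E y \<longrightarrow> (\<exists>!z. z \<in> L \<and> (\<forall>i\<in>I. l i z = y i)))"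

lemma is_limit_set_catI:
  assumes dia: "finite_diagram (set_cat U) I D E" and cone: "is_cone (set_cat U) I D E L l"
    and lim: "elementwise_limit I D E L l"
  shows "is_limit (set_cat U) I D E L l"
  unfolding is_limit_def
proof (intro conjI allI impI cone)
  fix L' l' assume cone': "is_cone (set_cat U) I D E L' l'"
  have l: "\<And>i x. i \<in> I \<Longrightarrow> x \<in> L \<Longrightarrow> l i x \<in> D i" using cone by (auto simp: is_cone_def)
  have l': "\<And>i. i \<in> I \<Longrightarrow> l' i \<in> L' \<rightarrow>\<^sub>E D i" using cone' by (auto simp: is_cone_def)
  have "compatible_family I D E (\<lambda>i. l' i x)" if x: "x \<in> L'" for x
  proof -
    have "f (l' i x) = l' j x" if "(i, j, f) \<in> E" for i j f
    proof -
      have "compose L' f (l' i) = l' j" using cone' that by (auto simp: is_cone_def)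
      then show ?thesis using x by (metis compose_eq)
    qed
    then show ?thesis using l' x by (auto simp: compatible_family_def PiE_iff)
  qed
  then have ex: "\<And>x. x \<in> L' \<Longrightarrow> \<exists>!z. z \<in> L \<and> (\<forall>i\<in>I. l i z = l' i x)"
    using lim unfolding elementwise_limit_def by blast
  define h where "h = (\<lambda>x\<in>L'. THE z. z \<in> L \<and> (\<forall>i\<in>I. l i z = l' i x))"
  have h: "h x \<in> L" "\<And>i. i \<in> I \<Longrightarrow> l i (h x) = l' i x" if "x \<in> L'" for x
    using theI'[OF ex[OF that]] that by (auto simp: h_def)
  have hL: "h \<in> L' \<rightarrow>\<^sub>E L" using h(1) by (auto simp: h_def)
  have hl: "compose L' (l i) h = l' i" if "i \<in> I" for i
    by (rule extensionalityI[of _ L']) (use l'[OF that] h(2) that in \<open>auto simp: compose_eq PiE_iff\<close>)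
  have hu: "h' = h" if h': "h' \<in> L' \<rightarrow>\<^sub>E L" "\<forall>i\<in>I. compose L' (l i) h' = l' i" for h'
  proof (rule extensionalityI[of _ L'])
    fix x assume x: "x \<in> L'"
    have "\<forall>i\<in>I. l i (h' x) = l' i x" using h'(2) x by (metis compose_eq)
    moreover have "h' x \<in> L" using h'(1) x by auto
    ultimately show "h' x = h x" using ex[OF x] h[OF x] by blast
  qed (use h' in \<open>auto simp: h_def PiE_iff\<close>)
  show "\<exists>!h. h \<in> arr (set_cat U) L' L \<and> (\<forall>i\<in>I. ccomp (set_cat U) L' L (D i) (l i) h = l' i)"
    unfolding set_cat_simps 
    by (rule ex1I[of _ h], intro conjI ballI hL hl) (assumption, elim conjE, rule hu)
qed

lemma is_limit_set_catD:
  assumes U: "set_universe U" and dia: "finite_diagram (set_cat U) I D E"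
    and lim: "is_limit (set_cat U) I D E L l"
  shows "elementwise_limit I D E L l"
  unfolding elementwise_limit_def
proof (intro allI impI)
  fix y assume y: "compatible_family I D E y"
  define c where "c = enc U (0 :: nat)"
  define l' where "l' i = (\<lambda>x\<in>{c}. y i)" for i
  have c: "{c} \<in> U" using enc_image[OF U, of "{0 :: nat}"] by (simp add: c_def)
  have "is_cone (set_cat U) I D E {c} l'"
    unfolding is_cone_def
  proof (intro conjI ballI)
    fix e assume e: "e \<in> E"
    obtain i j f where ijf: "e = (i, j, f)" by (cases e)
    have "compose {c} f (l' i) = l' j"
      using y e ijf by (auto simp: compose_def l'_def compatible_family_def fun_eq_iff)
    then show "case e of (i, j, f) \<Rightarrow> ccomp (set_cat U) {c} (D i) (D j) f (l' i) = l' j"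
      by (simp add: ijf)
  qed (use y c in \<open>auto simp: l'_def compatible_family_def\<close>)
  then have ex: "\<exists>!h. h \<in> {c} \<rightarrow>\<^sub>E L \<and> (\<forall>i\<in>I. compose {c} (l i) h = l' i)"
    using lim unfolding is_limit_def set_cat_simps by blast
  have tr: "compose {c} (l i) h = l' i \<longleftrightarrow> l i (h c) = y i" for i h
    by (auto simp: compose_def l'_def fun_eq_iff)
  from ex obtain h where h: "h \<in> {c} \<rightarrow>\<^sub>E L" "\<forall>i\<in>I. l i (h c) = y i" unfolding tr by blast
  show "\<exists>!z. z \<in> L \<and> (\<forall>i\<in>I. l i z = y i)"
  proof (rule ex1I[of _ "h c"])
    show "h c \<in> L \<and> (\<forall>i\<in>I. l i (h c) = y i)" using h by auto
    fix z assume z: "z \<in> L \<and> (\<forall>i\<in>I. l i z = y i)"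
    then have "(\<lambda>x\<in>{c}. z) \<in> {c} \<rightarrow>\<^sub>E L \<and> (\<forall>i\<in>I. l i ((\<lambda>x\<in>{c}. z) c) = y i)" by auto
    then have "(\<lambda>x\<in>{c}. z) = h" using ex h unfolding tr by blast
    then show "z = h c" by (metis restrict_apply' singletonI)
  qed
qed

lemma is_limit_mset_catI:
  assumes dia: "finite_diagram (mset_cat U) I d E" and cone: "is_cone (mset_cat U) I d E L l"
    and lim: "elementwise_limit I (\<lambda>i. und (d i)) E (und L) l"
  shows "is_limit (mset_cat U) I d E L l"
  unfolding is_limit_def
proof (intro conjI allI impI cone)
  fix L' l' assume cone': "is_cone (mset_cat U) I d E L' l'"
  have L: "is_mset L" "is_mset L'" using cone cone' by (auto simp: is_cone_def)
  have l: "\<And>i. i \<in> I \<Longrightarrow> l i \<in> mset_maps L (d i)" using cone by (auto simp: is_cone_def)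
  have l': "\<And>i. i \<in> I \<Longrightarrow> l' i \<in> mset_maps L' (d i)" using cone' by (auto simp: is_cone_def)
  have "compatible_family I (\<lambda>i. und (d i)) E (\<lambda>i. l' i x)" if x: "x \<in> und L'" for x
  proof -
    have "f (l' i x) = l' j x" if "(i, j, f) \<in> E" for i j f
    proof -
      have "compose (und L') f (l' i) = l' j" using cone' that by (auto simp: is_cone_def)
      then show ?thesis using x by (metis compose_eq)
    qed
    then show ?thesis using l' x mset_maps_mem by (fastforce simp: compatible_family_def)
  qed
  then have ex: "\<And>x. x \<in> und L' \<Longrightarrow> \<exists>!z. z \<in> und L \<and> (\<forall>i\<in>I. l i z = l' i x)"
    using lim unfolding elementwise_limit_def by blast
  define h where "h = (\<lambda>x\<in>und L'. THE z. z \<in> und L \<and> (\<forall>i\<in>I. l i z = l' i x))"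
  have h: "h x \<in> und L" "\<And>i. i \<in> I \<Longrightarrow> l i (h x) = l' i x" if "x \<in> und L'" for x
    using theI'[OF ex[OF that]] that by (auto simp: h_def)
  have "h (act L' a x) = act L a (h x)" if a: "a \<in> nsmat" and x: "x \<in> und L'" for a x
  proof -
    have ax: "act L' a x \<in> und L'" using L(2) a x by (rule act_closed)
    have "l i (act L a (h x)) = l' i (act L' a x)" if i: "i \<in> I" for i
      using mset_maps_act[OF l[OF i] a h(1)[OF x]] mset_maps_act[OF l'[OF i] a x] h(2)[OF x i] by simp
    moreover have "act L a (h x) \<in> und L" using L(1) a h(1)[OF x] by (rule act_closed)
    ultimately show ?thesis using ex[OF ax] h[OF ax] by blast
  qed
  then have hL: "h \<in> mset_maps L' L" using h(1) by (auto simp: mset_maps_def h_def)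
  have hl: "compose (und L') (l i) h = l' i" if "i \<in> I" for i
    by (rule extensionalityI[of _ "und L'"])
      (use mset_maps_ext[OF l'[OF that]] h(2) that in \<open>auto simp: compose_eq\<close>)
  have hu: "h' = h" if h': "h' \<in> mset_maps L' L" "\<forall>i\<in>I. compose (und L') (l i) h' = l' i" for h'
  proof (rule extensionalityI[of _ "und L'"])
    fix x assume x: "x \<in> und L'"
    have "\<forall>i\<in>I. l i (h' x) = l' i x" using h'(2) x by (metis compose_eq)
    moreover have "h' x \<in> und L" using h'(1) x by (rule mset_maps_mem)
    ultimately show "h' x = h x" using ex[OF x] h[OF x] by blast
  qed (use mset_maps_ext[OF h'(1)] in \<open>auto simp: h_def\<close>)
  show "\<exists>!h. h \<in> arr (mset_cat U) L' L \<and> (\<forall>i\<in>I. ccomp (mset_cat U) L' L (d i) (l i) h = l' i)"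
    unfolding mset_cat_simps 
    by (rule ex1I[of _ h], intro conjI ballI hL hl) (assumption, elim conjE, rule hu)
qed

lemma is_limit_mset_catD:
  assumes U: "set_universe U" and dia: "finite_diagram (mset_cat U) I d E"
    and lim: "is_limit (mset_cat U) I d E L l"
  shows "elementwise_limit I (\<lambda>i. und (d i)) E (und L) l"
  unfolding elementwise_limit_def
proof (intro allI impI)
  fix y assume y: "compatible_family I (\<lambda>i. und (d i)) E y"
  note free = free_mset_obj[OF U] and om = orbit_map_arr[OF U]
  have ms: "\<And>i. i \<in> I \<Longrightarrow> is_mset (d i)" using dia by (auto simp: finite_diagram_def)
  have L: "is_mset L" and l: "\<And>i. i \<in> I \<Longrightarrow> l i \<in> mset_maps L (d i)"
    using lim by (auto simp: is_limit_def is_cone_def)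
  define l' where "l' i = orbit_map U (d i) (y i)" for i
  have yd: "\<And>i. i \<in> I \<Longrightarrow> y i \<in> und (d i)" using y by (simp add: compatible_family_def)
  have "is_cone (mset_cat U) I d E (free_mset U) l'"
    unfolding is_cone_def
  proof (intro conjI ballI)
    fix e assume e: "e \<in> E"
    obtain i j f where ijf: "e = (i, j, f)" by (cases e)
    have *: "i \<in> I" "f \<in> mset_maps (d i) (d j)" "f (y i) = y j"
      using dia y e by (auto simp: ijf finite_diagram_def compatible_family_def)
    then show "case e of (i, j, f) \<Rightarrow> ccomp (mset_cat U) (free_mset U) (d i) (d j) f (l' i) = l' j"
      using compose_orbit_map[OF U ms yd, of i f] by (simp add: ijf l'_def)
  qed (use free om ms yd in \<open>simp_all add: l'_def\<close>)
  then have ex: "\<exists>!h. h \<in> mset_maps (free_mset U) L \<and> (\<forall>i\<in>I. compose (und (free_mset U)) (l i) h = l' i)"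
    using lim unfolding is_limit_def mset_cat_simps by blast
  have tr: "compose (und (free_mset U)) (l i) (orbit_map U L z) = l' i \<longleftrightarrow> l i z = y i"
    if z: "z \<in> und L" and i: "i \<in> I" for i z
  proof -
    have "orbit_map U (d i) n (generator U) = n" if "n \<in> und (d i)" for n
      using ms[OF i] that by (simp add: nsmat_one act_one orbit_map_enc[OF U])
    then show ?thesis
      using compose_orbit_map[OF U L z l[OF i]] mset_maps_mem[OF l[OF i] z] yd[OF i] by (metis l'_def)
  qed
  from ex obtain h where h: "h \<in> mset_maps (free_mset U) L" "\<forall>i\<in>I. compose (und (free_mset U)) (l i)
      h = l' i"
    by blast
  define z where "z = h (generator U)"
  have z: "z \<in> und L" "h = orbit_map U L z"
    unfolding z_def using free_mset_arr[OF U L h(1)] by auto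
  show "\<exists>!z. z \<in> und L \<and> (\<forall>i\<in>I. l i z = y i)"
  proof (rule ex1I[of _ z])
    show "z \<in> und L \<and> (\<forall>i\<in>I. l i z = y i)" using h(2) tr[OF z(1)] z by auto
    fix x assume x: "x \<in> und L \<and> (\<forall>i\<in>I. l i x = y i)"
    then have "orbit_map U L x = orbit_map U L z"
      using ex h om[OF L] tr z by blast
    then have "orbit_map U L x (generator U) = orbit_map U L z (generator U)" by simp
    then show "x = z" using x z(1) L by (simp add: nsmat_one act_one orbit_map_enc[OF U])
  qed
qed

section \<open>Functors presented by a group\<close>

text \<open>Here \<open>F N\<close> is the tensor product of the right module of frames of \<open>A\<close> with the left module \<open>N\<close>,
  that is, the filtered colimit of copies of \<open>N\<close> over the lattices in \<open>A\<close>, and \<open>\<theta> N s n\<close> is the class of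
  \<open>s \<otimes> n\<close>. Over the same frame two classes agree iff they agree after passing to a larger lattice.\<close>

locale presentation =
  fixes U :: "'u set set" and A :: "(rat^2) set" and F :: "'u point"
    and \<theta> :: "'u mset \<Rightarrow> rat^2^2 \<Rightarrow> 'u \<Rightarrow> 'u"
  assumes U: "set_universe U" and A: "A \<in> intermediate_groups"
    and is_functor: "is_functor (mset_cat U) (set_cat U) F"
    and mem: "\<And>N s n. N \<in> obj (mset_cat U) \<Longrightarrow> s \<in> frames A \<Longrightarrow> n \<in> und N \<Longrightarrow> \<theta> N s n \<in> fobj F N"
    and surj: "\<And>N z. N \<in> obj (mset_cat U) \<Longrightarrow> z \<in> fobj F N \<Longrightarrow> \<exists>s\<in>frames A. \<exists>n\<in>und N. z = \<theta> N s n"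
    and balanced: "\<And>N s m n. N \<in> obj (mset_cat U) \<Longrightarrow> s \<in> frames A \<Longrightarrow> m \<in> nsmat \<Longrightarrow> n \<in> und N \<Longrightarrow>
      \<theta> N (s ** ratm m) n = \<theta> N s (act N m n)"
    and separated: "\<And>N s n n'. N \<in> obj (mset_cat U) \<Longrightarrow> s \<in> frames A \<Longrightarrow> n \<in> und N \<Longrightarrow> n' \<in> und N \<Longrightarrow>
      \<theta> N s n = \<theta> N s n' \<Longrightarrow> \<exists>t\<in>frames A. \<exists>m\<in>nsmat. s = t ** ratm m \<and> act N m n = act N m n'"
    and natural: "\<And>N N' f s n. N \<in> obj (mset_cat U) \<Longrightarrow> N' \<in> obj (mset_cat U) \<Longrightarrow> f \<in> mset_maps N N' \<Longrightarrow>
      s \<in> frames A \<Longrightarrow> n \<in> und N \<Longrightarrow> farr F N N' f (\<theta> N s n) = \<theta> N' s (f n)"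

lemma functor_simps:
  assumes "is_functor (mset_cat U) (set_cat U) F"
  shows "N \<in> obj (mset_cat U) \<Longrightarrow> fobj F N \<in> U"
    "N \<in> obj (mset_cat U) \<Longrightarrow> N' \<in> obj (mset_cat U) \<Longrightarrow> f \<in> mset_maps N N' \<Longrightarrow>
      farr F N N' f \<in> fobj F N \<rightarrow>\<^sub>E fobj F N'"
    "N \<in> obj (mset_cat U) \<Longrightarrow> farr F N N (\<lambda>x\<in>und N. x) = (\<lambda>x\<in>fobj F N. x)"
    "N \<in> obj (mset_cat U) \<Longrightarrow> N' \<in> obj (mset_cat U) \<Longrightarrow> N'' \<in> obj (mset_cat U) \<Longrightarrow>
      f \<in> mset_maps N N' \<Longrightarrow> g \<in> mset_maps N' N'' \<Longrightarrow>
      farr F N N'' (compose (und N) g f) = compose (fobj F N) (farr F N' N'' g) (farr F N N' f)"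
  using assms unfolding is_functor_def set_cat_simps mset_cat_simps(2-) by blast+

lemma functor_compose_eq:
  assumes "is_functor (mset_cat U) (set_cat U) F"
    "N \<in> obj (mset_cat U)" "N' \<in> obj (mset_cat U)" "N'' \<in> obj (mset_cat U)"
    "f \<in> mset_maps N N'" "g \<in> mset_maps N' N''" "z \<in> fobj F N"
  shows "farr F N' N'' g (farr F N N' f z) = farr F N N'' (compose (und N) g f) z"
  using functor_simps(4)[OF assms(1-6)] assms(7) by (simp add: compose_eq)

lemma finite_diagram_image:
  assumes F: "is_functor (mset_cat U) (set_cat U) F" and dia: "finite_diagram (mset_cat U) I d E"
  shows "finite_diagram (set_cat U) I (\<lambda>i. fobj F (d i)) ((\<lambda>(i, j, f). (i, j,
      farr F (d i) (d j) f)) ` E)"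
  unfolding finite_diagram_def
proof (intro conjI ballI)
  have d: "\<And>i. i \<in> I \<Longrightarrow> d i \<in> obj (mset_cat U)" using dia by (simp add: finite_diagram_def)
  show "finite I" "finite ((\<lambda>(i, j, f). (i, j, farr F (d i) (d j) f)) ` E)"
    using dia by (auto simp: finite_diagram_def)
  show "fobj F (d i) \<in> obj (set_cat U)" if "i \<in> I" for i using functor_simps(1)[OF F d[OF that]] by simp
  fix e assume "e \<in> (\<lambda>(i, j, f). (i, j, farr F (d i) (d j) f)) ` E"
  then obtain i j f where e: "e = (i, j, farr F (d i) (d j) f)" "(i, j, f) \<in> E" by auto
  then have *: "i \<in> I" "j \<in> I" "f \<in> mset_maps (d i) (d j)"
    using dia by (auto simp: finite_diagram_def)
  then show "case e of (i, j, f) \<Rightarrow> i \<in> I \<and> j \<in> I \<and> f \<in> arr (set_cat U) (fobj F (d i)) (fobj F (d j))"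
    using functor_simps(2)[OF F d d, of i j f] by (simp add: e)
qed

lemma is_cone_image:
  assumes F: "is_functor (mset_cat U) (set_cat U) F" and dia: "finite_diagram (mset_cat U) I d E"
    and cone: "is_cone (mset_cat U) I d E L l"
  shows "is_cone (set_cat U) I (\<lambda>i. fobj F (d i)) ((\<lambda>(i, j, f). (i, j, farr F (d i) (d j) f)) ` E)
    (fobj F L) (\<lambda>i. farr F L (d i) (l i))"
  unfolding is_cone_def
proof (intro conjI ballI)
  have d: "\<And>i. i \<in> I \<Longrightarrow> d i \<in> obj (mset_cat U)" using dia by (simp add: finite_diagram_def)
  have L: "L \<in> obj (mset_cat U)" and l: "\<And>i. i \<in> I \<Longrightarrow> l i \<in> mset_maps L (d i)"
    using cone by (auto simp: is_cone_def)
  show "fobj F L \<in> obj (set_cat U)" using functor_simps(1)[OF F L] by simp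
  show "farr F L (d i) (l i) \<in> arr (set_cat U) (fobj F L) (fobj F (d i))" if "i \<in> I" for i
    using functor_simps(2)[OF F L d l] that by simp
  fix e assume "e \<in> (\<lambda>(i, j, f). (i, j, farr F (d i) (d j) f)) ` E"
  then obtain i j f where e: "e = (i, j, farr F (d i) (d j) f)" "(i, j, f) \<in> E" by auto
  from this(2) have *: "i \<in> I" "j \<in> I" "f \<in> mset_maps (d i) (d j)" "compose (und L) f (l i) = l j"
    using dia cone by (auto simp: finite_diagram_def is_cone_def)
  show "case e of (i, j, f) \<Rightarrow> ccomp (set_cat U) (fobj F L) (fobj F (d i)) (fobj F (d j)) f
      (farr F L (d i) (l i)) = farr F L (d j) (l j)"
    using functor_simps(4)[OF F L d[OF *(1)] d[OF *(2)] l[OF *(1)] *(3)] *(4) by (simp add: e)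
qed

lemma is_iso_set_catI:
  assumes "f \<in> X \<rightarrow>\<^sub>E Y" "bij_betw f X Y"
  shows "is_iso_arr (set_cat U) X Y f"
proof -
  define g where "g = (\<lambda>y\<in>Y. inv_into X f y)"
  have "g \<in> Y \<rightarrow>\<^sub>E X" using assms(2) bij_betw_inv_into[OF assms(2)] by (auto simp: g_def bij_betw_def)
  moreover have "compose X g f = (\<lambda>x\<in>X. x)" "compose Y f g = (\<lambda>y\<in>Y. y)"
    using assms bij_betw_inv_into_left[OF assms(2)] bij_betw_inv_into_right[OF assms(2)]
    by (auto simp: compose_def g_def fun_eq_iff PiE_iff)
  ultimately show ?thesis using assms(1) unfolding is_iso_arr_def set_cat_simps by blast
qed

lemma is_iso_set_catD:
  assumes "is_iso_arr (set_cat U) X Y f"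
  shows "f \<in> X \<rightarrow>\<^sub>E Y" "bij_betw f X Y"
proof -
  show f: "f \<in> X \<rightarrow>\<^sub>E Y" using assms by (simp add: is_iso_arr_def)
  obtain g where g: "g \<in> Y \<rightarrow>\<^sub>E X" "compose X g f = (\<lambda>x\<in>X. x)" "compose Y f g = (\<lambda>y\<in>Y. y)"
    using assms by (auto simp: is_iso_arr_def)
  show "bij_betw f X Y"
  proof (rule bij_betw_byWitness[where f' = g])
    show "\<forall>x\<in>X. g (f x) = x" using g(2) by (metis compose_eq restrict_apply')
    show "\<forall>y\<in>Y. f (g y) = y" using g(3) by (metis compose_eq restrict_apply')
  qed (use f g in auto)
qed

context presentation
begin

lemma frame_cancel:
  assumes "s \<in> frames A" "s ** ratm m = s ** ratm m'" shows "m = m'"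
  using assms invertible_cancel_left[OF frames_invertible] by (metis ratm_eq_iff)

lemma balanced_eq_iff:
  assumes N: "N \<in> obj (mset_cat U)" and s: "s \<in> frames A" "s' \<in> frames A" and n: "n \<in> und N" "n' \<in> und N"
  shows "\<theta> N s n = \<theta> N s' n' \<longleftrightarrow> (\<exists>t\<in>frames A. \<exists>m\<in>nsmat. \<exists>m'\<in>nsmat.
    s = t ** ratm m \<and> s' = t ** ratm m' \<and> act N m n = act N m' n')"
proof
  have ms: "is_mset N" using N by simp
  assume eq: "\<theta> N s n = \<theta> N s' n'"
  obtain h k k' where h: "h \<in> frames A" "k \<in> nsmat" "k' \<in> nsmat" "s = h ** ratm k" "s' = h ** ratm k'"
    using frames_directed[OF A s] by blast
  have mem: "act N k n \<in> und N" "act N k' n' \<in> und N" using act_closed[OF ms] h n by auto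
  have "\<theta> N h (act N k n) = \<theta> N h (act N k' n')"
    using eq balanced[OF N h(1,2) n(1)] balanced[OF N h(1,3) n(2)] h(4,5) by simp
  from separated[OF N h(1) mem this] obtain t m where
    t: "t \<in> frames A" "m \<in> nsmat" "h = t ** ratm m" "act N m (act N k n) = act N m (act N k' n')"
        by blast
  have "s = t ** ratm (m ** k)" "s' = t ** ratm (m ** k')"
    by (simp_all add: h(4,5) t(3) ratm_mult matrix_mul_assoc)
  moreover have "act N (m ** k) n = act N (m ** k') n'"
    using t(4) act_mult[OF ms t(2) h(2) n(1)] act_mult[OF ms t(2) h(3) n(2)] by simp
  ultimately show "\<exists>t\<in>frames A. \<exists>m\<in>nsmat. \<exists>m'\<in>nsmat.
    s = t ** ratm m \<and> s' = t ** ratm m' \<and> act N m n = act N m' n'"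
    using t(1) nsmat_mult[OF t(2) h(2)] nsmat_mult[OF t(2) h(3)] by blast
next
  assume "\<exists>t\<in>frames A. \<exists>m\<in>nsmat. \<exists>m'\<in>nsmat.
    s = t ** ratm m \<and> s' = t ** ratm m' \<and> act N m n = act N m' n'"
  then show "\<theta> N s n = \<theta> N s' n'" using balanced[OF N] n by auto
qed

lemma common_frame:
  assumes "finite I" "\<And>i. i \<in> I \<Longrightarrow> s i \<in> frames A"
  shows "\<exists>t\<in>frames A. \<forall>i\<in>I. \<exists>m\<in>nsmat. s i = t ** ratm m"
  using assms
proof (induction I rule: finite_induct)
  case empty
  show ?case using frames_one[OF A] by blast
next
  case (insert i I)
  then obtain t where t: "t \<in> frames A" "\<forall>i\<in>I. \<exists>m\<in>nsmat. s i = t ** ratm m" by auto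
  have "s i \<in> frames A" using insert.prems by simp
  from frames_directed[OF A t(1) this] obtain h m m' where
    h: "h \<in> frames A" "m \<in> nsmat" "m' \<in> nsmat" "t = h ** ratm m" "s i = h ** ratm m'" by blast
  have "\<exists>k\<in>nsmat. s j = h ** ratm k" if "j \<in> I" for j
  proof -
    obtain k where k: "k \<in> nsmat" "s j = t ** ratm k" using t(2) \<open>j \<in> I\<close> by blast
    have "s j = h ** ratm (m ** k)" by (simp add: k(2) h(4) ratm_mult matrix_mul_assoc)
    then show ?thesis using nsmat_mult[OF h(2) k(1)] by blast
  qed
  then show ?case using h(1,3,5) by blast
qed

text \<open>Each equation holds after a refinement of \<open>s\<close>. A common refinement \<open>h\<close> of these works for all,
  because \<open>s = h r\<close> determines the integer matrix \<open>r\<close>.\<close>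

lemma separate_finitely_many:
  assumes fin: "finite K" and s: "s \<in> frames A" and N: "\<And>k. k \<in> K \<Longrightarrow> N k \<in> obj (mset_cat U)"
    and n: "\<And>k. k \<in> K \<Longrightarrow> n k \<in> und (N k)" "\<And>k. k \<in> K \<Longrightarrow> n' k \<in> und (N k)"
    and eq: "\<And>k. k \<in> K \<Longrightarrow> \<theta> (N k) s (n k) = \<theta> (N k) s (n' k)"
  obtains t m where "t \<in> frames A" "m \<in> nsmat" "s = t ** ratm m"
    "\<And>k. k \<in> K \<Longrightarrow> act (N k) m (n k) = act (N k) m (n' k)"
proof -
  have "\<forall>k\<in>K. \<exists>t m. t \<in> frames A \<and> m \<in> nsmat \<and> s = t ** ratm m \<and> act (N k) m (n k) = act (N k) m (n' k)"
    using separated[OF N s n eq] by blast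
  then obtain t m where tm: "\<And>k. k \<in> K \<Longrightarrow> t k \<in> frames A \<and> m k \<in> nsmat \<and> s = t k ** ratm (m k) \<and>
    act (N k) (m k) (n k) = act (N k) (m k) (n' k)" by metis
  define t' where "t' x = (case x of None \<Rightarrow> s | Some k \<Rightarrow> t k)" for x
  have "\<And>x. x \<in> insert None (Some ` K) \<Longrightarrow> t' x \<in> frames A" using tm s by (auto simp: t'_def)
  then obtain h where h: "h \<in> frames A" "\<forall>x\<in>insert None (Some ` K). \<exists>m\<in>nsmat. t' x = h ** ratm m"
    using common_frame[of "insert None (Some ` K)" t'] fin by blast
  obtain r where r: "r \<in> nsmat" "s = h ** ratm r" using h(2) by (auto simp: t'_def)
  show ?thesis
  proof (rule that[OF h(1) r])
    fix k assume k: "k \<in> K"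
    obtain u where u: "u \<in> nsmat" "t k = h ** ratm u" using h(2) k by (auto simp: t'_def)
    have "h ** ratm r = h ** ratm (u ** m k)"
      using tm[OF k] r(2) u(2) by (simp add: ratm_mult matrix_mul_assoc)
    then have ru: "r = u ** m k" using frame_cancel[OF h(1)] by blast
    have ms: "is_mset (N k)" using N[OF k] by simp
    show "act (N k) r (n k) = act (N k) r (n' k)"
      using tm[OF k] u(1) n k by (simp add: ru act_mult[OF ms])
  qed
qed

text \<open>Filtered colimits commute with finite limits: finitely many elements live over a common frame,
  and finitely many equations between them hold after one further refinement.\<close>

lemma preserves_limits: "preserves_finite_limits (mset_cat U) (set_cat U) F"
  unfolding preserves_finite_limits_def
proof (intro allI impI)
  fix I d E L l
  assume dia: "finite_diagram (mset_cat U) I d E" and lim: "is_limit (mset_cat U) I d E L l"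
  define E' where "E' = (\<lambda>(i, j, f). (i, j, farr F (d i) (d j) f)) ` E"
  have fin: "finite I" "finite E" and d: "\<And>i. i \<in> I \<Longrightarrow> d i \<in> obj (mset_cat U)"
    using dia by (auto simp: finite_diagram_def)
  have E: "i \<in> I" "j \<in> I" "f \<in> mset_maps (d i) (d j)" if "(i, j, f) \<in> E" for i j f
    using dia that by (auto simp: finite_diagram_def)
  have cone: "is_cone (mset_cat U) I d E L l" using lim by (simp add: is_limit_def)
  then have L: "L \<in> obj (mset_cat U)" and l: "\<And>i. i \<in> I \<Longrightarrow> l i \<in> mset_maps L (d i)"
    by (auto simp: is_cone_def)
  have ms: "is_mset L" "\<And>i. i \<in> I \<Longrightarrow> is_mset (d i)" using L d by auto
  have elt: "elementwise_limit I (\<lambda>i. und (d i)) E (und L) l" by (rule is_limit_mset_catD[OF U dia lim])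
  have "elementwise_limit I (\<lambda>i. fobj F (d i)) E' (fobj F L) (\<lambda>i. farr F L (d i) (l i))"
    unfolding elementwise_limit_def
  proof (intro allI impI)
    fix y assume y: "compatible_family I (\<lambda>i. fobj F (d i)) E' y"
    then have "\<forall>i\<in>I. \<exists>s n. s \<in> frames A \<and> n \<in> und (d i) \<and> y i = \<theta> (d i) s n"
      using surj[OF d] unfolding compatible_family_def by blast
    then obtain s n where sn: "\<And>i. i \<in> I \<Longrightarrow> s i \<in> frames A \<and> n i \<in> und (d i) \<and> y i = \<theta> (d i) (s i) (n i)"
      by metis
    then obtain q where q: "q \<in> frames A" "\<forall>i\<in>I. \<exists>m\<in>nsmat. s i = q ** ratm m"
      using common_frame[OF fin(1), of s] by blast
    then obtain m where m: "\<And>i. i \<in> I \<Longrightarrow> m i \<in> nsmat \<and> s i = q ** ratm (m i)" by metis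
    define a where "a i = act (d i) (m i) (n i)" for i
    have a: "a i \<in> und (d i)" "y i = \<theta> (d i) q (a i)" if "i \<in> I" for i
      using sn[OF that] m[OF that] act_closed[OF ms(2)[OF that]] balanced[OF d[OF that] q(1)]
          by (auto simp: a_def)
    have edge: "\<theta> (d j) q (f (a i)) = \<theta> (d j) q (a j)" if e: "(i, j, f) \<in> E" for i j f
    proof -
      have "(i, j, farr F (d i) (d j) f) \<in> E'" using e unfolding E'_def by (rule image_eqI[rotated]) simp
      then have "farr F (d i) (d j) f (y i) = y j" using y by (auto simp: compatible_family_def)
      then show ?thesis using natural[OF d d E(3)[OF e] q(1) a(1)] a E[OF e] by simp
    qed
    obtain t r where t: "t \<in> frames A" "r \<in> nsmat" "q = t ** ratm r"
      "\<And>e. e \<in> E \<Longrightarrow> (case e of (i, j, f) \<Rightarrow> act (d j) r (f (a i)) = act (d j) r (a j))"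
    proof (rule separate_finitely_many[OF fin(2) q(1), of "\<lambda>(i, j, f). d j" "\<lambda>(i, j, f). f (a i)"
        "\<lambda>(i, j, f). a j"])
      fix e assume e: "e \<in> E"
      obtain i j f where ijf: "e = (i, j, f)" by (cases e)
      note e' = E[OF e[unfolded ijf]]
      show "(case e of (i, j, f) \<Rightarrow> d j) \<in> obj (mset_cat U)" using d e' by (simp add: ijf)
      show "(case e of (i, j, f) \<Rightarrow> f (a i)) \<in> und (case e of (i, j, f) \<Rightarrow> d j)"
        using mset_maps_mem[OF e'(3) a(1)[OF e'(1)]] by (simp add: ijf)
      show "(case e of (i, j, f) \<Rightarrow> a j) \<in> und (case e of (i, j, f) \<Rightarrow> d j)"
        using a(1)[OF e'(2)] by (simp add: ijf)
      show "\<theta> (case e of (i, j, f) \<Rightarrow> d j) q (case e of (i, j, f) \<Rightarrow> f (a i)) =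
        \<theta> (case e of (i, j, f) \<Rightarrow> d j) q (case e of (i, j, f) \<Rightarrow> a j)"
        using edge e by (simp add: ijf)
    next
      fix t m assume *: "t \<in> frames A" "m \<in> nsmat" "q = t ** ratm m"
        "\<And>e. e \<in> E \<Longrightarrow> act (case e of (i, j, f) \<Rightarrow> d j) m (case e of (i, j, f) \<Rightarrow> f (a i)) =
          act (case e of (i, j, f) \<Rightarrow> d j) m (case e of (i, j, f) \<Rightarrow> a j)"
      show thesis by (rule that[OF *(1-3)]) (use *(4) in force)
    qed
    have "compatible_family I (\<lambda>i. und (d i)) E (\<lambda>i. act (d i) r (a i))"
      unfolding compatible_family_def
    proof (intro conjI ballI)
      show "act (d i) r (a i) \<in> und (d i)" if "i \<in> I" for i
        using act_closed[OF ms(2)[OF that] t(2) a(1)[OF that]] .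
      fix e assume e: "e \<in> E"
      obtain i j f where ijf: "e = (i, j, f)" by (cases e)
      show "case e of (i, j, f) \<Rightarrow> f (act (d i) r (a i)) = act (d j) r (a j)"
        using mset_maps_act[OF E(3)[OF e[unfolded ijf]] t(2) a(1)[OF E(1)[OF e[unfolded ijf]]]]
            t(4)[OF e]
        by (simp add: ijf)
    qed
    then obtain z where z: "z \<in> und L" "\<And>i. i \<in> I \<Longrightarrow> l i z = act (d i) r (a i)"
      using elt unfolding elementwise_limit_def by blast
    show "\<exists>!z. z \<in> fobj F L \<and> (\<forall>i\<in>I. farr F L (d i) (l i) z = y i)"
    proof (rule ex1I[of _ "\<theta> L t z"])
      have "farr F L (d i) (l i) (\<theta> L t z) = y i" if i: "i \<in> I" for i
        using natural[OF L d[OF i] l[OF i] t(1) z(1)] balanced[OF d[OF i] t(1,2) a(1)[OF i]]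
            z(2)[OF i] a(2)[OF i] t(3)
        by simp
      then show *: "\<theta> L t z \<in> fobj F L \<and> (\<forall>i\<in>I. farr F L (d i) (l i) (\<theta> L t z) = y i)"
        using mem[OF L t(1) z(1)] by blast
      fix w assume w: "w \<in> fobj F L \<and> (\<forall>i\<in>I. farr F L (d i) (l i) w = y i)"
      then obtain s' x' where s': "s' \<in> frames A" "x' \<in> und L" "w = \<theta> L s' x'" using surj[OF L] by blast
      obtain h k k' where h: "h \<in> frames A" "k \<in> nsmat" "k' \<in> nsmat" "t = h ** ratm k"
          "s' = h ** ratm k'"
        using frames_directed[OF A t(1) s'(1)] by blast
      define x where "x = act L k z"
      define x'' where "x'' = act L k' x'"
      have x: "x \<in> und L" "x'' \<in> und L" using act_closed[OF ms(1)] h z s' by (auto simp: x_def x''_def)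
      have zx: "\<theta> L t z = \<theta> L h x" "w = \<theta> L h x''"
        using balanced[OF L h(1)] h z s' by (auto simp: x_def x''_def)
      have "\<theta> (d i) h (l i x) = \<theta> (d i) h (l i x'')" if i: "i \<in> I" for i
        using natural[OF L d[OF i] l[OF i] h(1) x(1)] natural[OF L d[OF i] l[OF i] h(1) x(2)] * w i
            zx by simp
      then obtain u v where u: "u \<in> frames A" "v \<in> nsmat" "h = u ** ratm v"
        "\<And>i. i \<in> I \<Longrightarrow> act (d i) v (l i x) = act (d i) v (l i x'')"
        using separate_finitely_many[OF fin(1) h(1), of d "\<lambda>i. l i x" "\<lambda>i. l i x''"] d
          mset_maps_mem[OF l x(1)] mset_maps_mem[OF l x(2)] by blast
      have vx: "act L v x \<in> und L" "act L v x'' \<in> und L" using act_closed[OF ms(1) u(2)] x by auto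
      have lv: "l i (act L v x) = l i (act L v x'')" if i: "i \<in> I" for i
        using mset_maps_act[OF l[OF i] u(2)] x u(4)[OF i] by simp
      have "compatible_family I (\<lambda>i. und (d i)) E (\<lambda>i. l i (act L v x))"
        unfolding compatible_family_def
      proof (intro conjI ballI)
        show "l i (act L v x) \<in> und (d i)" if "i \<in> I" for i using mset_maps_mem[OF l[OF that] vx(1)] .
        fix e assume e: "e \<in> E"
        obtain i j f where ijf: "e = (i, j, f)" by (cases e)
        have "compose (und L) f (l i) = l j" using cone e by (auto simp: ijf is_cone_def)
        then show "case e of (i, j, f) \<Rightarrow> f (l i (act L v x)) = l j (act L v x)"
          using vx(1) by (simp add: ijf) (metis compose_eq)
      qed
      then have "\<exists>!z. z \<in> und L \<and> (\<forall>i\<in>I. l i z = l i (act L v x))"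
        using elt unfolding elementwise_limit_def by blast
      then have "act L v x = act L v x''" using vx lv by metis
      then have "\<theta> L h x = \<theta> L h x''"
        using balanced[OF L u(1,2) x(1)] balanced[OF L u(1,2) x(2)] u(3) by simp
      then show "w = \<theta> L t z" using zx by simp
    qed
  qed
  with is_limit_set_catI[OF finite_diagram_image[OF is_functor dia] is_cone_image[OF is_functor dia
      cone]]
  show "is_limit (set_cat U) I (\<lambda>i. fobj F (d i)) ((\<lambda>(i, j, f). (i, j, farr F (d i) (d j) f)) ` E)
          (fobj F L) (\<lambda>i. farr F L (d i) (l i))" by (simp add: E'_def)
qed

end

text \<open>The right adjoint involves the set of all functions from frames to \<open>B\<close>. By an enumeration of the
  frames these are the sequences in \<open>B\<close>, for which the universe has codes.\<close>

definition seq_code :: "'u set set \<Rightarrow> 'u set \<Rightarrow> (nat \<Rightarrow> 'u) \<Rightarrow> 'u" where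
  "seq_code U B = (SOME e. inj_on e (UNIV \<rightarrow> B) \<and> e ` (UNIV \<rightarrow> B) \<in> U)"

definition seq_decode :: "'u set set \<Rightarrow> 'u set \<Rightarrow> 'u \<Rightarrow> nat \<Rightarrow> 'u" where
  "seq_decode U B = inv_into (UNIV \<rightarrow> B) (seq_code U B)"

lemma seq_code:
  assumes "set_universe U" "B \<in> U"
  shows "inj_on (seq_code U B) (UNIV \<rightarrow> B)" "seq_code U B ` (UNIV \<rightarrow> B) \<in> U"
proof -
  have "\<exists>e :: (nat \<Rightarrow> 'a) \<Rightarrow> 'a. inj_on e (UNIV \<rightarrow> B) \<and> e ` (UNIV \<rightarrow> B) \<in> U"
    using assms unfolding set_universe_def by blast
  from someI_ex[OF this] show "inj_on (seq_code U B) (UNIV \<rightarrow> B)" "seq_code U B ` (UNIV \<rightarrow> B) \<in> U"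
    unfolding seq_code_def by auto
qed

lemma seq_decode_code:
  "set_universe U \<Longrightarrow> B \<in> U \<Longrightarrow> \<phi> \<in> UNIV \<rightarrow> B \<Longrightarrow> seq_decode U B (seq_code U B \<phi>) = \<phi>"
  unfolding seq_decode_def by (rule inv_into_f_f[OF seq_code(1)])

definition frame_index :: "(rat^2) set \<Rightarrow> rat^2^2 \<Rightarrow> nat" where
  "frame_index A = to_nat_on (frames A)"

definition nth_frame :: "(rat^2) set \<Rightarrow> nat \<Rightarrow> rat^2^2" where
  "nth_frame A = from_nat_into (frames A)"

lemma infinite_frames:
  assumes A: "A \<in> intermediate_groups"
  shows "infinite (frames A)"
proof
  assume fin: "finite (frames A)"
  have "mat (int (Suc k)) \<in> nsmat" for k by (simp add: nsmat_def det_2 mat_def)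
  then have "ratm (mat (int (Suc k))) \<in> frames A" for k
    using frames_mult[OF A frames_one[OF A]] by (metis matrix_mul_lid)
  then have "range (\<lambda>k. ratm (mat (int (Suc k)))) \<subseteq> frames A" by blast
  then have "finite (range (\<lambda>k. ratm (mat (int (Suc k)))))" using fin by (rule finite_subset)
  moreover have "inj (\<lambda>k. ratm (mat (int (Suc k))))"
    by (rule injI) (auto simp: vec_eq_iff forall_2 mat_def)
  ultimately show False using finite_imageD by blast
qed

lemma frame_index_nth_frame:
  assumes A: "A \<in> intermediate_groups"
  shows "nth_frame A k \<in> frames A" "frame_index A (nth_frame A k) = k"
    "s \<in> frames A \<Longrightarrow> nth_frame A (frame_index A s) = s"
  using infinite_frames[OF A] unfolding frame_index_def nth_frame_def
  by (auto intro: from_nat_into to_nat_on_from_nat_into_infinite dest: infinite_imp_nonempty)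

text \<open>The right adjoint sends \<open>B\<close> to the set of functions from frames to \<open>B\<close>, on which \<open>m\<close> acts by
  \<open>(m \<phi>)(s) = \<phi>(s m)\<close>.\<close>

definition coinduced :: "'u set set \<Rightarrow> (rat^2) set \<Rightarrow> 'u set \<Rightarrow> 'u mset" where
  "coinduced U A B = \<lparr>und = seq_code U B ` (UNIV \<rightarrow> B),
     act = (\<lambda>a z. seq_code U B (\<lambda>k. seq_decode U B z (frame_index A (nth_frame A k ** ratm a))))\<rparr>"

definition coinduced_functor :: "'u set set \<Rightarrow> (rat^2) set \<Rightarrow> ('u set, 'u \<Rightarrow> 'u, 'u mset,
    'u \<Rightarrow> 'u) fctr" where
  "coinduced_functor U A = \<lparr>fobj = coinduced U A,
     farr = (\<lambda>B B' g. \<lambda>z\<in>und (coinduced U A B). seq_code U B' (\<lambda>k. g (seq_decode U B z k)))\<rparr>"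

context
  fixes U :: "'u set set" and A assumes U: "set_universe U" and A: "A \<in> intermediate_groups"
begin

lemma coinduced_und: "und (coinduced U A B) = seq_code U B ` (UNIV \<rightarrow> B)"
  by (simp add: coinduced_def)

lemma coinduced_act:
  assumes "B \<in> U" "\<phi> \<in> UNIV \<rightarrow> B"
  shows "act (coinduced U A B) a (seq_code U B \<phi>)
    = seq_code U B (\<lambda>k. \<phi> (frame_index A (nth_frame A k ** ratm a)))"
  using seq_decode_code[OF U assms] by (simp add: coinduced_def)

lemma coinduced_obj:
  assumes B: "B \<in> U"
  shows "coinduced U A B \<in> obj (mset_cat U)"
proof -
  note fi = frame_index_nth_frame[OF A]
  have shift: "(\<lambda>k. \<phi> (h k)) \<in> UNIV \<rightarrow> B" if "\<phi> \<in> UNIV \<rightarrow> B" for \<phi> and h :: "nat \<Rightarrow> nat"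
    using that by auto
  have "is_mset (coinduced U A B)"
    unfolding is_mset_def coinduced_und
  proof (intro conjI ballI)
    fix a n assume "a \<in> nsmat" "n \<in> seq_code U B ` (UNIV \<rightarrow> B)"
    then obtain \<phi> where \<phi>: "\<phi> \<in> UNIV \<rightarrow> B" "n = seq_code U B \<phi>" by blast
    show "act (coinduced U A B) a n \<in> seq_code U B ` (UNIV \<rightarrow> B)"
      unfolding \<phi>(2) coinduced_act[OF B \<phi>(1)] by (rule imageI[OF shift[OF \<phi>(1)]])
  next
    fix n assume "n \<in> seq_code U B ` (UNIV \<rightarrow> B)"
    moreover have "ratm (mat 1) = mat 1" by (simp add: ratm_mat)
    ultimately show "act (coinduced U A B) (mat 1) n = n"
      by (auto simp: coinduced_act[OF B] fi)
  next
    fix a b n assume ab: "a \<in> nsmat" "b \<in> nsmat" and "n \<in> seq_code U B ` (UNIV \<rightarrow> B)"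
    then obtain \<phi> where \<phi>: "\<phi> \<in> UNIV \<rightarrow> B" "n = seq_code U B \<phi>" by blast
    have "nth_frame A (frame_index A (nth_frame A k ** ratm a)) = nth_frame A k ** ratm a" for k
      by (intro fi(3) frames_mult[OF A] fi(1) ab)
    then show "act (coinduced U A B) (a ** b) n = act (coinduced U A B) a (act (coinduced U A B) b n)"
      by (simp add: \<phi>(2) coinduced_act[OF B \<phi>(1)] coinduced_act[OF B shift[OF \<phi>(1)]] ratm_mult
          matrix_mul_assoc)
  qed
  then show ?thesis using seq_code(2)[OF U B] by (simp add: coinduced_und)
qed

lemma coinduced_functor_arr:
  assumes "B \<in> U" "\<phi> \<in> UNIV \<rightarrow> B"
  shows "farr (coinduced_functor U A) B B' g (seq_code U B \<phi>) = seq_code U B' (\<lambda>k. g (\<phi> k))"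
  using assms(2) seq_decode_code[OF U assms] by (simp add: coinduced_functor_def coinduced_und)

lemma coinduced_is_functor: "is_functor (set_cat U) (mset_cat U) (coinduced_functor U A)"
  unfolding is_functor_def
proof (intro conjI ballI)
  note arr = coinduced_functor_arr
  have ob [simp]: "fobj (coinduced_functor U A) B = coinduced U A B" for B
      by (simp add: coinduced_functor_def)
  have ext: "farr (coinduced_functor U A) B B' g \<in> extensional (und (coinduced U A B))" for B B' g
    by (simp add: coinduced_functor_def)
  fix B assume "B \<in> obj (set_cat U)"
  then have B: "B \<in> U" by simp
  show "fobj (coinduced_functor U A) B \<in> obj (mset_cat U)" using coinduced_obj[OF B] by simp
  show "farr (coinduced_functor U A) B B (cid (set_cat U) B) = cid (mset_cat U) (fobj
      (coinduced_functor U A) B)"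
  proof (rule extensionalityI[OF ext])
    fix z assume "z \<in> und (coinduced U A B)"
    then obtain \<phi> where "\<phi> \<in> UNIV \<rightarrow> B" "z = seq_code U B \<phi>" by (auto simp: coinduced_und)
    then show "farr (coinduced_functor U A) B B (cid (set_cat U) B) z = cid (mset_cat U) (fobj
        (coinduced_functor U A) B) z"
      by (simp add: arr[OF B] coinduced_und Pi_iff)
  qed simp
  fix B' assume "B' \<in> obj (set_cat U)"
  then have B': "B' \<in> U" by simp
  fix g assume "g \<in> arr (set_cat U) B B'"
  then have g: "g \<in> B \<rightarrow>\<^sub>E B'" by simp
  show "farr (coinduced_functor U A) B B' g
      \<in> arr (mset_cat U) (fobj (coinduced_functor U A) B) (fobj (coinduced_functor U A) B')"
    unfolding mset_cat_simps mset_maps_def ob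
  proof (intro CollectI conjI ballI)
    have img: "(\<lambda>k. g (\<phi> k)) \<in> UNIV \<rightarrow> B'" if "\<phi> \<in> UNIV \<rightarrow> B" for \<phi> :: "nat \<Rightarrow> 'u" using that g by auto
    show "farr (coinduced_functor U A) B B' g \<in> und (coinduced U A B) \<rightarrow>\<^sub>E und (coinduced U A B')"
      using ext img by (auto simp: PiE_iff coinduced_und arr[OF B])
    fix a n assume a: "a \<in> nsmat" and "n \<in> und (coinduced U A B)"
    then obtain \<phi> where \<phi>: "\<phi> \<in> UNIV \<rightarrow> B" "n = seq_code U B \<phi>" by (auto simp: coinduced_und)
    have "(\<lambda>k. \<phi> (frame_index A (nth_frame A k ** ratm a))) \<in> UNIV \<rightarrow> B" using \<phi>(1) by auto
    then show "farr (coinduced_functor U A) B B' g (act (coinduced U A B) a n)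
        = act (coinduced U A B') a (farr (coinduced_functor U A) B B' g n)"
      by (simp add: \<phi>(2) coinduced_act[OF B \<phi>(1)] coinduced_act[OF B' img[OF \<phi>(1)]] arr[OF B \<phi>(1)]
          arr[OF B])
  qed
  fix B'' assume "B'' \<in> obj (set_cat U)"
  then have B'': "B'' \<in> U" by simp
  fix k assume k: "k \<in> arr (set_cat U) B' B''"
  show "farr (coinduced_functor U A) B B'' (ccomp (set_cat U) B B' B'' k g) =
      ccomp (mset_cat U) (fobj (coinduced_functor U A) B) (fobj (coinduced_functor U A) B')
        (fobj (coinduced_functor U A) B'') (farr (coinduced_functor U A) B' B'' k)
        (farr (coinduced_functor U A) B B' g)"
    unfolding mset_cat_simps set_cat_simps ob
  proof (rule extensionalityI[OF ext])
    fix z assume z: "z \<in> und (coinduced U A B)"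
    then obtain \<phi> where \<phi>: "\<phi> \<in> UNIV \<rightarrow> B" "z = seq_code U B \<phi>" by (auto simp: coinduced_und)
    have "(\<lambda>k. g (\<phi> k)) \<in> UNIV \<rightarrow> B'" using \<phi>(1) g by auto
    then show "farr (coinduced_functor U A) B B'' (compose B k g) z =
        compose (und (coinduced U A B)) (farr (coinduced_functor U A) B' B'' k) (farr
            (coinduced_functor U A) B B' g) z"
      using z \<phi>(1) by (simp add: compose_eq \<phi>(2) arr[OF B] arr[OF B'] Pi_iff)
  qed simp
qed

end

context presentation
begin

definition transpose :: "'u mset \<Rightarrow> 'u set \<Rightarrow> ('u \<Rightarrow> 'u) \<Rightarrow> 'u \<Rightarrow> 'u" where
  "transpose N B g = (\<lambda>n\<in>und N. seq_code U B (\<lambda>k. g (\<theta> N (nth_frame A k) n)))"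

lemma transpose_seq:
  assumes N: "N \<in> obj (mset_cat U)" and g: "g \<in> fobj F N \<rightarrow>\<^sub>E B" and n: "n \<in> und N"
  shows "(\<lambda>k. g (\<theta> N (nth_frame A k) n)) \<in> UNIV \<rightarrow> B"
  using mem[OF N frame_index_nth_frame(1)[OF A] n] g by auto

lemma transpose_arr:
  assumes N: "N \<in> obj (mset_cat U)" and B: "B \<in> U" and g: "g \<in> fobj F N \<rightarrow>\<^sub>E B"
  shows "transpose N B g \<in> mset_maps N (coinduced U A B)"
  unfolding mset_maps_def
proof (intro CollectI conjI ballI)
  have ms: "is_mset N" using N by simp
  note fi = frame_index_nth_frame[OF A]
  show "transpose N B g \<in> und N \<rightarrow>\<^sub>E und (coinduced U A B)"
    using transpose_seq[OF N g] by (auto simp: transpose_def coinduced_und[OF U A])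
  fix a n assume a: "a \<in> nsmat" and n: "n \<in> und N"
  have "nth_frame A (frame_index A (nth_frame A k ** ratm a)) = nth_frame A k ** ratm a" for k
    by (intro fi(3) frames_mult[OF A] fi(1) a)
  then show "transpose N B g (act N a n) = act (coinduced U A B) a (transpose N B g n)"
    using act_closed[OF ms a n] n
    by (simp add: transpose_def coinduced_act[OF U A B transpose_seq[OF N g n]] balanced[OF N fi(1) a n])
qed

lemma transpose_inj:
  assumes N: "N \<in> obj (mset_cat U)" and B: "B \<in> U"
  shows "inj_on (transpose N B) (fobj F N \<rightarrow>\<^sub>E B)"
proof (rule inj_onI)
  note fi = frame_index_nth_frame[OF A]
  fix g h assume g: "g \<in> fobj F N \<rightarrow>\<^sub>E B" and h: "h \<in> fobj F N \<rightarrow>\<^sub>E B"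
    and eq: "transpose N B g = transpose N B h"
  show "g = h"
  proof (rule PiE_ext[OF g h])
    fix z assume "z \<in> fobj F N"
    then obtain s n where z: "s \<in> frames A" "n \<in> und N" "z = \<theta> N s n" using surj[OF N] by blast
    have "transpose N B g n = transpose N B h n" by (simp add: eq)
    then have "seq_code U B (\<lambda>k. g (\<theta> N (nth_frame A k) n)) = seq_code U B (\<lambda>k.
        h (\<theta> N (nth_frame A k) n))"
      using z(2) by (simp add: transpose_def)
    then have "(\<lambda>k. g (\<theta> N (nth_frame A k) n)) = (\<lambda>k. h (\<theta> N (nth_frame A k) n))"
      using seq_code(1)[OF U B] transpose_seq[OF N g z(2)] transpose_seq[OF N h z(2)]
          by (auto dest: inj_onD)
    then have "g (\<theta> N (nth_frame A (frame_index A s)) n) = h (\<theta> N (nth_frame A (frame_index A s)) n)"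
      by (rule fun_cong)
    then show "g z = h z" using fi(3)[OF z(1)] z(3) by simp
  qed
qed

text \<open>A map \<open>\<kappa>\<close> to the coinduced set gives the function \<open>(s, n) \<mapsto> \<kappa>(n)(s)\<close>. It is balanced because \<open>\<kappa>\<close> is
  equivariant, and therefore descends to the tensor product.\<close>

lemma transpose_surj:
  assumes N: "N \<in> obj (mset_cat U)" and B: "B \<in> U" and \<kappa>: "\<kappa> \<in> mset_maps N (coinduced U A B)"
  shows "\<exists>g\<in>fobj F N \<rightarrow>\<^sub>E B. transpose N B g = \<kappa>"
proof -
  note fi = frame_index_nth_frame[OF A]
  have ms: "is_mset N" using N by simp
  define v where "v s n = seq_decode U B (\<kappa> n) (frame_index A s)" for s n
  have code: "\<exists>\<phi>. \<phi> \<in> UNIV \<rightarrow> B \<and> \<kappa> n = seq_code U B \<phi>" if "n \<in> und N" for n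
    using mset_maps_mem[OF \<kappa> that] by (auto simp: coinduced_und[OF U A])
  have vB: "v s n \<in> B" if n: "n \<in> und N" for s n
    using code[OF n] seq_decode_code[OF U B] by (auto simp: v_def Pi_iff)
  have vbal: "v (s ** ratm m) n = v s (act N m n)" if s: "s \<in> frames A" and m: "m \<in> nsmat"
      and n: "n \<in> und N" for s m n
  proof -
    obtain \<phi> where \<phi>: "\<phi> \<in> UNIV \<rightarrow> B" "\<kappa> n = seq_code U B \<phi>" using code[OF n] by blast
    have sh: "(\<lambda>k. \<phi> (frame_index A (nth_frame A k ** ratm m))) \<in> UNIV \<rightarrow> B" using \<phi>(1) by auto
    have "\<kappa> (act N m n) = seq_code U B (\<lambda>k. \<phi> (frame_index A (nth_frame A k ** ratm m)))"
      using mset_maps_act[OF \<kappa> m n] by (simp add: \<phi> coinduced_act[OF U A B \<phi>(1)])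
    then show ?thesis
      by (simp add: v_def \<phi>(2) seq_decode_code[OF U B \<phi>(1)] seq_decode_code[OF U B sh] fi(3)[OF s])
  qed
  have vwell: "v s n = v s' n'" if sn: "s \<in> frames A" "s' \<in> frames A" "n \<in> und N" "n' \<in> und N"
    and eq: "\<theta> N s n = \<theta> N s' n'" for s s' n n'
  proof -
    obtain t m m' where t: "t \<in> frames A" "m \<in> nsmat" "m' \<in> nsmat" "s = t ** ratm m" "s' = t ** ratm m'"
      "act N m n = act N m' n'" using eq balanced_eq_iff[OF N sn] by blast
    then show ?thesis using vbal[OF t(1,2) sn(3)] vbal[OF t(1,3) sn(4)] by simp
  qed
  have "\<forall>z\<in>fobj F N. \<exists>s n. s \<in> frames A \<and> n \<in> und N \<and> z = \<theta> N s n" using surj[OF N] by blast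
  then obtain \<sigma> \<nu> where \<sigma>: "\<And>z. z \<in> fobj F N \<Longrightarrow> \<sigma> z \<in> frames A \<and> \<nu> z \<in> und N \<and> z = \<theta> N (\<sigma> z) (\<nu> z)"
    by metis
  define g where "g = (\<lambda>z\<in>fobj F N. v (\<sigma> z) (\<nu> z))"
  have g\<theta>: "g (\<theta> N s n) = v s n" if s: "s \<in> frames A" and n: "n \<in> und N" for s n
  proof -
    have z: "\<theta> N s n \<in> fobj F N" using mem[OF N s n] .
    have "v (\<sigma> (\<theta> N s n)) (\<nu> (\<theta> N s n)) = v s n"
      using \<sigma>[OF z] s n by (intro vwell) auto
    then show ?thesis using z by (simp add: g_def)
  qed
  have gB: "g \<in> fobj F N \<rightarrow>\<^sub>E B" using \<sigma> vB by (auto simp: g_def)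
  moreover have "transpose N B g = \<kappa>"
  proof (rule mset_maps_eqI[OF transpose_arr[OF N B gB] \<kappa>])
    fix n assume n: "n \<in> und N"
    obtain \<phi> where \<phi>: "\<phi> \<in> UNIV \<rightarrow> B" "\<kappa> n = seq_code U B \<phi>" using code[OF n] by blast
    have "v (nth_frame A k) n = \<phi> k" for k
      by (simp add: v_def \<phi>(2) seq_decode_code[OF U B \<phi>(1)] fi(2))
    then show "transpose N B g n = \<kappa> n" using n by (simp add: transpose_def g\<theta> fi(1) \<phi>(2))
  qed
  ultimately show ?thesis by blast
qed

lemma adjunction: "is_adjunction (mset_cat U) (set_cat U) F (coinduced_functor U A)"
  unfolding is_adjunction_def
proof (intro exI[of _ transpose] conjI ballI)
  note fi = frame_index_nth_frame[OF A]
  have ob [simp]: "fobj (coinduced_functor U A) B = coinduced U A B" for B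
      by (simp add: coinduced_functor_def)
  fix N B assume N: "N \<in> obj (mset_cat U)" and "B \<in> obj (set_cat U)"
  then have B: "B \<in> U" by simp
  show "bij_betw (transpose N B) (arr (set_cat U) (fobj F N) B)
      (arr (mset_cat U) N (fobj (coinduced_functor U A) B))"
    unfolding set_cat_simps mset_cat_simps(2-) ob bij_betw_def
    using transpose_inj[OF N B] transpose_surj[OF N B] transpose_arr[OF N B] by blast
next
  note fi = frame_index_nth_frame[OF A]
  fix N N' B f g
  assume N: "N \<in> obj (mset_cat U)" and N': "N' \<in> obj (mset_cat U)" and "B \<in> obj (set_cat U)"
    and "f \<in> arr (mset_cat U) N' N" and "g \<in> arr (set_cat U) (fobj F N) B"
  then have f: "f \<in> mset_maps N' N" by simp
  have "transpose N' B (compose (fobj F N') g (farr F N' N f)) n = compose (und N') (transpose N B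
      g) f n" for n
  proof (cases "n \<in> und N'")
    case True
    have "compose (fobj F N') g (farr F N' N f) (\<theta> N' s n) = g (\<theta> N s (f n))" if s: "s \<in> frames A" for s
      using mem[OF N' s True] natural[OF N' N f s True] by (simp add: compose_eq)
    then show ?thesis using True mset_maps_mem[OF f True] by (simp add: transpose_def compose_eq fi(1))
  next
    case False
    then show ?thesis by (simp add: transpose_def compose_def)
  qed
  then show "transpose N' B (ccomp (set_cat U) (fobj F N') (fobj F N) B g (farr F N' N f))
      = ccomp (mset_cat U) N' N (fobj (coinduced_functor U A) B) (transpose N B g) f" by auto
next
  note fi = frame_index_nth_frame[OF A]
  fix N B B' g k
  assume N: "N \<in> obj (mset_cat U)" and "B \<in> obj (set_cat U)" and "B' \<in> obj (set_cat U)"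
    and "g \<in> arr (set_cat U) (fobj F N) B" and "k \<in> arr (set_cat U) B B'"
  then have B: "B \<in> U" and g: "g \<in> fobj F N \<rightarrow>\<^sub>E B" by simp_all
  have "transpose N B' (compose (fobj F N) k g) n
      = compose (und N) (farr (coinduced_functor U A) B B' k) (transpose N B g) n" for n
  proof (cases "n \<in> und N")
    case True
    have "compose (fobj F N) k g (\<theta> N s n) = k (g (\<theta> N s n))" if s: "s \<in> frames A" for s
      using mem[OF N s True] by (simp add: compose_eq)
    then show ?thesis
      using True coinduced_functor_arr[OF U A B transpose_seq[OF N g True]]
      by (simp add: transpose_def compose_eq fi(1))
  next
    case False
    then show ?thesis by (simp add: transpose_def compose_def)
  qed
  then show "transpose N B' (ccomp (set_cat U) (fobj F N) B B' k g)
      = ccomp (mset_cat U) N (fobj (coinduced_functor U A) B) (fobj (coinduced_functor U A) B')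
          (farr (coinduced_functor U A) B B' k) (transpose N B g)" by auto
qed

lemma presented_point: "F \<in> points U"
  unfolding points_def is_inverse_image_def
  using is_functor preserves_limits adjunction coinduced_is_functor[OF U A] by blast

end

lemma presentation_translate:
  assumes pres: "presentation U A F \<theta>" and g: "invertible g" and B: "B \<in> intermediate_groups"
      "B = (*v) g ` A"
  obtains \<theta>' where "presentation U B F \<theta>'"
proof -
  interpret presentation U A F \<theta> by (rule pres)
  obtain d where d: "invertible d" "g ** d = mat 1" "d ** g = mat 1" using g invertibleE by blast
  have fB: "s \<in> frames B \<longleftrightarrow> d ** s \<in> frames A" for s
  proof -
    have "s = g ** (d ** s)" by (simp add: matrix_mul_assoc d)
    then show ?thesis unfolding B(2) frames_image[OF g]
      by (metis (no_types, lifting) d(3) image_iff matrix_mul_assoc matrix_mul_lid)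
  qed
  have "presentation U B F (\<lambda>N s. \<theta> N (d ** s))"
  proof
    fix N z assume N: "N \<in> obj (mset_cat U)" and "z \<in> fobj F N"
    then obtain s n where "s \<in> frames A" "n \<in> und N" "z = \<theta> N s n" using surj by blast
    then show "\<exists>s\<in>frames B. \<exists>n\<in>und N. z = \<theta> N (d ** s) n"
      by (intro bexI[of _ "g ** s"] bexI[of _ n]) (auto simp: fB matrix_mul_assoc d)
  next
    fix N s n n' assume *: "N \<in> obj (mset_cat U)" "s \<in> frames B" "n \<in> und N" "n' \<in> und N"
      "\<theta> N (d ** s) n = \<theta> N (d ** s) n'"
    then obtain t m where t: "t \<in> frames A" "m \<in> nsmat" "d ** s = t ** ratm m" "act N m n = act N m n'"
      using separated[OF *(1) _ *(3,4), of "d ** s"] fB by blast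
    have "s = (g ** t) ** ratm m"
      using arg_cong[OF t(3), of "(**) g"] by (simp add: matrix_mul_assoc d)
    moreover have "g ** t \<in> frames B" using t(1) by (simp add: fB matrix_mul_assoc d)
    ultimately show "\<exists>t\<in>frames B. \<exists>m\<in>nsmat. s = t ** ratm m \<and> act N m n = act N m n'" using t by blast
  next
    fix N s m n assume "N \<in> obj (mset_cat U)" "s \<in> frames B" "m \<in> nsmat" "n \<in> und N"
    then show "\<theta> N (d ** (s ** ratm m)) n = \<theta> N (d ** s) (act N m n)"
      using balanced[of N "d ** s" m n] fB by (simp only: matrix_mul_assoc)
  next
    fix N s n assume "N \<in> obj (mset_cat U)" "s \<in> frames B" "n \<in> und N"
    then show "\<theta> N (d ** s) n \<in> fobj F N" using mem fB by blast
  next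
    fix N N' f s n assume "N \<in> obj (mset_cat U)" "N' \<in> obj (mset_cat U)" "f \<in> mset_maps N N'"
        "s \<in> frames B" "n \<in> und N"
    then show "farr F N N' f (\<theta> N (d ** s) n) = \<theta> N' (d ** s) (f n)" using natural fB by blast
  qed (rule U B(1) is_functor)+
  then show ?thesis by (rule that)
qed

text \<open>Both functors are quotients of the same sets of pairs \<open>(s, n)\<close> by the same relation.\<close>

lemma presentation_isomorphic:
  assumes F: "presentation U A F \<theta>" and G: "presentation U A G \<theta>'"
  shows "naturally_isomorphic (mset_cat U) (set_cat U) F G"
proof -
  interpret F: presentation U A F \<theta> by (rule F)
  interpret G: presentation U A G \<theta>' by (rule G)
  define \<eta> where "\<eta> N = (\<lambda>z\<in>fobj F N. THE w. \<exists>s\<in>frames A. \<exists>n\<in>und N. z = \<theta> N s n \<and> w = \<theta>' N s n)" for N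
  have \<eta>: "\<eta> N (\<theta> N s n) = \<theta>' N s n" if N: "N \<in> obj (mset_cat U)" and s: "s \<in> frames A"
      and n: "n \<in> und N" for N s n
  proof -
    have "w = \<theta>' N s n" if w: "\<exists>s'\<in>frames A. \<exists>n'\<in>und N. \<theta> N s n = \<theta> N s' n' \<and> w = \<theta>' N s' n'" for w
    proof -
      obtain s' n' where *: "s' \<in> frames A" "n' \<in> und N" "\<theta> N s n = \<theta> N s' n'" "w = \<theta>' N s' n'"
          using w by blast
      then show ?thesis using F.balanced_eq_iff[OF N s *(1) n *(2)] G.balanced_eq_iff[OF N s *(1) n
          *(2)] by simp
    qed
    then have "(THE w. \<exists>s'\<in>frames A. \<exists>n'\<in>und N. \<theta> N s n = \<theta> N s' n' \<and> w = \<theta>' N s' n') = \<theta>' N s n"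
      using s n by (intro the_equality) auto
    then show ?thesis using F.mem[OF N s n] by (simp add: \<eta>_def)
  qed
  have iso: "is_iso_arr (set_cat U) (fobj F N) (fobj G N) (\<eta> N)" if N: "N \<in> obj (mset_cat U)" for N
  proof (rule is_iso_set_catI)
    have "\<eta> N z \<in> fobj G N" if z: "z \<in> fobj F N" for z
    proof -
      obtain s n where "s \<in> frames A" "n \<in> und N" "z = \<theta> N s n" using F.surj[OF N z] by blast
      then show ?thesis using \<eta>[OF N] G.mem[OF N] by simp
    qed
    then show ext: "\<eta> N \<in> fobj F N \<rightarrow>\<^sub>E fobj G N" by (auto simp: \<eta>_def)
    have "inj_on (\<eta> N) (fobj F N)"
    proof (rule inj_onI)
      fix z z' assume "z \<in> fobj F N" "z' \<in> fobj F N" and eq: "\<eta> N z = \<eta> N z'"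
      then obtain s n s' n' where *: "s \<in> frames A" "n \<in> und N" "z = \<theta> N s n"
        "s' \<in> frames A" "n' \<in> und N" "z' = \<theta> N s' n'" using F.surj[OF N] by meson
      then show "z = z'"
        using eq \<eta>[OF N] F.balanced_eq_iff[OF N *(1,4,2,5)] G.balanced_eq_iff[OF N *(1,4,2,5)] by simp
    qed
    moreover have "w \<in> \<eta> N ` fobj F N" if w: "w \<in> fobj G N" for w
    proof -
      obtain s n where *: "s \<in> frames A" "n \<in> und N" "w = \<theta>' N s n" using G.surj[OF N w] by blast
      then show ?thesis using \<eta>[OF N *(1,2)] F.mem[OF N *(1,2)] by (metis imageI)
    qed
    ultimately show "bij_betw (\<eta> N) (fobj F N) (fobj G N)" using ext by (auto simp: bij_betw_def)
  qed
  have "compose (fobj F N) (\<eta> N') (farr F N N' f) = compose (fobj F N) (farr G N N' f) (\<eta> N)"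
    if N: "N \<in> obj (mset_cat U)" and N': "N' \<in> obj (mset_cat U)" and f: "f \<in> mset_maps N N'" for N N' f
  proof (rule extensionalityI[of _ "fobj F N"])
    fix z assume z: "z \<in> fobj F N"
    obtain s n where *: "s \<in> frames A" "n \<in> und N" "z = \<theta> N s n" using F.surj[OF N z] by blast
    show "compose (fobj F N) (\<eta> N') (farr F N N' f) z = compose (fobj F N) (farr G N N' f) (\<eta> N) z"
      using z F.natural[OF N N' f *(1,2)] G.natural[OF N N' f *(1,2)] \<eta>[OF N *(1,2)]
        \<eta>[OF N' *(1) mset_maps_mem[OF f *(2)]] *(3) by (simp add: compose_eq)
  qed simp_all
  then show ?thesis
    using iso unfolding naturally_isomorphic_def set_cat_simps mset_cat_simps(2-)
        by (intro exI[of _ \<eta>]) blast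
qed

text \<open>The value at the monoid itself, with the right action of the monoid, recovers the set of frames:
  an isomorphism of functors is therefore left multiplication by a rational matrix.\<close>

lemma isomorphic_presentations:
  assumes F: "presentation U A F \<theta>" and G: "presentation U B G \<theta>'"
    and iso: "naturally_isomorphic (mset_cat U) (set_cat U) F G"
  shows "(A, B) \<in> group_iso"
proof -
  interpret F: presentation U A F \<theta> by (rule F)
  interpret G: presentation U B G \<theta>' by (rule G)
  define M where "M = free_mset U"
  define e where "e = generator U"
  have M: "M \<in> obj (mset_cat U)" using free_mset_obj[OF F.U] by (simp add: M_def)
  then have ms: "is_mset M" by simp
  have e: "e \<in> und M" using nsmat_one unfolding e_def M_def und_free_mset[OF F.U] by blast
  have act_e: "act M m e = enc U m" for m by (simp add: M_def e_def act_free_mset[OF F.U])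
  have code: "\<exists>m\<in>nsmat. n = act M m e" if "n \<in> und M" for n
  proof -
    have "n \<in> enc U ` nsmat" using that by (simp only: M_def und_free_mset[OF F.U])
    then show ?thesis by (auto simp: act_e)
  qed
  obtain \<eta> where \<eta>: "\<And>N. N \<in> obj (mset_cat U) \<Longrightarrow> is_iso_arr (set_cat U) (fobj F N) (fobj G N) (\<eta> N)"
    "\<And>N N' f. N \<in> obj (mset_cat U) \<Longrightarrow> N' \<in> obj (mset_cat U) \<Longrightarrow> f \<in> mset_maps N N' \<Longrightarrow>
      compose (fobj F N) (\<eta> N') (farr F N N' f) = compose (fobj F N) (farr G N N' f) (\<eta> N)"
    using iso unfolding naturally_isomorphic_def set_cat_simps mset_cat_simps(2-) by blast
  note \<eta>M = is_iso_set_catD[OF \<eta>(1)[OF M]]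
  have exG: "\<exists>s\<in>frames B. z = \<theta>' M s e" if z: "z \<in> fobj G M" for z
  proof -
    obtain s n where *: "s \<in> frames B" "n \<in> und M" "z = \<theta>' M s n" using G.surj[OF M z] by blast
    then obtain m where m: "m \<in> nsmat" "n = act M m e" using code by blast
    then have "z = \<theta>' M (s ** ratm m) e" using * G.balanced[OF M *(1) m(1) e] by simp
    then show ?thesis using frames_mult[OF G.A *(1) m(1)] by blast
  qed
  have exF: "\<exists>s\<in>frames A. z = \<theta> M s e" if z: "z \<in> fobj F M" for z
  proof -
    obtain s n where *: "s \<in> frames A" "n \<in> und M" "z = \<theta> M s n" using F.surj[OF M z] by blast
    then obtain m where m: "m \<in> nsmat" "n = act M m e" using code by blast
    then have "z = \<theta> M (s ** ratm m) e" using * F.balanced[OF M *(1) m(1) e] by simp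
    then show ?thesis using frames_mult[OF F.A *(1) m(1)] by blast
  qed
  \<comment> \<open>The classes \<open>s \<otimes> e\<close> of the generator \<open>e\<close> make the value at the monoid a copy of the set of frames.\<close>
  have injG: "s = s'" if s: "s \<in> frames B" "s' \<in> frames B" and eq: "\<theta>' M s e = \<theta>' M s' e" for s s'
  proof -
    obtain t m m' where t: "s = t ** ratm m" "s' = t ** ratm m'" "act M m e = act M m' e"
      using eq G.balanced_eq_iff[OF M s e e] by blast
    then have "m = m'" by (simp add: act_e enc_eq_iff[OF F.U])
    then show ?thesis by (simp add: t)
  qed
  have "\<forall>s\<in>frames A. \<exists>t. t \<in> frames B \<and> \<eta> M (\<theta> M s e) = \<theta>' M t e"
    using exG \<eta>M(1) F.mem[OF M _ e] by (meson PiE_mem)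
  then obtain h where h: "\<And>s. s \<in> frames A \<Longrightarrow> h s \<in> frames B \<and> \<eta> M (\<theta> M s e) = \<theta>' M (h s) e" by metis
  have equiv: "h (s ** ratm m) = h s ** ratm m" if s: "s \<in> frames A" and m: "m \<in> nsmat" for s m
  proof -
    define \<rho> where "\<rho> = orbit_map U M (act M m e)"
    have me: "act M m e \<in> und M" using ms m e by (rule act_closed)
    have \<rho>: "\<rho> \<in> mset_maps M M" unfolding \<rho>_def M_def by (rule orbit_map_arr[OF F.U]) (use ms me in
        \<open>simp_all add: M_def\<close>)
    have \<rho>e: "\<rho> e = act M m e"
      using act_one[OF ms me] orbit_map_enc[OF F.U nsmat_one] by (simp add: \<rho>_def e_def)
    have sm: "s ** ratm m \<in> frames A" and hsm: "h s ** ratm m \<in> frames B"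
      using frames_mult[OF F.A s m] frames_mult[OF G.A _ m] h[OF s] by auto
    have z: "\<theta> M s e \<in> fobj F M" using F.mem[OF M s e] .
    have hs: "h s \<in> frames B" using h[OF s] by blast
    have "\<theta>' M (h (s ** ratm m)) e = \<eta> M (\<theta> M (s ** ratm m) e)" using h[OF sm] by simp
    also have "\<theta> M (s ** ratm m) e = farr F M M \<rho> (\<theta> M s e)"
      using F.balanced[OF M s m e] F.natural[OF M M \<rho> s e] \<rho>e by simp
    also have "\<eta> M \<dots> = farr G M M \<rho> (\<eta> M (\<theta> M s e))"
      using fun_cong[OF \<eta>(2)[OF M M \<rho>], of "\<theta> M s e"] z by (simp add: compose_eq)
    also have "\<dots> = \<theta>' M (h s ** ratm m) e"
      using h[OF s] G.natural[OF M M \<rho> hs e] G.balanced[OF M hs m e] \<rho>e by simp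
    finally show ?thesis using injG h[OF sm] hsm by blast
  qed
  have one: "mat 1 \<in> frames A" by (rule frames_one[OF F.A])
  define g where "g = h (mat 1)"
  have gB: "g \<in> frames B" using h[OF one] by (simp add: g_def)
  have hg: "h s = g ** s" if s: "s \<in> frames A" for s
  proof -
    obtain q m m' where q: "q \<in> frames A" "m \<in> nsmat" "m' \<in> nsmat" "s = q ** ratm m"
        "mat 1 = q ** ratm m'"
      using frames_directed[OF F.A s one] by blast
    have "h s = h q ** ratm m" "g = h q ** ratm m'" using equiv[OF q(1)] q by (simp_all add: g_def)
    moreover have "ratm m' ** q = mat 1" using q(5) matrix_left_right_inverse by metis
    ultimately show ?thesis by (simp add: q(4) matrix_mul_assoc[symmetric]) (simp add: matrix_mul_assoc)
  qed
  have "(**) g ` frames A = frames B"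
  proof (intro equalityI subsetI)
    fix t assume "t \<in> (**) g ` frames A"
    then obtain s where s: "s \<in> frames A" "t = h s" using hg by auto
    then show "t \<in> frames B" using h by blast
  next
    fix t assume t: "t \<in> frames B"
    have "\<theta>' M t e \<in> fobj G M" using G.mem[OF M t e] .
    then obtain z where z: "z \<in> fobj F M" "\<eta> M z = \<theta>' M t e"
      using \<eta>M(2) unfolding bij_betw_def by (metis imageE)
    then obtain s where s: "s \<in> frames A" "z = \<theta> M s e" using exF by blast
    then have "h s = t" using injG h[OF s(1)] t z(2) by metis
    then show "t \<in> (**) g ` frames A" using hg[OF s(1)] s(1) by blast
  qed
  then have "B = (*v) g ` A" using frames_inject F.A G.A by blast
  then show ?thesis unfolding group_iso_iff using F.A G.A frames_invertible[OF gB] by blast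
qed

section \<open>Every point is presented by a group\<close>

text \<open>The three conditions (nonempty, directed, and free in the sense that different matrices move
  each element differently) say that \<open>P\<close> is flat. After the choice of an element \<open>p0\<close>, every \<open>p\<close> is
  written as \<open>p0 s\<close> with a unique invertible rational matrix \<open>s\<close>, and the matrices that occur are the
  frames of a group.\<close>

lemma flat_module_is_frames:
  fixes r :: "'p \<Rightarrow> int^2^2 \<Rightarrow> 'p"
  assumes ne: "p0 \<in> P"
    and closed: "\<And>p m. p \<in> P \<Longrightarrow> m \<in> nsmat \<Longrightarrow> r p m \<in> P"
    and one: "\<And>p. p \<in> P \<Longrightarrow> r p (mat 1) = p"
    and mult: "\<And>p a b. p \<in> P \<Longrightarrow> a \<in> nsmat \<Longrightarrow> b \<in> nsmat \<Longrightarrow> r (r p a) b = r p (a ** b)"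
    and dir: "\<And>p p'. p \<in> P \<Longrightarrow> p' \<in> P \<Longrightarrow> \<exists>q\<in>P. \<exists>m\<in>nsmat. \<exists>m'\<in>nsmat. p = r q m \<and> p' = r q m'"
    and free: "\<And>p m m'. p \<in> P \<Longrightarrow> m \<in> nsmat \<Longrightarrow> m' \<in> nsmat \<Longrightarrow> r p m = r p m' \<Longrightarrow> m = m'"
  obtains A \<pi> where "A \<in> intermediate_groups" "bij_betw \<pi> (frames A) P"
    "\<And>s m. s \<in> frames A \<Longrightarrow> m \<in> nsmat \<Longrightarrow> \<pi> (s ** ratm m) = r (\<pi> s) m"
proof -
  \<comment> \<open>\<open>\<rho> p s\<close> says that \<open>p = p0 s\<close>, computed over a common refinement of \<open>p\<close> and \<open>p0\<close>.\<close>
  define \<rho> where "\<rho> p s \<longleftrightarrow>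
    (\<exists>q\<in>P. \<exists>m\<in>nsmat. \<exists>m'\<in>nsmat. p0 = r q m \<and> p = r q m' \<and> ratm m ** s = ratm m')" for p s
  have common: "\<exists>q\<in>P. \<exists>a\<in>nsmat. \<exists>b\<in>nsmat. \<exists>b'\<in>nsmat. p0 = r q a \<and> p = r q b \<and> p' = r q b' \<and>
      ratm a ** s = ratm b \<and> ratm a ** s' = ratm b'" if \<rho>: "\<rho> p s" "\<rho> p' s'" for p s p' s'
  proof -
    obtain q1 m1 k1 where 1: "q1 \<in> P" "m1 \<in> nsmat" "k1 \<in> nsmat" "p0 = r q1 m1" "p = r q1 k1"
        "ratm m1 ** s = ratm k1"
      using \<rho>(1) unfolding \<rho>_def by blast
    obtain q2 m2 k2 where 2: "q2 \<in> P" "m2 \<in> nsmat" "k2 \<in> nsmat" "p0 = r q2 m2" "p' = r q2 k2"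
        "ratm m2 ** s' = ratm k2"
      using \<rho>(2) unfolding \<rho>_def by blast
    obtain q c d where q: "q \<in> P" "c \<in> nsmat" "d \<in> nsmat" "q1 = r q c" "q2 = r q d"
        using dir[OF 1(1) 2(1)] by blast
    have "r q (c ** m1) = r q (d ** m2)"
      using 1(4) 2(4) mult[OF q(1,2) 1(2)] mult[OF q(1,3) 2(2)] q(4,5) by simp
    then have cd: "c ** m1 = d ** m2" by (rule free[OF q(1) nsmat_mult[OF q(2) 1(2)]
        nsmat_mult[OF q(3) 2(2)]])
    have "p0 = r q (c ** m1)" "p = r q (c ** k1)" "p' = r q (d ** k2)"
      using 1(4,5) 2(5) mult[OF q(1,2) 1(2)] mult[OF q(1,2) 1(3)] mult[OF q(1,3) 2(3)] q(4,5) by simp_all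
    moreover have "ratm (c ** m1) ** s = ratm (c ** k1)"
      by (simp add: ratm_mult matrix_mul_assoc[symmetric] 1(6))
    moreover have "ratm (c ** m1) ** s' = ratm (d ** k2)"
      unfolding cd by (simp add: ratm_mult matrix_mul_assoc[symmetric] 2(6))
    ultimately show ?thesis
      using q(1) nsmat_mult[OF q(2) 1(2)] nsmat_mult[OF q(2) 1(3)] nsmat_mult[OF q(3) 2(3)] by blast
  qed
  have fun1: "p = p'" if "\<rho> p s" "\<rho> p' s" for p p' s
    using common[OF that] ratm_eq_iff by metis
  have fun2: "s = s'" if \<rho>: "\<rho> p s" "\<rho> p s'" for p s s'
  proof -
    obtain q a b b' where *: "q \<in> P" "a \<in> nsmat" "b \<in> nsmat" "b' \<in> nsmat" "p = r q b" "p = r q b'"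
      "ratm a ** s = ratm b" "ratm a ** s' = ratm b'" using common[OF \<rho>] by blast
    then have "b = b'" using free[OF *(1,3,4)] by simp
    then have "ratm a ** s = ratm a ** s'" using * by simp
    then show ?thesis using *(2) invertible_cancel_left[of "ratm a" s s'] by (simp add: invertible_ratm)
  qed
  have left_inv: "\<exists>h. invertible h \<and> ratm m ** h = mat 1 \<and> h ** ratm m = mat 1" if "m \<in> nsmat" for m
    using that invertibleE[of "ratm m"] invertible_ratm by metis
  have total: "\<exists>s. \<rho> p s" if p: "p \<in> P" for p
  proof -
    obtain q m m' where q: "q \<in> P" "m \<in> nsmat" "m' \<in> nsmat" "p0 = r q m" "p = r q m'"
        using dir[OF ne p] by blast
    obtain h where h: "ratm m ** h = mat 1" using left_inv[OF q(2)] by blast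
    have "ratm m ** (h ** ratm m') = ratm m'" by (simp add: matrix_mul_assoc h)
    then show ?thesis using q unfolding \<rho>_def by blast
  qed
  have in_P: "p \<in> P" if "\<rho> p s" for p s using that closed unfolding \<rho>_def by blast
  define S where "S = {s. \<exists>p. \<rho> p s}"
  have \<rho>_mult: "\<rho> (r p k) (s ** ratm k)" if \<rho>: "\<rho> p s" and k: "k \<in> nsmat" for p s k
  proof -
    obtain q m m' where q: "q \<in> P" "m \<in> nsmat" "m' \<in> nsmat" "p0 = r q m" "p = r q m'"
        "ratm m ** s = ratm m'"
      using \<rho> unfolding \<rho>_def by blast
    have "r p k = r q (m' ** k)" using mult[OF q(1,3) k] q(5) by simp
    moreover have "ratm m ** (s ** ratm k) = ratm (m' ** k)" by (simp add: matrix_mul_assoc q(6)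
        ratm_mult)
    ultimately show ?thesis using q nsmat_mult[OF q(3) k] unfolding \<rho>_def by blast
  qed
  have "\<exists>A\<in>intermediate_groups. frames A = S"
  proof (rule frames_of_flat)
    have "ratm (mat 1) ** mat 1 = ratm (mat 1)" by simp
    then have "\<rho> p0 (mat 1)" unfolding \<rho>_def using ne one[OF ne] nsmat_one by metis
    then show "mat 1 \<in> S" by (auto simp: S_def)
    show "invertible s" if "s \<in> S" for s
    proof -
      obtain m m' where m: "m \<in> nsmat" "m' \<in> nsmat" "ratm m ** s = ratm m'"
        using \<open>s \<in> S\<close> unfolding S_def \<rho>_def by blast
      then have "det (ratm m) * det s \<noteq> 0"
        using invertible_ratm[of m'] by (simp add: invertible_det_nz det_mul[symmetric])
      then show ?thesis by (simp add: invertible_det_nz)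
    qed
    show "s ** ratm m \<in> S" if "s \<in> S" "m \<in> nsmat" for s m using that \<rho>_mult unfolding S_def by blast
    show "\<exists>h\<in>S. \<exists>m\<in>nsmat. \<exists>m'\<in>nsmat. s = h ** ratm m \<and> t = h ** ratm m'" if "s \<in> S" "t \<in> S" for s t
    proof -
      obtain p p' where "\<rho> p s" "\<rho> p' t" using \<open>s \<in> S\<close> \<open>t \<in> S\<close> unfolding S_def by blast
      then obtain q a b b' where *: "q \<in> P" "a \<in> nsmat" "b \<in> nsmat" "b' \<in> nsmat" "p0 = r q a"
        "ratm a ** s = ratm b" "ratm a ** t = ratm b'" using common by blast
      obtain h where h: "ratm a ** h = mat 1" "h ** ratm a = mat 1" using left_inv[OF *(2)] by blast
      have "ratm a ** h = ratm (mat 1)" by (simp add: h ratm_mat)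
      then have "\<rho> q h" unfolding \<rho>_def using * nsmat_one one[OF *(1)] by metis
      moreover have "s = h ** ratm b" "t = h ** ratm b'"
        unfolding *(6,7)[symmetric] by (simp_all add: matrix_mul_assoc h)
      ultimately show ?thesis using *(3,4) unfolding S_def by blast
    qed
  qed
  then obtain A where A: "A \<in> intermediate_groups" "frames A = S" by blast
  define \<pi> where "\<pi> s = (THE p. \<rho> p s)" for s
  have \<pi>: "\<pi> s = p" if "\<rho> p s" for s p unfolding \<pi>_def by (rule the_equality) (use that fun1 in auto)
  have "bij_betw \<pi> (frames A) P"
    unfolding bij_betw_def A(2)
  proof
    show "inj_on \<pi> S" by (rule inj_onI) (use \<pi> fun2 in \<open>auto simp: S_def\<close>)
    show "\<pi> ` S = P"
    proof (intro equalityI subsetI)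
      fix p assume "p \<in> P"
      then obtain s where "\<rho> p s" using total by blast
      then show "p \<in> \<pi> ` S" using \<pi> unfolding S_def by (intro image_eqI[of _ _ s]) auto
    qed (use \<pi> in_P in \<open>auto simp: S_def\<close>)
  qed
  moreover have "\<pi> (s ** ratm m) = r (\<pi> s) m" if "s \<in> frames A" "m \<in> nsmat" for s m
    using that \<pi> \<rho>_mult unfolding A(2) S_def by auto
  ultimately show ?thesis using that A(1) by blast
qed

context
  fixes U :: "'u set set" and F :: "'u point"
  assumes U: "set_universe U" and point: "F \<in> points U"
begin

lemma point_functor: "is_functor (mset_cat U) (set_cat U) F"
  using point by (simp add: points_def is_inverse_image_def)

lemma point_limit:
  assumes "finite_diagram (mset_cat U) I d E" "is_cone (mset_cat U) I d E L l"
    "elementwise_limit I (\<lambda>i. und (d i)) E (und L) l"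
  shows "elementwise_limit I (\<lambda>i. fobj F (d i)) ((\<lambda>(i, j, f). (i, j, farr F (d i) (d j) f)) ` E)
    (fobj F L) (\<lambda>i. farr F L (d i) (l i))"
proof -
  have "is_limit (mset_cat U) I d E L l" by (rule is_limit_mset_catI[OF assms])
  then have "is_limit (set_cat U) I (\<lambda>i. fobj F (d i)) ((\<lambda>(i, j, f). (i, j, farr F (d i) (d j) f)) ` E)
    (fobj F L) (\<lambda>i. farr F L (d i) (l i))"
    using point assms(1) unfolding points_def is_inverse_image_def preserves_finite_limits_def by blast
  then show ?thesis by (rule is_limit_set_catD[OF U finite_diagram_image[OF point_functor assms(1)]])
qed

text \<open>The image of \<open>p\<close> under \<open>F\<close> of the equivariant map \<open>m \<mapsto> m n\<close> from the monoid to \<open>N\<close>. This is to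
  become the class of \<open>p \<otimes> n\<close>, where the monoid acts on its own value under \<open>F\<close> from the right.\<close>

definition point_elem :: "'u mset \<Rightarrow> 'u \<Rightarrow> 'u \<Rightarrow> 'u" where
  "point_elem N p n = farr F (free_mset U) N (orbit_map U N n) p"

lemma point_elem_mem:
  assumes N: "N \<in> obj (mset_cat U)" and p: "p \<in> fobj F (free_mset U)" and n: "n \<in> und N"
  shows "point_elem N p n \<in> fobj F N"
proof -
  have "orbit_map U N n \<in> mset_maps (free_mset U) N" using N n by (intro orbit_map_arr[OF U]) auto
  from functor_simps(2)[OF point_functor free_mset_obj[OF U] N this] p
  show ?thesis by (auto simp: point_elem_def)
qed

lemma point_elem_natural:
  assumes N: "N \<in> obj (mset_cat U)" "N' \<in> obj (mset_cat U)" and f: "f \<in> mset_maps N N'"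
    and p: "p \<in> fobj F (free_mset U)" and n: "n \<in> und N"
  shows "farr F N N' f (point_elem N p n) = point_elem N' p (f n)"
proof -
  have o: "orbit_map U N n \<in> mset_maps (free_mset U) N" using N n by (intro orbit_map_arr[OF U]) auto
  have ms: "is_mset N" using N by simp
  show ?thesis
    using functor_compose_eq[OF point_functor free_mset_obj[OF U] N o f p]
      compose_orbit_map[OF U ms n f] by (simp add: point_elem_def)
qed

text \<open>A functor with a right adjoint preserves jointly epimorphic families. The orbit maps are such a
  family; their images are compared with the whole by maps to a set with two elements.\<close>

lemma point_elem_surj:
  assumes N: "N \<in> obj (mset_cat U)" and z: "z \<in> fobj F N"
  shows "\<exists>p\<in>fobj F (free_mset U). \<exists>n\<in>und N. z = point_elem N p n"
proof (rule ccontr)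
  assume no: "\<not> ?thesis"
  define M where "M = free_mset U"
  have M: "M \<in> obj (mset_cat U)" using free_mset_obj[OF U] by (simp add: M_def)
  have ms: "is_mset N" using N by simp
  obtain G where "is_adjunction (mset_cat U) (set_cat U) F G"
    using point unfolding points_def is_inverse_image_def by blast
  then obtain \<Phi> where
    bij': "\<forall>N\<in>obj (mset_cat U). \<forall>B\<in>U. bij_betw (\<Phi> N B) (fobj F N \<rightarrow>\<^sub>E B) (mset_maps N (fobj G B))" and
    nat': "\<forall>N\<in>obj (mset_cat U). \<forall>N'\<in>obj (mset_cat U). \<forall>B\<in>U. \<forall>f\<in>mset_maps N' N.
      \<forall>g\<in>fobj F N \<rightarrow>\<^sub>E B. \<Phi> N' B (compose (fobj F N') g (farr F N' N f)) = compose (und N') (\<Phi> N B g) f"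
    unfolding is_adjunction_def set_cat_simps mset_cat_simps(2-) by (elim exE conjE) (rule that)
  note bij = bij'[rule_format] and nat = nat'[rule_format]
  define c where "c b = enc U (b :: bool)" for b
  define B where "B = range c"
  have B: "B \<in> U" using enc_image[OF U, of "UNIV :: bool set"] by (simp add: B_def c_def)
  define g where "g = (\<lambda>w\<in>fobj F N. c (w = z))"
  define g' where "g' = (\<lambda>w\<in>fobj F N. c False)"
  have gB: "g \<in> fobj F N \<rightarrow>\<^sub>E B" "g' \<in> fobj F N \<rightarrow>\<^sub>E B" by (auto simp: g_def g'_def B_def)
  have "\<Phi> N B g n = \<Phi> N B g' n" if n: "n \<in> und N" for n
  proof -
    define f where "f = orbit_map U N n"
    have f: "f \<in> mset_maps M N" using orbit_map_arr[OF U ms n] by (simp add: f_def M_def)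
    have "compose (fobj F M) g (farr F M N f) = compose (fobj F M) g' (farr F M N f)"
    proof (rule extensionalityI[of _ "fobj F M"])
      fix p assume p: "p \<in> fobj F M"
      have "farr F M N f p = point_elem N p n" by (simp add: point_elem_def f_def M_def)
      moreover have "point_elem N p n \<in> fobj F N" "point_elem N p n \<noteq> z"
        using point_elem_mem[OF N _ n] no n p by (auto simp: M_def)
      ultimately show "compose (fobj F M) g (farr F M N f) p = compose (fobj F M) g' (farr F M N f) p"
        using p by (simp add: compose_eq g_def g'_def)
    qed simp_all
    then have "compose (und M) (\<Phi> N B g) f = compose (und M) (\<Phi> N B g') f"
      using nat[OF N M B f gB(1)] nat[OF N M B f gB(2)] by simp
    moreover have "generator U \<in> und M" "f (generator U) = n"
      using nsmat_one orbit_map_enc[OF U nsmat_one] act_one[OF ms n]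
      by (auto simp: M_def f_def und_free_mset[OF U])
    ultimately show ?thesis by (metis compose_eq)
  qed
  moreover have "\<Phi> N B g \<in> mset_maps N (fobj G B)" "\<Phi> N B g' \<in> mset_maps N (fobj G B)"
    using bij[OF N B] gB unfolding bij_betw_def by blast+
  ultimately have "\<Phi> N B g = \<Phi> N B g'" by (metis mset_maps_eqI)
  then have "g = g'" using bij[OF N B] gB unfolding bij_betw_def inj_on_def by blast
  then have "g z = g' z" by simp
  then show False using z by (simp add: g_def g'_def c_def enc_eq_iff[OF U])
qed

text \<open>Elements of \<open>F(N)\<close> that come from two orbit maps agree only for the obvious reason, since \<open>F\<close>
  preserves the pullback of these maps and the elements of the image of the pullback come from
  orbit maps again.\<close>

lemma point_elem_pullback:
  assumes N: "N \<in> obj (mset_cat U)" and p: "p \<in> fobj F (free_mset U)" "p' \<in> fobj F (free_mset U)"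
    and n: "n \<in> und N" "n' \<in> und N" and eq: "point_elem N p n = point_elem N p' n'"
  shows "\<exists>q\<in>fobj F (free_mset U). \<exists>m\<in>nsmat. \<exists>m'\<in>nsmat.
    p = point_elem (free_mset U) q (enc U m) \<and> p' = point_elem (free_mset U) q (enc U m') \<and>
    act N m n = act N m' n'"
proof -
  define M where "M = free_mset U"
  have M: "M \<in> obj (mset_cat U)" using free_mset_obj[OF U] by (simp add: M_def)
  have ms: "is_mset N" "is_mset M" using N M by auto
  have uM: "und M = enc U ` nsmat" by (simp add: M_def und_free_mset[OF U])
  have aM: "act M a (enc U m) = enc U (a ** m)" for a and m :: "int^2^2"
      by (simp add: M_def act_free_mset[OF U])
  have om: "orbit_map U N x (enc U m) = act N m x" if "m \<in> nsmat" for x m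
    by (rule orbit_map_enc[OF U that])
  define X where "X = {(m, m'). m \<in> nsmat \<and> m' \<in> nsmat \<and> act N m n = act N m' n'}"
  define \<alpha> where "\<alpha> a x = (a ** fst x, a ** snd x)" for a :: "int^2^2" and x :: "(int^2^2) \<times> (int^2^2)"
  define L where "L = coded U X \<alpha>"
  have L: "L \<in> obj (mset_cat U)" unfolding L_def
  proof (rule coded_obj[OF U])
    show "\<alpha> a x \<in> X" if "a \<in> nsmat" "x \<in> X" for a x
      using that n act_mult[OF ms(1)] by (auto simp: X_def \<alpha>_def nsmat_mult)
  qed (simp_all add: \<alpha>_def matrix_mul_assoc)
  have uL: "und L = enc U ` X" by (simp add: L_def und_coded[OF U])
  have aL: "act L a (enc U x) = enc U (\<alpha> a x)" for a x by (simp add: L_def act_coded[OF U])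
  define l :: "nat \<Rightarrow> 'u \<Rightarrow> 'u" where "l i = (\<lambda>z\<in>und L. let x = inv_into UNIV (enc U) z :: (int^2^2) \<times>
      (int^2^2) in
    if i = 2 then act N (fst x) n else if i = 0 then enc U (fst x) else enc U (snd x))" for i
  have l: "l 2 (enc U x) = act N (fst x) n" "l 0 (enc U x) = enc U (fst x)"
      "l (Suc 0) (enc U x) = enc U (snd x)"
    if "x \<in> X" for x using that by (simp_all add: l_def uL inv_enc[OF U] Let_def)
  have le: "l i \<in> extensional (und L)" for i by (simp add: l_def)
  define d :: "nat \<Rightarrow> 'u mset" where "d i = (if i = 2 then N else M)" for i
  define I :: "nat set" where "I = {0, Suc 0, 2}"
  define E where "E = {(0 :: nat, 2 :: nat, orbit_map U N n), (Suc 0, 2, orbit_map U N n')}"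
  have d: "d 2 = N" "d 0 = M" "d (Suc 0) = M" by (simp_all add: d_def)
  have oarr: "orbit_map U N n \<in> mset_maps M N" "orbit_map U N n' \<in> mset_maps M N"
    using orbit_map_arr[OF U ms(1)] n by (simp_all add: M_def)
  have larr: "l i \<in> mset_maps L (d i)" if "i \<in> I" for i
  proof -
    have "l 0 \<in> mset_maps L M" "l (Suc 0) \<in> mset_maps L M" "l 2 \<in> mset_maps L N"
      unfolding mset_maps_def PiE_iff
      using le n act_closed[OF ms(1)] act_mult[OF ms(1)]
      by (auto simp: uL uM l aL aM X_def \<alpha>_def nsmat_mult)
    then show ?thesis using that by (auto simp: I_def d_def)
  qed
  have dia: "finite_diagram (mset_cat U) I d E"
    using N M oarr by (auto simp: finite_diagram_def I_def E_def d_def simp del: mset_cat_simps(1))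
  have cone: "is_cone (mset_cat U) I d E L l"
    unfolding is_cone_def
  proof (intro conjI ballI)
    fix e assume e: "e \<in> E"
    have "compose (und L) (orbit_map U N n) (l 0) = l 2" "compose (und L) (orbit_map U N n') (l (Suc
        0)) = l 2"
      by (rule extensionalityI[of _ "und L"]; use le in \<open>auto simp: compose_eq uL l X_def om\<close>)+
    then show "case e of (i, j, f) \<Rightarrow> ccomp (mset_cat U) L (d i) (d j) f (l i) = l j"
      using e by (auto simp: E_def)
  qed (use L larr in auto)
  have elt: "elementwise_limit I (\<lambda>i. und (d i)) E (und L) l"
    unfolding elementwise_limit_def
  proof (intro allI impI)
    fix y assume y: "compatible_family I (\<lambda>i. und (d i)) E y"
    then obtain m m' where m: "m \<in> nsmat" "m' \<in> nsmat" "y 0 = enc U m" "y (Suc 0) = enc U m'"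
      by (auto simp: compatible_family_def I_def d uM)
    then have y2: "y 2 = act N m n" "y 2 = act N m' n'"
      using y om by (auto simp: compatible_family_def E_def)
    then have x: "(m, m') \<in> X" using m by (simp add: X_def)
    show "\<exists>!z. z \<in> und L \<and> (\<forall>i\<in>I. l i z = y i)"
    proof (rule ex1I[of _ "enc U (m, m')"])
      show "enc U (m, m') \<in> und L \<and> (\<forall>i\<in>I. l i (enc U (m, m')) = y i)"
        using x m y2 l[OF x] by (auto simp: uL I_def)
      fix z assume "z \<in> und L \<and> (\<forall>i\<in>I. l i z = y i)"
      then obtain x' where x': "x' \<in> X" "z = enc U x'" "l 0 z = y 0" "l (Suc 0) z = y (Suc 0)"
        by (auto simp: uL I_def)
      then have "enc U (fst x') = enc U m" "enc U (snd x') = enc U m'" using l m by auto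
      then show "z = enc U (m, m')" using x'(2) by (cases x') (simp add: enc_eq_iff[OF U])
    qed
  qed
  define y where "y i = (if i = (2 :: nat) then point_elem N p n else if i = 0 then p else p')" for i
  have "compatible_family I (\<lambda>i. fobj F (d i)) ((\<lambda>(i, j, f). (i, j, farr F (d i) (d j) f)) ` E) y"
    using p n eq point_elem_mem[OF N p(1) n(1)]
    by (auto simp: compatible_family_def I_def E_def d y_def M_def) (simp_all add: point_elem_def)
  then have "\<exists>!z. z \<in> fobj F L \<and> (\<forall>i\<in>I. farr F L (d i) (l i) z = y i)"
    using point_limit[OF dia cone elt] unfolding elementwise_limit_def by blast
  then obtain w where w: "w \<in> fobj F L" "farr F L M (l 0) w = p" "farr F L M (l (Suc 0)) w = p'"
    by (auto simp: I_def d y_def)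
  obtain q x where q: "q \<in> fobj F M" "x \<in> und L" "w = point_elem L q x"
    using point_elem_surj[OF L w(1)] by (auto simp: M_def)
  obtain m m' where m: "(m, m') \<in> X" "x = enc U (m, m')" using q(2) by (auto simp: uL)
  have "l 0 \<in> mset_maps L M" "l (Suc 0) \<in> mset_maps L M" using larr[of 0] larr[of "Suc 0"]
      by (simp_all add: I_def d)
  from point_elem_natural[OF L M this(1) _ q(2)] point_elem_natural[OF L M this(2) _ q(2)]
  have "p = point_elem M q (enc U m)" "p' = point_elem M q (enc U m')"
    using w q l[OF m(1)] by (auto simp: m(2) M_def)
  then show ?thesis using q(1) m(1) unfolding M_def X_def by blast
qed

text \<open>The value \<open>P\<close> at the monoid is a flat right module, and \<open>F\<close> is the tensor product with it, by the
  two preceding lemmas. Flatness follows from the preservation of the terminal object and of an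
  equalizer.\<close>

lemma point_presentation: "\<exists>A \<theta>. presentation U A F \<theta>"
proof -
  define M where "M = free_mset U"
  have M: "M \<in> obj (mset_cat U)" using free_mset_obj[OF U] by (simp add: M_def)
  then have ms: "is_mset M" by simp
  have uM: "und M = enc U ` nsmat" by (simp add: M_def und_free_mset[OF U])
  have aM: "act M a (enc U m) = enc U (a ** m)" for a and m :: "int^2^2"
      by (simp add: M_def act_free_mset[OF U])
  have om: "orbit_map U N x (enc U m) = act N m x" if "m \<in> nsmat" for N x m
    by (rule orbit_map_enc[OF U that])
  define P where "P = fobj F M"
  define r where "r p m = point_elem M p (enc U m)" for p and m :: "int^2^2"
  have eM: "enc U m \<in> und M" if "m \<in> nsmat" for m :: "int^2^2" using that by (simp add: uM)
  have act: "point_elem N (r p m) n = point_elem N p (act N m n)"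
    if N: "N \<in> obj (mset_cat U)" and p: "p \<in> P" and m: "m \<in> nsmat" and n: "n \<in> und N" for N p m n
  proof -
    have "is_mset N" using N by simp
    then have "orbit_map U N n \<in> mset_maps M N" using orbit_map_arr[OF U _ n] by (simp add: M_def)
    from point_elem_natural[OF M N this _ eM[OF m]] p
    show ?thesis by (simp add: om[OF m] P_def M_def r_def point_elem_def[of N "point_elem _ _ _"])
  qed
  have closed: "r p m \<in> P" if "p \<in> P" "m \<in> nsmat" for p m
    using point_elem_mem[OF M _ eM] that by (simp add: r_def P_def M_def)
  have one: "r p (mat 1) = p" if p: "p \<in> P" for p
  proof -
    have "orbit_map U M (generator U) = (\<lambda>x\<in>und M. x)"
    proof (rule extensionalityI[of _ "und M"])
      fix z assume "z \<in> und M"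
      then obtain m where "m \<in> nsmat" "z = enc U m" by (auto simp: uM)
      then show "orbit_map U M (generator U) z = (\<lambda>x\<in>und M. x) z" by (simp add: om aM uM)
    qed (simp_all add: orbit_map_def M_def)
    then show ?thesis using functor_simps(3)[OF point_functor M] p
      by (simp add: r_def point_elem_def P_def M_def)
  qed
  have mult: "r (r p a) b = r p (a ** b)" if "p \<in> P" "a \<in> nsmat" "b \<in> nsmat" for p a b
    using act[OF M that(1,2) eM[OF that(3)]] by (simp add: r_def aM)
  \<comment> \<open>The terminal object gives nonemptiness and directedness.\<close>
  define T where "T = coded U {()} (\<lambda>a x. x)"
  have T: "T \<in> obj (mset_cat U)" unfolding T_def by (rule coded_obj[OF U]) auto
  have uT: "und T = {enc U ()}" by (simp add: T_def und_coded[OF U])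
  have "\<exists>!z. z \<in> fobj F T \<and> (\<forall>i\<in>{}. farr F T (undefined i) (undefined i) z = undefined i)"
  proof -
    have "finite_diagram (mset_cat U) {} undefined {}" by (simp add: finite_diagram_def)
    moreover have "is_cone (mset_cat U) {} undefined {} T undefined" using T by (simp add: is_cone_def)
    moreover have "elementwise_limit {} (\<lambda>i. und (undefined i)) {} (und T) undefined"
      by (simp add: elementwise_limit_def uT)
    ultimately have "elementwise_limit {} (\<lambda>i. fobj F (undefined i)) {} (fobj F T) (\<lambda>i.
        farr F T (undefined i) (undefined i))"
      using point_limit[of "{}" undefined "{}" T undefined] by simp
    then show ?thesis by (simp add: elementwise_limit_def compatible_family_def)
  qed
  then have T1: "\<exists>!z. z \<in> fobj F T" by simp
  then obtain z where "z \<in> fobj F T" by blast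
  from point_elem_surj[OF T this] obtain p0 where ne: "p0 \<in> P" unfolding P_def M_def by blast
  have dir: "\<exists>q\<in>P. \<exists>m\<in>nsmat. \<exists>m'\<in>nsmat. p = r q m \<and> p' = r q m'" if p: "p \<in> P" "p' \<in> P" for p p'
  proof -
    have t: "enc U () \<in> und T" by (simp add: uT)
    have "point_elem T p (enc U ()) = point_elem T p' (enc U ())"
      using T1 point_elem_mem[OF T _ t] p unfolding P_def M_def by blast
    from point_elem_pullback[OF T p[unfolded P_def M_def] t t this]
    show ?thesis unfolding P_def M_def r_def by blast
  qed
  \<comment> \<open>The equalizer of right multiplication by two different matrices is empty.\<close>
  have free: "m = m'" if p: "p \<in> P" and m: "m \<in> nsmat" "m' \<in> nsmat" and eq: "r p m = r p m'" for p m m'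
  proof (rule ccontr)
    assume neq: "m \<noteq> m'"
    define L where "L = coded U ({} :: nat set) (\<lambda>a x. x)"
    have L: "L \<in> obj (mset_cat U)" unfolding L_def by (rule coded_obj[OF U]) auto
    have uL: "und L = {}" by (simp add: L_def und_coded[OF U])
    define l :: "nat \<Rightarrow> 'u \<Rightarrow> 'u" where "l i = (\<lambda>x. undefined)" for i
    define d where "d i = M" for i :: nat
    define I :: "nat set" where "I = {0, 1}"
    define E where "E = {(0 :: nat, 1 :: nat, orbit_map U M (enc U m)), (0, 1,
        orbit_map U M (enc U m'))}"
    have o: "orbit_map U M (enc U k) \<in> mset_maps M M" if "k \<in> nsmat" for k
      using orbit_map_arr[OF U ms eM[OF that]] by (simp add: M_def)
    have "finite_diagram (mset_cat U) I d E"
      using M o m by (auto simp: finite_diagram_def I_def E_def d_def simp del: mset_cat_simps(1))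
    moreover have "is_cone (mset_cat U) I d E L l"
      using L by (auto simp: is_cone_def mset_maps_def uL l_def E_def compose_def fun_eq_iff simp
          del: mset_cat_simps(1))
    moreover have "\<not> compatible_family I (\<lambda>i. und (d i)) E y" for y
    proof
      assume y: "compatible_family I (\<lambda>i. und (d i)) E y"
      then obtain k where k: "k \<in> nsmat" "y 0 = enc U k" by (auto simp: compatible_family_def I_def
          d_def uM)
      have "orbit_map U M (enc U m) (y 0) = orbit_map U M (enc U m') (y 0)"
        using y by (auto simp: compatible_family_def E_def)
      then have "k ** m = k ** m'" by (simp add: k om aM enc_eq_iff[OF U])
      then show False using neq nsmat_cancel_left[OF k(1)] by blast
    qed
    ultimately have lim: "elementwise_limit I (\<lambda>i. fobj F (d i)) ((\<lambda>(i, j, f). (i, j,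
        farr F (d i) (d j) f)) ` E)
        (fobj F L) (\<lambda>i. farr F L (d i) (l i))"
      using point_limit[of I d E L l] by (simp add: elementwise_limit_def)
    have "compatible_family I (\<lambda>i. fobj F (d i)) ((\<lambda>(i, j, f). (i, j, farr F (d i) (d j) f)) ` E)
        (\<lambda>i. if i = 0 then p else r p m)"
      using p closed[OF p m(1)] eq
      by (auto simp: compatible_family_def I_def E_def d_def P_def) (simp_all add: r_def
          point_elem_def M_def)
    then obtain z where "z \<in> fobj F L" using lim unfolding elementwise_limit_def by blast
    then show False using point_elem_surj[OF L] uL by blast
  qed
  obtain A \<pi> where A: "A \<in> intermediate_groups" "bij_betw \<pi> (frames A) P"
    "\<And>s m. s \<in> frames A \<Longrightarrow> m \<in> nsmat \<Longrightarrow> \<pi> (s ** ratm m) = r (\<pi> s) m"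
    using flat_module_is_frames[of p0 P r] ne closed one mult dir free by blast
  have \<pi>: "\<pi> s \<in> fobj F (free_mset U)" if "s \<in> frames A" for s
    using A(2) that by (auto simp: bij_betw_def P_def M_def)
  have "presentation U A F (\<lambda>N s. point_elem N (\<pi> s))"
  proof
    fix N s n assume *: "N \<in> obj (mset_cat U)" "s \<in> frames A" "n \<in> und N"
    show "point_elem N (\<pi> s) n \<in> fobj F N" by (rule point_elem_mem[OF *(1) \<pi>[OF *(2)] *(3)])
  next
    fix N z assume N: "N \<in> obj (mset_cat U)" and z: "z \<in> fobj F N"
    obtain p n where p: "p \<in> P" "n \<in> und N" "z = point_elem N p n"
      using point_elem_surj[OF N z] by (auto simp: P_def M_def)
    then obtain s where "s \<in> frames A" "p = \<pi> s" using A(2) unfolding bij_betw_def by blast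
    with p show "\<exists>s\<in>frames A. \<exists>n\<in>und N. z = point_elem N (\<pi> s) n" by blast
  next
    fix N s m n assume *: "N \<in> obj (mset_cat U)" "s \<in> frames A" "m \<in> nsmat" "n \<in> und N"
    show "point_elem N (\<pi> (s ** ratm m)) n = point_elem N (\<pi> s) (act N m n)"
      using act[OF *(1) _ *(3,4), of "\<pi> s"] \<pi>[OF *(2)] A(3)[OF *(2,3)] by (simp add: P_def M_def)
  next
    fix N s n n' assume N: "N \<in> obj (mset_cat U)" and s: "s \<in> frames A" and n: "n \<in> und N" "n' \<in> und N"
      and eq: "point_elem N (\<pi> s) n = point_elem N (\<pi> s) n'"
    obtain q m m' where q: "q \<in> P" "m \<in> nsmat" "m' \<in> nsmat" "\<pi> s = r q m" "\<pi> s = r q m'"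
        "act N m n = act N m' n'"
      using point_elem_pullback[OF N \<pi>[OF s] \<pi>[OF s] n eq] by (auto simp: P_def M_def r_def)
    have mm: "m = m'" using free[OF q(1-3)] q(4,5) by simp
    obtain t where t: "t \<in> frames A" "q = \<pi> t" using A(2) q(1) unfolding bij_betw_def by blast
    have "\<pi> s = \<pi> (t ** ratm m)" using A(3)[OF t(1) q(2)] q(4) t(2) by simp
    then have "s = t ** ratm m"
      using A(2) s frames_mult[OF A(1) t(1) q(2)] unfolding bij_betw_def inj_on_def by blast
    then show "\<exists>t\<in>frames A. \<exists>m\<in>nsmat. s = t ** ratm m \<and> act N m n = act N m n'"
      using t(1) q(2,6) mm by blast
  next
    fix N N' f s n assume *: "N \<in> obj (mset_cat U)" "N' \<in> obj (mset_cat U)" "f \<in> mset_maps N N'"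
        "s \<in> frames A" "n \<in> und N"
    show "farr F N N' f (point_elem N (\<pi> s) n) = point_elem N' (\<pi> s) (f n)"
      by (rule point_elem_natural[OF *(1-3) \<pi>[OF *(4)] *(5)])
  qed (rule U A(1) point_functor)+
  then show ?thesis by blast
qed

end

section \<open>The point and the group attached to a profinite matrix\<close>

abbreviation zmat :: "int^2^2 \<Rightarrow> zhat^2^2" where
  "zmat \<equiv> map_matrix of_int"

lemma adm_integral:
  assumes "\<And>j. column j g \<in> group_at Y"
  obtains c where "Y ** qadm g = adm c"
proof -
  have "\<exists>z. (Y ** qadm g) $ i $ j = zhat_to_adele z" for i j
  proof -
    have "(Y *v qadv (column j g)) $ i = (Y ** qadm g) $ i $ j"
      by (simp add: matrix_vector_mult_def matrix_matrix_mult_def column_def)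
    moreover have "(Y *v qadv (column j g)) $ i \<in> range zhat_to_adele"
      using assms[of j] by (simp add: group_at_def)
    ultimately show ?thesis by (simp add: image_iff)
  qed
  then obtain f where "\<And>i j. (Y ** qadm g) $ i $ j = zhat_to_adele (f i j)" by metis
  then have "Y ** qadm g = adm (\<chi> i j. f i j)" by (simp add: vec_eq_iff)
  with that show ?thesis by blast
qed

lemma column_in_group_at:
  assumes "Y ** qadm g = adm c" shows "column j g \<in> group_at Y"
proof -
  have "(Y *v qadv (column j g)) $ i = (Y ** qadm g) $ i $ j" for i
    by (simp add: matrix_vector_mult_def matrix_matrix_mult_def column_def)
  then show ?thesis by (simp add: group_at_def assms)
qed

lemma GL_orbit_eqI:
  assumes "b = u ** a" "invertible u" shows "GL_orbit a = GL_orbit (b :: 'a::comm_ring_1^2^2)"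
proof -
  have sub: "GL_orbit (u ** a) \<subseteq> GL_orbit a" if "invertible u" for u a :: "'a^2^2"
  proof
    fix x assume "x \<in> GL_orbit (u ** a)"
    then obtain v where "invertible v" "x = v ** (u ** a)" unfolding GL_orbit_def by blast
    then show "x \<in> GL_orbit a"
      using that unfolding GL_orbit_def by (auto simp: matrix_mul_assoc intro!: exI[of _ "v ** u"]
          invertible_prod)
  qed
  obtain v where v: "invertible v" "v ** u = mat 1" using assms(2) invertibleE by blast
  then have "a = v ** b" by (simp add: assms(1) matrix_mul_assoc)
  then show ?thesis using sub[OF v(1), of b] sub[OF assms(2), of a] assms(1) by simp
qed

lemma mem_GL_orbit: "a \<in> GL_orbit (a :: 'a::comm_ring_1^2^2)"
  unfolding GL_orbit_def by (auto simp: invertible_def intro!: exI[of _ "mat 1"])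

lemma Xhat_orbit:
  assumes "x \<in> Xhat" "y \<in> x" shows "x = GL_orbit y"
proof -
  obtain z where z: "x = GL_orbit z" using assms(1) by (auto simp: Xhat_def)
  then obtain u where "invertible u" "y = u ** z" using assms(2) by (auto simp: GL_orbit_def)
  then show ?thesis using z GL_orbit_eqI by metis
qed

lemma Xhat_le_iff:
  "Xhat_le (to_Xhat m) (GL_orbit y) \<longleftrightarrow> (\<exists>c. y = c ** zmat m)"
proof
  assume "Xhat_le (to_Xhat m) (GL_orbit y)"
  then obtain a b k where abk: "a \<in> GL_orbit (zmat m)" "b \<in> GL_orbit y" "b = k ** a"
    unfolding Xhat_le_def to_Xhat_def by blast
  obtain u where u: "a = u ** zmat m" using abk(1) by (auto simp: GL_orbit_def)
  obtain v where v: "invertible v" "b = v ** y" using abk(2) by (auto simp: GL_orbit_def)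
  have *: "v ** y = k ** (u ** zmat m)" using abk(3) u v(2) by simp
  obtain w where w: "w ** v = mat 1" using v(1) invertibleE by blast
  have "y = w ** (v ** y)" by (simp add: matrix_mul_assoc w)
  then have "y = (w ** k ** u) ** zmat m" unfolding * by (simp add: matrix_mul_assoc)
  then show "\<exists>c. y = c ** zmat m" by blast
next
  assume "\<exists>c. y = c ** zmat m"
  then show "Xhat_le (to_Xhat m) (GL_orbit y)"
    unfolding Xhat_le_def to_Xhat_def using mem_GL_orbit by blast
qed

text \<open>The product \<open>y m\<^sup>-\<^sup>1\<close> is integral iff \<open>y\<close> is integral on the columns of \<open>m\<^sup>-\<^sup>1\<close>. So the order by
  divisibility becomes inclusion of the lattices \<open>m\<^sup>-\<^sup>1 \<int>\<^sup>2\<close> in the group of \<open>y\<close>.\<close>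

lemma Xhat_le_iff_frame:
  assumes h: "ratm m ** h = mat 1" "h ** ratm m = mat 1"
  shows "Xhat_le (to_Xhat m) (GL_orbit y) \<longleftrightarrow> h \<in> frames (group_at (adm y))"
proof -
  have inv: "invertible h" using h unfolding invertible_def by blast
  have qh: "qadm (ratm m) ** qadm h = mat 1" "qadm h ** qadm (ratm m) = mat 1"
    by (simp_all add: qadm_mult[symmetric] h qadm_one)
  show ?thesis unfolding Xhat_le_iff
  proof
    assume "\<exists>c. y = c ** zmat m"
    then obtain c where "y = c ** zmat m" by blast
    then have "adm y ** qadm h = adm c ** (qadm (ratm m) ** qadm h)"
      by (simp add: adm_mult qadm_ratm matrix_mul_assoc)
    then have "adm y ** qadm h = adm c" by (simp add: qh)
    then show "h \<in> frames (group_at (adm y))" using inv column_in_group_at by (auto simp: frames_def)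
  next
    assume "h \<in> frames (group_at (adm y))"
    then obtain c where c: "adm y ** qadm h = adm c" using adm_integral unfolding frames_def by blast
    have "adm y = (adm y ** qadm h) ** qadm (ratm m)" by (simp add: matrix_mul_assoc[symmetric] qh)
    also have "\<dots> = adm (c ** zmat m)" by (simp add: c adm_mult qadm_ratm)
    finally show "\<exists>c. y = c ** zmat m" unfolding adm_eq_iff by blast
  qed
qed

locale profinite_point =
  fixes R :: "(int^2^2) set" and y :: "zhat^2^2"
  assumes R: "representatives R"
begin

abbreviation "index_set \<equiv> below R (GL_orbit y)"
abbreviation "A \<equiv> group_at (adm y)"

lemma A: "A \<in> intermediate_groups" by (rule group_at_intermediate)

lemma index_set_frame:
  assumes "m \<in> index_set"
  obtains h where "h \<in> frames A" "ratm m ** h = mat 1" "h ** ratm m = mat 1" "m \<in> nsmat"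
proof -
  have m: "m \<in> nsmat" "Xhat_le (to_Xhat m) (GL_orbit y)"
    using assms R by (auto simp: below_def representatives_def)
  then obtain h where "ratm m ** h = mat 1" "h ** ratm m = mat 1" using invertibleE invertible_ratm
      by metis
  with m Xhat_le_iff_frame that show ?thesis by blast
qed

text \<open>The integer matrix \<open>k\<close> is the inverse of the frame \<open>h\<close>, hence below \<open>y\<close>; its chosen representative is
  \<open>u k\<close> for a unit \<open>u\<close>. Thus the inverses of the matrices in the index set are cofinal among the frames.\<close>

lemma index_set_cofinal:
  assumes h: "h \<in> frames A" "k \<in> nsmat" "h ** ratm k = mat 1"
  obtains m u where "m \<in> index_set" "u \<in> nsmat" "m = u ** k" "ratm m ** h = ratm u"
proof -
  obtain m where m: "m \<in> R" "m \<in> GL_orbit k" using R h(2) unfolding representatives_def by blast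
  then obtain u where u: "invertible u" "m = u ** k" by (auto simp: GL_orbit_def)
  obtain v where v: "u ** v = mat 1" "v ** u = mat 1" using u(1) invertibleE by blast
  have kh: "ratm k ** h = mat 1" using h(3) matrix_left_right_inverse by blast
  have "det u * det v = 1" using v(1) det_mul[of u v] by simp
  then have uv: "u \<in> nsmat" "v \<in> nsmat" by (auto simp: nsmat_def)
  have mh: "ratm m ** h = ratm u" by (simp add: u(2) ratm_mult matrix_mul_assoc[symmetric] kh)
  have uv1: "ratm u ** ratm v = mat 1" "ratm v ** ratm u = mat 1"
      by (simp_all add: ratm_mult[symmetric] v ratm_mat)
  have 1: "ratm m ** (h ** ratm v) = mat 1" by (simp add: matrix_mul_assoc mh uv1)
  have 2: "(h ** ratm v) ** ratm m = mat 1" using 1 matrix_left_right_inverse by blast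
  have "h ** ratm v \<in> frames A" using frames_mult[OF A h(1) uv(2)] .
  then have "m \<in> index_set" using m(1) Xhat_le_iff_frame[OF 1 2] by (simp add: below_def)
  then show ?thesis using that uv(1) u(2) mh by blast
qed

lemma index_set_over_frame:
  assumes s: "s \<in> frames A"
  obtains m k where "m \<in> index_set" "k \<in> nsmat" "ratm m ** s = ratm k"
proof -
  obtain g k k' where g: "g \<in> frames A" "k \<in> nsmat" "k' \<in> nsmat" "mat 1 = g ** ratm k" "s = g ** ratm k'"
    using frames_directed[OF A frames_one[OF A] s] by blast
  obtain m u where m: "m \<in> index_set" "u \<in> nsmat" "ratm m ** g = ratm u"
    using index_set_cofinal[OF g(1,2) g(4)[symmetric]] by blast
  have "ratm m ** s = ratm (u ** k')" by (simp add: g(5) matrix_mul_assoc m(3) ratm_mult)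
  then show ?thesis using that m(1) nsmat_mult[OF m(2) g(3)] by blast
qed

lemma index_set_directed:
  assumes "m \<in> index_set" "m' \<in> index_set"
  obtains m'' a a' where "m'' \<in> index_set" "a \<in> nsmat" "a' \<in> nsmat" "m'' = a ** m" "m'' = a' ** m'"
proof -
  obtain h where h: "h \<in> frames A" "ratm m ** h = mat 1" "h ** ratm m = mat 1" "m \<in> nsmat"
    using assms(1) index_set_frame by blast
  obtain h' where h': "h' \<in> frames A" "ratm m' ** h' = mat 1" "h' ** ratm m' = mat 1" "m' \<in> nsmat"
    using assms(2) index_set_frame by blast
  obtain g a a' where g: "g \<in> frames A" "a \<in> nsmat" "a' \<in> nsmat" "h = g ** ratm a" "h' = g ** ratm a'"
    using frames_directed[OF A h(1) h'(1)] by blast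
  have 1: "g ** ratm (a ** m) = mat 1" "g ** ratm (a' ** m') = mat 1"
    using h(3) h'(3) by (simp_all add: g ratm_mult matrix_mul_assoc)
  then have "ratm (a ** m) = ratm (a' ** m')"
    using invertible_cancel_left[OF frames_invertible[OF g(1)]] by metis
  then have am: "a ** m = a' ** m'" by (simp only: ratm_eq_iff)
  obtain n u where n: "n \<in> index_set" "u \<in> nsmat" "n = u ** (a ** m)"
    using index_set_cofinal[OF g(1) nsmat_mult[OF g(2) h(4)] 1(1)] by blast
  have "n = (u ** a) ** m" using n(3) by (simp add: matrix_mul_assoc)
  moreover have "n = (u ** a') ** m'" using n(3)[unfolded am] by (simp add: matrix_mul_assoc)
  ultimately show ?thesis using that n(1) nsmat_mult[OF n(2) g(2)] nsmat_mult[OF n(2) g(3)] by blast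
qed

text \<open>The matrices below \<open>y\<close> are inverses of frames, and the lattices containing \<open>\<int>\<^sup>2\<close> cover the group.\<close>

lemma group_of_eq: "group_of R (GL_orbit y) = A"
proof (intro equalityI subsetI)
  fix v assume "v \<in> group_of R (GL_orbit y)"
  then obtain m where m: "m \<in> index_set" "ratm m *v v \<in> Z2" unfolding group_of_def by blast
  obtain w where w: "ratm m *v v = ratv w" using m(2) by (rule Z2_ratvE)
  obtain h where h: "h \<in> frames A" "h ** ratm m = mat 1" using m(1) index_set_frame by blast
  have "v = h *v ratv w" by (simp add: w[symmetric] matrix_vector_mul_assoc h)
  then show "v \<in> A" using h(1) intermediate_lincomb[OF A] by (simp add: frames_def)
next
  fix v assume "v \<in> A"
  then obtain h k w where h: "h \<in> frames A" "k \<in> nsmat" "h ** ratm k = mat 1" "v = h *v ratv w"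
    using frames_cover[OF A] by blast
  obtain m u where m: "m \<in> index_set" "ratm m ** h = ratm u" using index_set_cofinal[OF h(1-3)] by blast
  have "ratm m *v v = ratv (u *v w)" by (simp add: h(4) matrix_vector_mul_assoc m(2) ratm_ratv)
  then have "ratm m *v v \<in> Z2" by (simp only: ratv_Z2)
  then show "v \<in> group_of R (GL_orbit y)" using m(1) unfolding group_of_def by blast
qed

end

text \<open>This bounds the size of the colimit. For finite \<open>X\<close> the product is countable, for infinite \<open>X\<close> it
  has at most the cardinality of \<open>X\<close>.\<close>

lemma universe_countable_times:
  fixes K :: "'b::countable set" and U :: "'u set set"
  assumes U: "set_universe U" and X: "X \<in> U"
  obtains B and f :: "'b \<times> 'u \<Rightarrow> 'u" where "B \<in> U" "inj_on f (K \<times> X)" "f ` (K \<times> X) \<subseteq> B"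
proof (cases "finite X")
  case True
  have "countable (K \<times> X)" using True by (simp add: countable_finite)
  then have "inj_on (\<lambda>x. enc U (to_nat_on (K \<times> X) x)) (K \<times> X)"
    using inj_on_to_nat_on by (auto simp: inj_on_def enc_eq_iff[OF U])
  then show ?thesis using that[of "range (enc U :: nat \<Rightarrow> 'u)"] enc_image[OF U, of "UNIV :: nat set"]
      by blast
next
  case False
  obtain i :: "nat \<Rightarrow> 'u" where i: "inj i" "range i \<subseteq> X" using infinite_countable_subset[OF False]
      by blast
  have "inj_on (\<lambda>b. i (to_nat b)) K" by (rule inj_onI) (simp add: inj_eq[OF i(1)])
  moreover have "(\<lambda>b. i (to_nat b)) ` K \<subseteq> X" using i(2) by auto
  ultimately have "\<exists>f :: 'b \<Rightarrow> 'u. inj_on f K \<and> f ` K \<subseteq> X" by blast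
  then have KX: "(card_of K, card_of X) \<in> ordLeq" by (simp only: card_of_ordLeq)
  have "\<exists>f. inj_on f (K \<times> X) \<and> f ` (K \<times> X) \<subseteq> X"
  proof (cases "K = {}")
    case False
    then have "(card_of (K \<times> X), card_of X) \<in> ordIso"
      using card_of_Times_infinite[OF \<open>infinite X\<close> False KX] by simp
    then show ?thesis using card_of_ordLeq ordIso_imp_ordLeq by blast
  qed simp
  then show ?thesis using that[OF X] by blast
qed

context profinite_point
begin

definition germ :: "'u mset \<Rightarrow> int^2^2 \<Rightarrow> 'u \<Rightarrow> ((int^2^2) \<times> 'u) set" where
  "germ N m n = colim_rel R (GL_orbit y) N `` {(m, n)}"

definition elem :: "'u mset \<Rightarrow> int^2^2 \<Rightarrow> 'u \<Rightarrow> 'u" where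
  "elem N m n = rename (colim R (GL_orbit y) N) (germ N m n)"

text \<open>Since the index set is directed, elements of the colimit agree iff they agree at a later stage.\<close>

lemma colim_rel_iff:
  assumes N: "is_mset N"
  shows "((m, n), (m', n')) \<in> colim_rel R (GL_orbit y) N \<longleftrightarrow>
    m \<in> index_set \<and> n \<in> und N \<and> m' \<in> index_set \<and> n' \<in> und N \<and>
    (\<exists>a\<in>nsmat. \<exists>a'\<in>nsmat. a ** m \<in> index_set \<and> a ** m = a' ** m' \<and> act N a n = act N a' n')"
proof -
  define step where "step = colim_step R (GL_orbit y) N"
  define J where "J s t \<longleftrightarrow> (\<exists>a\<in>nsmat. \<exists>a'\<in>nsmat. a ** fst s \<in> index_set \<and> a ** fst s = a' ** fst t \<and>
    act N a (snd s) = act N a' (snd t))" for s t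
  have step_iff: "step s t \<longleftrightarrow> s \<in> index_set \<times> und N \<and> t \<in> index_set \<times> und N \<and>
     (\<exists>a\<in>nsmat. fst t = a ** fst s \<and> snd t = act N a (snd s))" for s t
    by (simp add: step_def colim_step_def)
  have ns: "a \<in> nsmat" if "a \<in> index_set" for a using index_set_frame[OF that] by blast
  have J_trans: "J s w" if st: "J s t" "J t w" and mem: "s \<in> index_set \<times> und N"
      "t \<in> index_set \<times> und N" "w \<in> index_set \<times> und N" for s t w
  proof -
    obtain a b where ab: "a \<in> nsmat" "b \<in> nsmat" "a ** fst s \<in> index_set" "a ** fst s = b ** fst t"
      "act N a (snd s) = act N b (snd t)" using st(1) unfolding J_def by blast
    obtain c d where cd: "c \<in> nsmat" "d \<in> nsmat" "c ** fst t \<in> index_set" "c ** fst t = d ** fst w"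
      "act N c (snd t) = act N d (snd w)" using st(2) unfolding J_def by blast
    obtain k e f where k: "k \<in> index_set" "e \<in> nsmat" "f \<in> nsmat" "k = e ** (a ** fst s)"
        "k = f ** (c ** fst t)"
      using index_set_directed[OF ab(3) cd(3)] by blast
    have "(e ** b) ** fst t = (f ** c) ** fst t"
      using k(4,5) unfolding ab(4) by (simp add: matrix_mul_assoc)
    then have eb: "e ** b = f ** c" using nsmat_cancel_right[OF ns] mem(2) by auto
    have "act N (e ** a) (snd s) = act N (f ** d) (snd w)"
    proof -
      have "act N (e ** a) (snd s) = act N (e ** b) (snd t)"
        using act_mult[OF N k(2) ab(1)] act_mult[OF N k(2) ab(2)] ab(5) mem by auto
      also have "\<dots> = act N (f ** d) (snd w)"
        unfolding eb using act_mult[OF N k(3) cd(1)] act_mult[OF N k(3) cd(2)] cd(5) mem by auto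
      finally show ?thesis .
    qed
    moreover have "(e ** a) ** fst s \<in> index_set" "(e ** a) ** fst s = (f ** d) ** fst w"
      using k(1,4,5) cd(4) by (simp_all add: matrix_mul_assoc[symmetric])
    ultimately show ?thesis
      using nsmat_mult[OF k(2) ab(1)] nsmat_mult[OF k(3) cd(2)] unfolding J_def by blast
  qed
  have J_step: "J s t" "J t s" if "step s t" for s t
  proof -
    obtain a where a: "s \<in> index_set \<times> und N" "t \<in> index_set \<times> und N" "a \<in> nsmat"
        "fst t = a ** fst s" "snd t = act N a (snd s)"
      using \<open>step s t\<close> unfolding step_iff by blast
    then have *: "act N (mat 1) (snd t) = snd t" "a ** fst s \<in> index_set" using act_one[OF N] by auto
    show "J s t" unfolding J_def
      by (rule bexI[of _ a], rule bexI[of _ "mat 1"]) (use a * nsmat_one in auto)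
    show "J t s" unfolding J_def
      by (rule bexI[of _ "mat 1"], rule bexI[of _ a]) (use a * nsmat_one in auto)
  qed
  have J_refl: "J s s" if "s \<in> index_set \<times> und N" for s
    using that nsmat_one unfolding J_def by (auto intro!: bexI[of _ "mat 1"])
  have fwd: "t \<in> index_set \<times> und N \<and> J s t" if st: "equivclp step s t"
      and s: "s \<in> index_set \<times> und N" for s t
    using st
  proof (induction rule: equivclp_induct)
    case base
    show ?case using s J_refl by blast
  next
    case (step t w)
    have "J t w" using step(2) J_step by blast
    moreover have "w \<in> index_set \<times> und N" using step(2) unfolding step_iff by blast
    ultimately show ?case using step(3) J_trans s by blast
  qed
  have bwd: "equivclp step s t" if "J s t" "s \<in> index_set \<times> und N" "t \<in> index_set \<times> und N" for s t
  proof -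
    obtain a b where ab: "a \<in> nsmat" "b \<in> nsmat" "a ** fst s \<in> index_set" "a ** fst s = b ** fst t"
      "act N a (snd s) = act N b (snd t)" using \<open>J s t\<close> unfolding J_def by blast
    define w where "w = (a ** fst s, act N a (snd s))"
    have "snd s \<in> und N" using that(2) by auto
    then have w: "w \<in> index_set \<times> und N"
      using ab(3) act_closed[OF N ab(1)] by (simp add: w_def)
    have "step s w" unfolding step_iff using that(2) w ab(1) by (auto simp: w_def)
    moreover have "step t w" unfolding step_iff using that(3) w ab by (auto simp: w_def)
    ultimately show ?thesis by (meson equivclp_sym equivclp_trans r_into_equivclp)
  qed
  show ?thesis
    using fwd[of "(m, n)" "(m', n')"] bwd[of "(m, n)" "(m', n')"]
    unfolding colim_rel_def step_def[symmetric] J_def by auto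
qed

lemma equiv_colim_rel: "equiv (index_set \<times> und N) (colim_rel R (GL_orbit y) N)"
proof (rule equivI)
  show "colim_rel R (GL_orbit y) N \<subseteq> (index_set \<times> und N) \<times> (index_set \<times> und N)"
    by (auto simp: colim_rel_def)
  show "refl_on (index_set \<times> und N) (colim_rel R (GL_orbit y) N)"
    by (rule refl_onI) (auto simp: colim_rel_def)
  show "sym (colim_rel R (GL_orbit y) N)"
    by (rule symI) (auto simp: colim_rel_def intro: equivclp_sym)
  show "trans (colim_rel R (GL_orbit y) N)"
    by (rule transI) (auto simp: colim_rel_def intro: equivclp_trans)
qed

lemma germ_colim: "m \<in> index_set \<Longrightarrow> n \<in> und N \<Longrightarrow> germ N m n \<in> colim R (GL_orbit y) N"
  unfolding germ_def colim_def by (rule quotientI) simp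

lemma colim_germE:
  assumes "c \<in> colim R (GL_orbit y) N"
  obtains m n where "m \<in> index_set" "n \<in> und N" "c = germ N m n"
  using assms unfolding colim_def germ_def by (auto elim!: quotientE)

lemma germ_eq_iff:
  assumes "m \<in> index_set" "n \<in> und N" "m' \<in> index_set" "n' \<in> und N"
  shows "germ N m n = germ N m' n' \<longleftrightarrow> ((m, n), (m', n')) \<in> colim_rel R (GL_orbit y) N"
  unfolding germ_def by (rule eq_equiv_class_iff[OF equiv_colim_rel]) (use assms in auto)

lemma colim_map_germ:
  assumes N: "is_mset N" "is_mset N'" and f: "f \<in> mset_maps N N'" and mn: "m \<in> index_set" "n \<in> und N"
  shows "colim_map R (GL_orbit y) N' f (germ N m n) = germ N' m (f n)"
proof -
  have "(\<lambda>(m, n). germ N' m (f n)) respects (colim_rel R (GL_orbit y) N)"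
  proof (rule congruentI, clarify)
    fix m n m' n' assume r: "((m, n), (m', n')) \<in> colim_rel R (GL_orbit y) N"
    then obtain a a' where a: "m \<in> index_set" "n \<in> und N" "m' \<in> index_set" "n' \<in> und N" "a \<in> nsmat"
        "a' \<in> nsmat"
      "a ** m \<in> index_set" "a ** m = a' ** m'" "act N a n = act N a' n'"
          unfolding colim_rel_iff[OF N(1)] by blast
    have "act N' a (f n) = act N' a' (f n')"
      using mset_maps_act[OF f a(5,2)] mset_maps_act[OF f a(6,4)] a(9) by simp
    then have "((m, f n), (m', f n')) \<in> colim_rel R (GL_orbit y) N'"
      unfolding colim_rel_iff[OF N(2)] using a mset_maps_mem[OF f] by blast
    then show "germ N' m (f n) = germ N' m' (f n')"
      using germ_eq_iff[of m "f n" N' m' "f n'"] a mset_maps_mem[OF f] by blast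
  qed
  from UN_equiv_class[OF equiv_colim_rel this, of "(m, n)"] mn
  show ?thesis by (simp add: colim_map_def germ_def)
qed

lemma rename_colim:
  fixes U :: "'u set set" and N :: "'u mset"
  assumes U: "set_universe U" and N: "und N \<in> U"
  shows "inj_on (rename (colim R (GL_orbit y) N) :: ((int^2^2) \<times> 'u) set \<Rightarrow> 'u) (colim R (GL_orbit y)
      N)" (is ?inj)
    and "(rename (colim R (GL_orbit y) N) :: ((int^2^2) \<times> 'u) set \<Rightarrow> 'u) ` colim R (GL_orbit y) N \<in>
        U" (is ?img)
proof -
  define Q where "Q = colim R (GL_orbit y) N"
  obtain B and f :: "(int^2^2) \<times> 'u \<Rightarrow> 'u" where
    f: "B \<in> U" "inj_on f (index_set \<times> und N)" "f ` (index_set \<times> und N) \<subseteq> B"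
    using universe_countable_times[OF U N] by blast
  have pick: "(SOME x. x \<in> c) \<in> c" "c \<subseteq> index_set \<times> und N" if "c \<in> Q" for c
  proof -
    have "c \<noteq> {}" using that in_quotient_imp_non_empty[OF equiv_colim_rel] unfolding Q_def colim_def
        by blast
    then show "(SOME x. x \<in> c) \<in> c" by (simp add: some_in_eq)
    show "c \<subseteq> index_set \<times> und N"
      using that in_quotient_imp_subset[OF equiv_colim_rel] unfolding Q_def colim_def by blast
  qed
  define g where "g c = f (SOME x. x \<in> c)" for c
  have g: "inj_on g Q"
  proof (rule inj_onI)
    fix c c' assume c: "c \<in> Q" "c' \<in> Q" "g c = g c'"
    then have "(SOME x. x \<in> c) = (SOME x. x \<in> c')"
      using f(2) pick[OF c(1)] pick[OF c(2)] unfolding g_def inj_on_def by blast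
    then have "c \<inter> c' \<noteq> {}" using pick(1)[OF c(1)] pick(1)[OF c(2)] by auto
    then show "c = c'"
      using quotient_disj[OF equiv_colim_rel] c(1,2) unfolding Q_def colim_def by blast
  qed
  then have "\<exists>e :: ((int^2^2) \<times> 'u) set \<Rightarrow> 'u. inj_on e Q" by blast
  then have inj: "inj_on (rename Q :: ((int^2^2) \<times> 'u) set \<Rightarrow> 'u) Q"
    unfolding rename_def by (rule someI_ex)
  then show ?inj unfolding Q_def .
  have "(rename Q :: ((int^2^2) \<times> 'u) set \<Rightarrow> 'u) ` Q \<subseteq> (\<lambda>b. rename Q (inv_into Q g b)) ` B"
  proof
    fix z :: 'u assume "z \<in> rename Q ` Q"
    then obtain c where c: "c \<in> Q" "z = rename Q c" by blast
    have "g c \<in> B" using f(3) pick[OF c(1)] unfolding g_def by blast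
    moreover have "z = rename Q (inv_into Q g (g c))" using c inv_into_f_f[OF g c(1)] by simp
    ultimately show "z \<in> (\<lambda>b. rename Q (inv_into Q g b)) ` B" by blast
  qed
  then have "rename Q ` Q \<in> U" by (rule universe_image[OF U f(1)])
  then show ?img unfolding Q_def .
qed

lemma fobj_point_of: "fobj (point_of R (GL_orbit y)) N = rename (colim R (GL_orbit y) N) ` colim R
    (GL_orbit y) N"
  by (simp add: point_of_def)

lemma elem_mem: "m \<in> index_set \<Longrightarrow> n \<in> und N \<Longrightarrow> elem N m n \<in> fobj (point_of R (GL_orbit y)) N"
  unfolding elem_def fobj_point_of by (rule imageI[OF germ_colim])

lemma elem_surj:
  assumes "z \<in> fobj (point_of R (GL_orbit y)) N"
  obtains m n where "m \<in> index_set" "n \<in> und N" "z = elem N m n"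
  using assms unfolding fobj_point_of elem_def by (auto elim!: colim_germE)

lemma elem_eq_iff:
  assumes U: "set_universe U" and N: "N \<in> obj (mset_cat U)"
    and mn: "m \<in> index_set" "n \<in> und N" "m' \<in> index_set" "n' \<in> und N"
  shows "elem N m n = elem N m' n' \<longleftrightarrow>
    (\<exists>a\<in>nsmat. \<exists>a'\<in>nsmat. a ** m \<in> index_set \<and> a ** m = a' ** m' \<and> act N a n = act N a' n')"
proof -
  have "elem N m n = elem N m' n' \<longleftrightarrow> germ N m n = germ N m' n'"
    using rename_colim(1)[OF U, of N] N germ_colim[OF mn(1,2)] germ_colim[OF mn(3,4)]
    unfolding elem_def by (simp add: inj_on_eq_iff)
  then show ?thesis using N mn unfolding germ_eq_iff[OF mn] by (simp add: colim_rel_iff)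
qed

lemma farr_elem:
  assumes U: "set_universe U" and N: "N \<in> obj (mset_cat U)" "N' \<in> obj (mset_cat U)"
      and f: "f \<in> mset_maps N N'"
    and mn: "m \<in> index_set" "n \<in> und N"
  shows "farr (point_of R (GL_orbit y)) N N' f (elem N m n) = elem N' m (f n)"
proof -
  have ms: "is_mset N" "is_mset N'" "und N \<in> U" using N by auto
  have "inv_into (colim R (GL_orbit y) N) (rename (colim R (GL_orbit y) N)) (elem N m n) = germ N m n"
    unfolding elem_def by (rule inv_into_f_f[OF rename_colim(1)[OF U ms(3)] germ_colim[OF mn]])
  then show ?thesis
    using elem_mem[OF mn] colim_map_germ[OF ms(1,2) f mn]
    by (simp add: point_of_def elem_def[of N' m])
qed

lemma point_of_functor:
  assumes U: "set_universe U"
  shows "is_functor (mset_cat U) (set_cat U) (point_of R (GL_orbit y))" (is "is_functor _ _ ?F")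
  unfolding is_functor_def
proof (intro conjI ballI)
  have ext: "farr ?F N N' f \<in> extensional (fobj ?F N)" for N N' f by (simp add: point_of_def)
  fix N assume N: "N \<in> obj (mset_cat U)"
  then have "und N \<in> U" by simp
  from rename_colim(2)[OF U this] show "fobj ?F N \<in> obj (set_cat U)" by (simp add: fobj_point_of)
  show "farr ?F N N (cid (mset_cat U) N) = cid (set_cat U) (fobj ?F N)"
  proof (rule extensionalityI[OF ext])
    have id: "(\<lambda>x\<in>und N. x) \<in> mset_maps N N" using N by (auto simp: mset_maps_def is_mset_def)
    fix z assume z: "z \<in> fobj ?F N"
    then obtain m n where mn: "m \<in> index_set" "n \<in> und N" "z = elem N m n" by (rule elem_surj)
    then show "farr ?F N N (cid (mset_cat U) N) z = cid (set_cat U) (fobj ?F N) z"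
      using farr_elem[OF U N N id mn(1,2)] z by simp
  qed simp
  fix N' assume N': "N' \<in> obj (mset_cat U)"
  fix f assume "f \<in> arr (mset_cat U) N N'"
  then have f: "f \<in> mset_maps N N'" by simp
  have fmem: "farr ?F N N' f z \<in> fobj ?F N'" if "z \<in> fobj ?F N" for z
  proof -
    obtain m n where mn: "m \<in> index_set" "n \<in> und N" "z = elem N m n"
      using \<open>z \<in> fobj ?F N\<close> by (rule elem_surj)
    then show ?thesis using farr_elem[OF U N N' f mn(1,2)] elem_mem[OF mn(1) mset_maps_mem[OF f
        mn(2)]] by simp
  qed
  then show "farr ?F N N' f \<in> arr (set_cat U) (fobj ?F N) (fobj ?F N')" using ext by (auto simp: PiE_iff)
  fix N'' g assume N'': "N'' \<in> obj (mset_cat U)" and "g \<in> arr (mset_cat U) N' N''"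
  then have g: "g \<in> mset_maps N' N''" by simp
  have gf: "compose (und N) g f \<in> mset_maps N N''" using mset_maps_compose[OF f g] N by simp
  show "farr ?F N N'' (ccomp (mset_cat U) N N' N'' g f)
      = ccomp (set_cat U) (fobj ?F N) (fobj ?F N') (fobj ?F N'') (farr ?F N' N'' g) (farr ?F N N' f)"
    unfolding set_cat_simps mset_cat_simps
  proof (rule extensionalityI[OF ext])
    fix z assume z: "z \<in> fobj ?F N"
    then obtain m n where mn: "m \<in> index_set" "n \<in> und N" "z = elem N m n" by (rule elem_surj)
    show "farr ?F N N'' (compose (und N) g f) z = compose (fobj ?F N) (farr ?F N' N'' g) (farr ?F N
        N' f) z"
      using z farr_elem[OF U N N'' gf mn(1,2)] farr_elem[OF U N N' f mn(1,2)]
        farr_elem[OF U N' N'' g mn(1) mset_maps_mem[OF f mn(2)]] mn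
      by (simp add: compose_eq)
  qed simp
qed

text \<open>The class of \<open>s \<otimes> n\<close> in the colimit: if \<open>s = m\<^sup>-\<^sup>1 k\<close> with \<open>m\<close> in the index set, it is the image of
  \<open>k n\<close> in the copy of \<open>N\<close> with index \<open>m\<close>.\<close>

definition frame_elem :: "'u mset \<Rightarrow> rat^2^2 \<Rightarrow> 'u \<Rightarrow> 'u" where
  "frame_elem N s n = (THE z. \<exists>m\<in>index_set. \<exists>k\<in>nsmat. ratm m ** s = ratm k \<and> z = elem N m (act N k n))"

lemma frame_elem_eq:
  assumes U: "set_universe U" and N: "N \<in> obj (mset_cat U)" and n: "n \<in> und N"
    and m: "m \<in> index_set" "k \<in> nsmat" "ratm m ** s = ratm k"
  shows "frame_elem N s n = elem N m (act N k n)"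
  unfolding frame_elem_def
proof (rule the_equality)
  show "\<exists>m'\<in>index_set. \<exists>k'\<in>nsmat. ratm m' ** s = ratm k' \<and> elem N m (act N k n) = elem N m' (act N k' n)"
    using m by blast
  fix z assume "\<exists>m'\<in>index_set. \<exists>k'\<in>nsmat. ratm m' ** s = ratm k' \<and> z = elem N m' (act N k' n)"
  then obtain m' k' where m': "m' \<in> index_set" "k' \<in> nsmat" "ratm m' ** s = ratm k'"
      "z = elem N m' (act N k' n)" by blast
  have ms: "is_mset N" using N by simp
  obtain m'' a a' where a: "m'' \<in> index_set" "a \<in> nsmat" "a' \<in> nsmat" "m'' = a ** m" "m'' = a' ** m'"
    using index_set_directed[OF m(1) m'(1)] by blast
  have "ratm (a ** k) = ratm m'' ** s" by (simp add: a(4) ratm_mult m(3)[symmetric] matrix_mul_assoc)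
  also have "\<dots> = ratm (a' ** k')" by (simp add: a(5) ratm_mult m'(3)[symmetric] matrix_mul_assoc)
  finally have ak: "a ** k = a' ** k'" by (simp only: ratm_eq_iff)
  have "act N a (act N k n) = act N a' (act N k' n)"
    using act_mult[OF ms a(2) m(2) n] act_mult[OF ms a(3) m'(2) n] ak by simp
  moreover have "a ** m \<in> index_set" "a ** m = a' ** m'" using a by simp_all
  ultimately have "elem N m (act N k n) = elem N m' (act N k' n)"
    using elem_eq_iff[OF U N m(1) act_closed[OF ms m(2) n] m'(1) act_closed[OF ms m'(2) n]] a(2,3)
        by blast
  then show "z = elem N m (act N k n)" using m'(4) by simp
qed

lemma point_of_presentation:
  assumes U: "set_universe U"
  shows "presentation U A (point_of R (GL_orbit y)) frame_elem"
proof
  fix N s n assume *: "N \<in> obj (mset_cat U)" "s \<in> frames A" "n \<in> und N"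
  have ms: "is_mset N" using * by simp
  obtain m k where m: "m \<in> index_set" "k \<in> nsmat" "ratm m ** s = ratm k"
      using index_set_over_frame[OF *(2)] by blast
  show "frame_elem N s n \<in> fobj (point_of R (GL_orbit y)) N"
    unfolding frame_elem_eq[OF U *(1,3) m] by (rule elem_mem[OF m(1) act_closed[OF ms m(2) *(3)]])
next
  fix N z assume N: "N \<in> obj (mset_cat U)" and z: "z \<in> fobj (point_of R (GL_orbit y)) N"
  from z obtain m n where mn: "m \<in> index_set" "n \<in> und N" "z = elem N m n" by (rule elem_surj)
  have ms: "is_mset N" using N by simp
  obtain h where h: "h \<in> frames A" "ratm m ** h = mat 1" using index_set_frame[OF mn(1)] by blast
  have "ratm m ** h = ratm (mat 1)" by (simp add: h ratm_mat)
  from frame_elem_eq[OF U N mn(2,1) nsmat_one this] have "z = frame_elem N h n"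
    by (simp add: mn act_one[OF ms])
  then show "\<exists>s\<in>frames A. \<exists>n\<in>und N. z = frame_elem N s n" using h(1) mn(2) by blast
next
  fix N s j n assume *: "N \<in> obj (mset_cat U)" "s \<in> frames A" "j \<in> nsmat" "n \<in> und N"
  have ms: "is_mset N" using * by simp
  obtain m k where m: "m \<in> index_set" "k \<in> nsmat" "ratm m ** s = ratm k"
      using index_set_over_frame[OF *(2)] by blast
  have "ratm m ** (s ** ratm j) = ratm (k ** j)" by (simp add: matrix_mul_assoc m(3) ratm_mult)
  from frame_elem_eq[OF U *(1,4) m(1) nsmat_mult[OF m(2) *(3)] this]
  show "frame_elem N (s ** ratm j) n = frame_elem N s (act N j n)"
    by (simp add: frame_elem_eq[OF U *(1) act_closed[OF ms *(3,4)] m] act_mult[OF ms m(2) *(3,4)])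
next
  fix N s n n' assume N: "N \<in> obj (mset_cat U)" and s: "s \<in> frames A" and n: "n \<in> und N" "n' \<in> und N"
    and eq: "frame_elem N s n = frame_elem N s n'"
  have ms: "is_mset N" using N by simp
  obtain m k where m: "m \<in> index_set" "k \<in> nsmat" "ratm m ** s = ratm k"
      using index_set_over_frame[OF s] by blast
  have "elem N m (act N k n) = elem N m (act N k n')"
    using eq by (simp add: frame_elem_eq[OF U N n(1) m] frame_elem_eq[OF U N n(2) m])
  then obtain a a' where a: "a \<in> nsmat" "a' \<in> nsmat" "a ** m \<in> index_set" "a ** m = a' ** m"
    "act N a (act N k n) = act N a' (act N k n')"
    using elem_eq_iff[OF U N m(1) act_closed[OF ms m(2) n(1)] m(1) act_closed[OF ms m(2) n(2)]] by blast
  have "m \<in> nsmat" using index_set_frame[OF m(1)] by blast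
  then have aa: "a = a'" using a(4) nsmat_cancel_right by blast
  obtain h where h: "h \<in> frames A" "h ** ratm (a ** m) = mat 1" using index_set_frame[OF a(3)] by blast
  have "s = (h ** ratm (a ** m)) ** s" by (simp add: h)
  also have "\<dots> = h ** ratm (a ** k)" by (simp add: ratm_mult m(3)[symmetric] matrix_mul_assoc)
  finally have "s = h ** ratm (a ** k)" .
  moreover have "act N (a ** k) n = act N (a ** k) n'"
    using a(5) unfolding aa[symmetric] act_mult[OF ms a(1) m(2) n(1)] act_mult[OF ms a(1) m(2) n(2)] .
  ultimately show "\<exists>t\<in>frames A. \<exists>m\<in>nsmat. s = t ** ratm m \<and> act N m n = act N m n'"
    using h(1) nsmat_mult[OF a(1) m(2)] by blast
next
  fix N N' f s n assume *: "N \<in> obj (mset_cat U)" "N' \<in> obj (mset_cat U)" "f \<in> mset_maps N N'"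
      "s \<in> frames A" "n \<in> und N"
  have ms: "is_mset N" using * by simp
  obtain m k where m: "m \<in> index_set" "k \<in> nsmat" "ratm m ** s = ratm k"
      using index_set_over_frame[OF *(4)] by blast
  show "farr (point_of R (GL_orbit y)) N N' f (frame_elem N s n) = frame_elem N' s (f n)"
    using farr_elem[OF U *(1-3) m(1) act_closed[OF ms m(2) *(5)]] mset_maps_act[OF *(3) m(2) *(5)]
    by (simp add: frame_elem_eq[OF U *(1,5) m] frame_elem_eq[OF U *(2) mset_maps_mem[OF *(3,5)] m])
qed (rule U A point_of_functor[OF U])+

end

text \<open>An isomorphism of groups turns a presentation by one into a presentation by the other, and
  presentations by the same group are isomorphic.\<close>

lemma presentations_iso_iff:
  assumes F: "presentation U A F \<theta>" and G: "presentation U B G \<theta>'"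
  shows "(F, G) \<in> point_iso U \<longleftrightarrow> (A, B) \<in> group_iso"
proof -
  have pts: "F \<in> points U" "G \<in> points U"
    using presentation.presented_point[OF F] presentation.presented_point[OF G] by auto
  show ?thesis
  proof
    assume "(F, G) \<in> point_iso U"
    then show "(A, B) \<in> group_iso" using isomorphic_presentations[OF F G] by (simp add: point_iso_def)
  next
    assume "(A, B) \<in> group_iso"
    then obtain g where g: "B \<in> intermediate_groups" "invertible g" "B = (*v) g ` A"
        unfolding group_iso_iff by blast
    obtain \<theta>'' where "presentation U B F \<theta>''" using presentation_translate[OF F g(2,1,3)] by blast
    from presentation_isomorphic[OF this G] show "(F, G) \<in> point_iso U" using pts
        by (simp add: point_iso_def)
  qed
qed

lemma equiv_point_iso:
  assumes U: "set_universe U" shows "equiv (points U) (point_iso U)"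
proof (rule equivI)
  note pres = point_presentation[OF U]
  have in_pts: "F \<in> points U" "G \<in> points U" if "(F, G) \<in> point_iso U" for F G
    using that by (auto simp: point_iso_def)
  show "point_iso U \<subseteq> points U \<times> points U" by (auto simp: point_iso_def)
  show "refl_on (points U) (point_iso U)"
  proof (rule refl_onI)
    fix F assume "F \<in> points U"
    then obtain A \<theta> where F: "presentation U A F \<theta>" using pres by blast
    then have "(A, A) \<in> group_iso"
      using equiv_group_iso presentation.A[OF F] unfolding equiv_def refl_on_def by blast
    then show "(F, F) \<in> point_iso U" using presentations_iso_iff[OF F F] by blast
  qed
  show "sym (point_iso U)"
  proof (rule symI)
    fix F G assume FG: "(F, G) \<in> point_iso U"
    obtain A \<theta> where F: "presentation U A F \<theta>" using pres in_pts[OF FG] by blast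
    obtain B \<theta>' where G: "presentation U B G \<theta>'" using pres in_pts[OF FG] by blast
    have "(A, B) \<in> group_iso" using FG presentations_iso_iff[OF F G] by blast
    then have "(B, A) \<in> group_iso" using equiv_group_iso unfolding equiv_def by (meson symD)
    then show "(G, F) \<in> point_iso U" using presentations_iso_iff[OF G F] by blast
  qed
  show "trans (point_iso U)"
  proof (rule transI)
    fix F G H assume FG: "(F, G) \<in> point_iso U" and GH: "(G, H) \<in> point_iso U"
    obtain A \<theta> where F: "presentation U A F \<theta>" using pres in_pts[OF FG] by blast
    obtain B \<theta>' where G: "presentation U B G \<theta>'" using pres in_pts[OF FG] by blast
    obtain C \<theta>'' where H: "presentation U C H \<theta>''" using pres in_pts[OF GH] by blast
    have "(A, B) \<in> group_iso" "(B, C) \<in> group_iso"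
      using FG GH presentations_iso_iff[OF F G] presentations_iso_iff[OF G H] by blast+
    then have "(A, C) \<in> group_iso" using equiv_group_iso unfolding equiv_def by (meson transD)
    then show "(F, H) \<in> point_iso U" using presentations_iso_iff[OF F H] by blast
  qed
qed

lemma bij_betw_from_common_kernel:
  assumes "A = f ` I" "B = g ` I" "\<And>i j. i \<in> I \<Longrightarrow> j \<in> I \<Longrightarrow> f i = f j \<longleftrightarrow> g i = g j"
  shows "\<exists>\<phi>. bij_betw \<phi> A B \<and> (\<forall>i\<in>I. \<phi> (f i) = g i)"
proof -
  define \<phi> where "\<phi> a = g (SOME i. i \<in> I \<and> f i = a)" for a
  have \<phi>: "\<phi> (f i) = g i" if "i \<in> I" for i
  proof -
    have "(SOME j. j \<in> I \<and> f j = f i) \<in> I \<and> f (SOME j. j \<in> I \<and> f j = f i) = f i"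
      by (rule someI[of _ i]) (use that in simp)
    then show ?thesis using assms(3) that unfolding \<phi>_def by blast
  qed
  have "inj_on \<phi> A" using \<phi> assms(1,3) by (auto simp: inj_on_def)
  moreover have "\<phi> ` A = B" using \<phi> assms(1,2) by (auto simp: image_image)
  ultimately show ?thesis using \<phi> unfolding bij_betw_def by blast
qed

theorem theorem5:
  fixes U :: "'u set set" and R :: "(int^2^2) set"
  assumes "set_universe U" and "representatives R"
  shows "(\<exists>\<phi>. bij_betw \<phi> double_quotient (point_classes U) \<and>
             (\<forall>x\<in>Xhat. \<forall>y\<in>x.
                \<phi> (double_coset (map_matrix zhat_to_adele y)) = point_class U R x)) \<and>
         (\<exists>\<psi>. bij_betw \<psi> (point_classes U) group_classes \<and>
             (\<forall>x\<in>Xhat. \<psi> (point_class U R x) = group_iso `` {group_of R x}))"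
proof -
  note U = assms(1)
  define D where "D y = double_coset (adm y)" for y
  define P where "P y = point_class U R (GL_orbit y)" for y
  define G where "G y = group_iso `` {group_at (adm y)}" for y
  have pres: "presentation U (group_at (adm y)) (point_of R (GL_orbit y))
      (profinite_point.frame_elem R y)" for y
    by (rule profinite_point.point_of_presentation[OF _ U]) (unfold_locales, rule assms(2))
  have grp: "group_of R (GL_orbit y) = group_at (adm y)" for y
    by (rule profinite_point.group_of_eq) (unfold_locales, rule assms(2))
  have pt: "point_of R (GL_orbit y) \<in> points U" for y by (rule presentation.presented_point[OF pres])
  have GG: "G y = G z \<longleftrightarrow> (group_at (adm y), group_at (adm z)) \<in> group_iso" for y z
    unfolding G_def by (rule eq_equiv_class_iff[OF equiv_group_iso group_at_intermediate
        group_at_intermediate])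
  have PG: "P y = P z \<longleftrightarrow> G y = G z" for y z
    unfolding P_def point_class_def GG eq_equiv_class_iff[OF equiv_point_iso[OF U] pt pt]
    by (rule presentations_iso_iff[OF pres pres])
  have DP: "D y = D z \<longleftrightarrow> P y = P z" for y z
    unfolding PG GG D_def by (rule double_coset_eq_iff)
  have exists: "\<exists>y. group_at (adm y) = A" if "A \<in> intermediate_groups" for A
    using universal_matrix[OF that] by metis
  have Pim: "point_classes U = P ` UNIV"
  proof (intro equalityI subsetI)
    fix c assume "c \<in> point_classes U"
    then obtain F where F: "F \<in> points U" "c = point_iso U `` {F}" by (auto simp: point_classes_def
        elim: quotientE)
    obtain A \<theta> where FA: "presentation U A F \<theta>" using point_presentation[OF U F(1)] by blast
    obtain y where y: "group_at (adm y) = A" using exists presentation.A[OF FA] by blast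
    have "(A, A) \<in> group_iso"
      using equiv_group_iso presentation.A[OF FA] unfolding equiv_def refl_on_def by blast
    then have "(F, point_of R (GL_orbit y)) \<in> point_iso U" using presentations_iso_iff[OF FA
        pres[of y]] y by simp
    then have "c = P y" unfolding F(2) P_def point_class_def
        by (rule equiv_class_eq[OF equiv_point_iso[OF U]])
    then show "c \<in> P ` UNIV" by blast
  next
    fix c assume "c \<in> P ` UNIV"
    then show "c \<in> point_classes U" using pt by (auto simp: P_def point_class_def point_classes_def
        intro: quotientI)
  qed
  have Gim: "group_classes = G ` UNIV"
  proof (intro equalityI subsetI)
    fix c assume "c \<in> group_classes"
    then obtain A where "A \<in> intermediate_groups" "c = group_iso `` {A}"
        by (auto simp: group_classes_def elim: quotientE)
    then show "c \<in> G ` UNIV" using exists unfolding G_def by blast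
  next
    fix c assume "c \<in> G ` UNIV"
    then show "c \<in> group_classes"
      using group_at_intermediate by (auto simp: G_def group_classes_def intro: quotientI)
  qed
  have Dim: "double_quotient = D ` UNIV" unfolding D_def by (rule double_quotient_integral)
  obtain \<phi> where \<phi>: "bij_betw \<phi> double_quotient (point_classes U)" "\<And>y. \<phi> (D y) = P y"
    using bij_betw_from_common_kernel[OF Dim Pim DP] by auto
  obtain \<psi> where \<psi>: "bij_betw \<psi> (point_classes U) group_classes" "\<And>y. \<psi> (P y) = G y"
    using bij_betw_from_common_kernel[OF Pim Gim PG] by auto
  have "\<phi> (double_coset (adm y)) = point_class U R x" if "x \<in> Xhat" "y \<in> x" for x y
    using \<phi>(2)[of y] Xhat_orbit[OF that] by (simp add: D_def P_def)
  moreover have "\<psi> (point_class U R x) = group_iso `` {group_of R x}" if "x \<in> Xhat" for x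
  proof -
    obtain y where "x = GL_orbit y" using \<open>x \<in> Xhat\<close> by (auto simp: Xhat_def)
    then show ?thesis using \<psi>(2)[of y] by (simp add: P_def G_def grp)
  qed
  ultimately show ?thesis using \<phi>(1) \<psi>(1) by blast
qed

end
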